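(* Let $\omega\in S_n$ and $1\le k\le n-1$. Then $$[\widehat{\mathbf w}_{\omega s_k}]=\begin{cases}s_k^\mu[\widehat{\mathbf w}_{\omega}]\cdot\delta\big(\frac{\gamma_{k+1}}{\gamma_k},\frac{\mu_{k+1}}{\mu_k}\big)-s_k^\mu s_k^\gamma[\widehat{\mathbf w}_{\omega}]\cdot\delta\big(\frac{\gamma_{k+1}}{\gamma_k},h\big)&\text{if }\ell(\omega s_k)>\ell(\omega),\\[8pt] s_k^\mu[\widehat{\mathbf w}_{\omega}]\cdot\dfrac{\delta(\frac{\gamma_{k+1}}{\gamma_k},\frac{\mu_{k+1}}{\mu_k})}{\delta(\frac{\mu_k}{\mu_{k+1}},h)\delta(\frac{\mu_{k+1}}{\mu_k},h)}-s_k^\mu s_k^\gamma[\widehat{\mathbf w}_{\omega}]\cdot\dfrac{\delta(\frac{\gamma_{k+1}}{\gamma_k},h)}{\delta(\frac{\mu_k}{\mu_{k+1}},h)\delta(\frac{\mu_{k+1}}{\mu_k},h)}&\text{if }\ell(\omega s_k)<\ell(\omega),\end{cases}$$ or equivalently, using the normalization $$\widehat{\mathbf w}'_{\omega}=\widehat{\mathbf w}_{\omega}\cdot\frac1{\prod_{i<j,\ \omega(i)>\omega(j)}\delta(\frac{\mu_i}{\mu_j},h)},$$ we have $$[\widehat{\mathbf w}'_{\omega s_k}]=s_k^\mu[\widehat{\mathbf w}'_{\omega}]\cdot\frac{\delta(\frac{\gamma_{k+1}}{\gamma_k},\frac{\mu_{k+1}}{\mu_k})}{\delta(\frac{\mu_k}{\mu_{k+1}},h)}-s_k^\mu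 s_k^\gamma[\widehat{\mathbf w}'_{\omega}]\cdot\frac{\delta(\frac{\gamma_{k+1}}{\gamma_k},h)}{\delta(\frac{\mu_k}{\mu_{k+1}},h)}.$$
   Context: $\vartheta(x)=x^{1/2}(1-x^{-1})\prod_{m\ge1}(1-q^mx)(1-q^m/x)$, $\vartheta'(1)$ is its derivative at $x=1$, $\delta(a,b)=\frac{\vartheta(ab)\vartheta'(1)}{\vartheta(a)\vartheta(b)}$. $S_n$ is the symmetric group with length function $\ell$, $s_k$ the transposition of $k$ and $k+1$; $\omega\sigma$ means first $\sigma$, then $\omega$. Weight functions: for $\omega\in S_n$ and $k=1,\dots,n$ let $\{\omega(1),\dots,\omega(k)\}=\{\omega^{(k)}_1<\dots<\omega^{(k)}_k\}$; define $j_\omega(k,a)$ by $\omega^{(k)}_a=\omega(j_\omega(k,a))$; for $k\le n-1$ let $c_\omega(k,a)=0$ if $\omega(k+1)\ge\omega^{(k)}_a$ and $c_\omega(k,a)=1$ if $\omega(k+1)<\omega^{(k)}_a$. With variables $t^{(k)}_a$ ($1\le a\le k\le n$), $\mu_1,\dots,\mu_n$, $h$, put $$\mathbf w_\omega=\left(\tfrac{\vartheta(h)}{\vartheta'(1)}\right)^{\frac{(n-1)n(2n-1)}6}\frac{\mathrm{Sym}_{t^{(1)}}\cdots\mathrm{Sym}_{t^{(n-1)}}U_\omega}{\prod_{k=1}^{n-1}\prod_{i,j=1}^k\vartheta(ht^{(k)}_i/t^{(k)}_j)},$$ where $\mathrm{Sym}_{t^{(k)}}f=\sum_{\sigma\in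 S_k}f(t^{(k)}_{\sigma(1)},\dots,t^{(k)}_{\sigma(k)})$, $$U_\omega=\prod_{k=1}^{n-1}\prod_{a=1}^k\left(\prod_{c=1}^{k+1}\psi_{\omega,k,a,c}(t^{(k+1)}_c/t^{(k)}_a)\prod_{b=a+1}^k\delta(t^{(k)}_b/t^{(k)}_a,h)\right),$$ and $\psi_{\omega,k,a,c}(x)=\vartheta(x)\cdot\delta(x,h)$ if $\omega^{(k+1)}_c<\omega^{(k)}_a$; $=\vartheta(x)\cdot\delta\big(x,h^{1-c_\omega(k,a)}\frac{\mu_{k+1}}{\mu_{j_\omega(k,a)}}\big)$ if $\omega^{(k+1)}_c=\omega^{(k)}_a$; $=\vartheta(x)$ if $\omega^{(k+1)}_c>\omega^{(k)}_a$. The modified weight function $\widehat{\mathbf w}_\omega(\gamma,z,\mu,h)$ is obtained from $\mathbf w_\omega$ by substituting $t^{(k)}_a=\gamma_a$ for $k=1,\dots,n-1$ and $t^{(n)}_a=z_a$. Classes: $[f]$ denotes the class of a function $f(\gamma,z,\mu,h)$ in the (completed, extended by $\mu,h,q$) equivariant K theory ring of the full flag variety of $\mathbb C^n$, presented as functions in $\gamma_1,\dots,\gamma_n,z_1,\dots,z_n$ modulo those whose substitutions $\gamma_k=z_{\sigma(k)}$ ($k=1,\dots,n$) vanish for all $\sigma\in S_n$; thus an equality of classes means equality of the restrictions $f|_{\gamma_k=z_{\sigma(k)}}$ for all $\sigma\in S_n$. $s_k^\mu$ interchanges $\mu_k$ and $\mu_{k+1}$; $s_k^\gamma$ interchanges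 $\gamma_k$ and $\gamma_{k+1}$, i.e. on tuples of restrictions it is $\{f_\sigma\}_\sigma\mapsto\{f_{\sigma s_k}\}_\sigma$. *)

theory Defs
  imports
    "HOL-Analysis.Analysis"
    "HOL-Combinatorics.Combinatorics"
    "HOL-Library.Function_Algebras"
begin

section \<open>The theta function\<close>

text \<open>
  The factor \<open>x\<^sup>1\<^sup>/\<^sup>2\<close> makes the theta function two-valued in \<open>x\<close>. Throughout, every variable
  (\<open>z\<^sub>i\<close>, \<open>\<gamma>\<^sub>i\<close>, \<open>\<mu>\<^sub>i\<close>, \<open>h\<close>, \<open>t\<close>) is therefore represented by a nonzero complex number that is a
  \<^emph>\<open>square root\<close> of its value: \<open>theta q X\<close> is \<open>\<vartheta>(X\<^sup>2)\<close> with \<open>(X\<^sup>2)\<^sup>1\<^sup>/\<^sup>2 = X\<close>. Products and quotients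
  of variables correspond to products and quotients of their roots, so that arguments such as
  \<open>z\<^sub>c/\<gamma>\<^sub>a\<close> or \<open>h\<mu>\<^sub>i/\<mu>\<^sub>j\<close> are written as usual. The parameter \<open>q\<close> is an ordinary complex number
  with \<open>\<bar>q\<bar> < 1\<close>.
\<close>

definition theta :: "complex \<Rightarrow> complex \<Rightarrow> complex" where
  "theta q X = X * (1 - 1 / X\<^sup>2) *
     (\<Prod>m. (1 - q ^ Suc m * X\<^sup>2) * (1 - q ^ Suc m / X\<^sup>2))"

text \<open>
  The derivative of \<open>\<vartheta>(x)\<close> at \<open>x = 1\<close> with respect to \<open>x\<close> itself (not to its square root), for the
  branch of \<open>x\<^sup>1\<^sup>/\<^sup>2\<close> that is \<open>1\<close> at \<open>x = 1\<close>.
\<close>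

definition theta'1 :: "complex \<Rightarrow> complex" where
  "theta'1 q = deriv (\<lambda>x. theta q (csqrt x)) 1"

definition delta :: "complex \<Rightarrow> complex \<Rightarrow> complex \<Rightarrow> complex" where
  "delta q a b = theta q (a * b) * theta'1 q / (theta q a * theta q b)"

text \<open>
  The product \<open>\<vartheta>(x) \<cdot> \<delta>(x,y)\<close> as a function that is regular in \<open>x\<close>: the zero of \<open>\<vartheta>(x)\<close> at \<open>x = 1\<close>
  cancels the pole of \<open>\<delta>(x,y)\<close>. The cancelled form is needed because the value \<open>x = 1\<close> occurs when
  the modified weight functions are formed and when they are restricted to \<open>\<gamma>\<^sub>k = z\<^sub>\<sigma>\<^sub>(\<^sub>k\<^sub>)\<close>.
\<close>

definition theta_delta :: "complex \<Rightarrow> complex \<Rightarrow> complex \<Rightarrow> complex" where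
  "theta_delta q x y = theta q (x * y) * theta'1 q / theta q y"

lemma theta_delta_eq: "theta q x \<noteq> 0 \<Longrightarrow> theta_delta q x y = theta q x * delta q x y"
  by (simp add: theta_delta_def delta_def)


section \<open>Permutations\<close>

text \<open>Elements of \<open>S\<^sub>n\<close> are functions \<open>\<omega> :: nat \<Rightarrow> nat\<close> with \<open>\<omega> permutes {1..n}\<close>.\<close>

definition sk :: "nat \<Rightarrow> nat \<Rightarrow> nat" where
  "sk k = Transposition.transpose k (k + 1)"

text \<open>Coxeter length: the least length of a word in \<open>s\<^sub>1, \<dots>, s\<^sub>n\<^sub>-\<^sub>1\<close> representing \<open>\<omega>\<close>.\<close>

definition perm_length :: "nat \<Rightarrow> (nat \<Rightarrow> nat) \<Rightarrow> nat" where
  "perm_length n \<omega> =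
     (LEAST m. \<exists>ks. length ks = m \<and> set ks \<subseteq> {1..<n} \<and> \<omega> = foldr (\<lambda>k \<pi>. sk k \<circ> \<pi>) ks id)"


section \<open>Weight functions\<close>

text \<open>\<open>\<omega>\<^sup>(\<^sup>k\<^sup>)\<^sub>a\<close>, the \<open>a\<close>-th smallest element (counted from 1) of \<open>{\<omega>(1), \<dots>, \<omega>(k)}\<close>.\<close>

definition omega_sorted :: "(nat \<Rightarrow> nat) \<Rightarrow> nat \<Rightarrow> nat \<Rightarrow> nat" where
  "omega_sorted \<omega> k a = sorted_list_of_set (\<omega> ` {1..k}) ! (a - 1)"

definition j_index :: "(nat \<Rightarrow> nat) \<Rightarrow> nat \<Rightarrow> nat \<Rightarrow> nat" where
  "j_index \<omega> k a = (THE j. j \<in> {1..k} \<and> \<omega> j = omega_sorted \<omega> k a)"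

definition c_index :: "(nat \<Rightarrow> nat) \<Rightarrow> nat \<Rightarrow> nat \<Rightarrow> nat" where
  "c_index \<omega> k a = (if \<omega> (k + 1) \<ge> omega_sorted \<omega> k a then 0 else 1)"

definition psi ::
  "complex \<Rightarrow> (nat \<Rightarrow> complex) \<Rightarrow> complex \<Rightarrow> (nat \<Rightarrow> nat) \<Rightarrow> nat \<Rightarrow> nat \<Rightarrow> nat \<Rightarrow> complex \<Rightarrow> complex"
where
  "psi q \<mu> h \<omega> k a c x =
     (if omega_sorted \<omega> (k + 1) c < omega_sorted \<omega> k a then theta_delta q x h
      else if omega_sorted \<omega> (k + 1) c = omega_sorted \<omega> k a
        then theta_delta q x (h ^ (1 - c_index \<omega> k a) * \<mu> (k + 1) / \<mu> (j_index \<omega> k a))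
      else theta q x)"

text \<open>Below, \<open>t k a\<close> is the variable \<open>t\<^sup>(\<^sup>k\<^sup>)\<^sub>a\<close>.\<close>

definition U_fun ::
  "complex \<Rightarrow> nat \<Rightarrow> (nat \<Rightarrow> nat) \<Rightarrow> (nat \<Rightarrow> complex) \<Rightarrow> complex \<Rightarrow> (nat \<Rightarrow> nat \<Rightarrow> complex) \<Rightarrow> complex"
where
  "U_fun q n \<omega> \<mu> h t =
     (\<Prod>k\<in>{1..<n}. \<Prod>a\<in>{1..k}.
        (\<Prod>c\<in>{1..k + 1}. psi q \<mu> h \<omega> k a c (t (k + 1) c / t k a)) *
        (\<Prod>b\<in>{a + 1..k}. delta q (t k b / t k a) h))"

definition Sym ::
  "nat \<Rightarrow> ((nat \<Rightarrow> nat \<Rightarrow> complex) \<Rightarrow> complex) \<Rightarrow> (nat \<Rightarrow> nat \<Rightarrow> complex) \<Rightarrow> complex"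
where
  "Sym k f t = (\<Sum>\<sigma> | \<sigma> permutes {1..k}. f (t(k := t k \<circ> \<sigma>)))"

definition weight ::
  "complex \<Rightarrow> nat \<Rightarrow> (nat \<Rightarrow> nat) \<Rightarrow> (nat \<Rightarrow> complex) \<Rightarrow> complex \<Rightarrow> (nat \<Rightarrow> nat \<Rightarrow> complex) \<Rightarrow> complex"
where
  "weight q n \<omega> \<mu> h t =
     (theta q h / theta'1 q) ^ ((n - 1) * n * (2 * n - 1) div 6) *
     (foldr Sym [1..<n] (U_fun q n \<omega> \<mu> h) t /
      (\<Prod>k\<in>{1..<n}. \<Prod>i\<in>{1..k}. \<Prod>j\<in>{1..k}. theta q (h * t k i / t k j)))"

text \<open>Functions of \<open>\<gamma>\<close>, \<open>z\<close>, \<open>\<mu>\<close> and \<open>h\<close>, in this order.\<close>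

type_synonym kfun =
  "(nat \<Rightarrow> complex) \<Rightarrow> (nat \<Rightarrow> complex) \<Rightarrow> (nat \<Rightarrow> complex) \<Rightarrow> complex \<Rightarrow> complex"

definition weight_hat :: "complex \<Rightarrow> nat \<Rightarrow> (nat \<Rightarrow> nat) \<Rightarrow> kfun" where
  "weight_hat q n \<omega> = (\<lambda>\<gamma> z \<mu> h. weight q n \<omega> \<mu> h (\<lambda>k. if k = n then z else \<gamma>))"

definition weight_hat_norm :: "complex \<Rightarrow> nat \<Rightarrow> (nat \<Rightarrow> nat) \<Rightarrow> kfun" where
  "weight_hat_norm q n \<omega> = (\<lambda>\<gamma> z \<mu> h. weight_hat q n \<omega> \<gamma> z \<mu> h *
     (1 / (\<Prod>(i, j) | i \<in> {1..n} \<and> j \<in> {1..n} \<and> i < j \<and> \<omega> i > \<omega> j. delta q (\<mu> i / \<mu> j) h)))"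


section \<open>Classes\<close>

text \<open>
  All functions here are meromorphic in the parameters \<open>(z, \<mu>, h)\<close> after restriction. They are
  compared at all parameter values at which none of the theta functions occurring in a denominator
  vanishes; this is the complement of a proper analytic hypersurface, invariant under permutations
  of the \<open>z\<^sub>i\<close> and of the \<open>\<mu>\<^sub>i\<close>. (The factor \<open>\<vartheta>'(1) = \<Prod>(1 - q\<^sup>m)\<^sup>2\<close> is never zero.)
\<close>

definition generic :: "complex \<Rightarrow> nat \<Rightarrow> (nat \<Rightarrow> complex) \<Rightarrow> (nat \<Rightarrow> complex) \<Rightarrow> complex \<Rightarrow> bool" where
  "generic q n z \<mu> h \<longleftrightarrow>
     h \<noteq> 0 \<and> theta q h \<noteq> 0 \<and>
     (\<forall>i\<in>{1..n}. z i \<noteq> 0 \<and> \<mu> i \<noteq> 0) \<and>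
     (\<forall>i\<in>{1..n}. \<forall>j\<in>{1..n}. i \<noteq> j \<longrightarrow>
        theta q (z i / z j) \<noteq> 0 \<and> theta q (h * z i / z j) \<noteq> 0 \<and>
        theta q (\<mu> i / \<mu> j) \<noteq> 0 \<and> theta q (h * \<mu> i / \<mu> j) \<noteq> 0)"

text \<open>
  The class of \<open>f\<close> is represented by the tuple, indexed by \<open>\<sigma> \<in> S\<^sub>n\<close>, of its restrictions to
  \<open>\<gamma>\<^sub>k = z\<^sub>\<sigma>\<^sub>(\<^sub>k\<^sub>)\<close>, as functions of \<open>z\<close>, \<open>\<mu>\<close>, \<open>h\<close>. Setting the tuple to zero when \<open>\<sigma> \<notin> S\<^sub>n\<close> or when the
  parameters are not generic makes equality of classes coincide with HOL equality, and sums and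
  products of classes with the pointwise operations of \<^theory>\<open>HOL-Library.Function_Algebras\<close>.
\<close>

type_synonym kclass =
  "(nat \<Rightarrow> nat) \<Rightarrow> (nat \<Rightarrow> complex) \<Rightarrow> (nat \<Rightarrow> complex) \<Rightarrow> complex \<Rightarrow> complex"

definition cls :: "complex \<Rightarrow> nat \<Rightarrow> kfun \<Rightarrow> kclass" where
  "cls q n f = (\<lambda>\<sigma> z \<mu> h.
     if \<sigma> permutes {1..n} \<and> generic q n z \<mu> h then f (z \<circ> \<sigma>) z \<mu> h else 0)"

lemma cls_eq_iff:
  "cls q n f = cls q n g \<longleftrightarrow>
   (\<forall>\<sigma> z \<mu> h. \<sigma> permutes {1..n} \<longrightarrow> generic q n z \<mu> h \<longrightarrow> f (z \<circ> \<sigma>) z \<mu> h = g (z \<circ> \<sigma>) z \<mu> h)"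
  by (auto simp: cls_def fun_eq_iff)

lemma cls_mult: "cls q n (f * g) = cls q n f * cls q n g"
  and cls_diff: "cls q n (f - g) = cls q n f - cls q n g"
  by (auto simp: cls_def fun_eq_iff)

definition s_mu :: "nat \<Rightarrow> kclass \<Rightarrow> kclass" where
  "s_mu k F = (\<lambda>\<sigma> z \<mu> h. F \<sigma> z (\<mu> \<circ> sk k) h)"

definition s_gamma :: "nat \<Rightarrow> kclass \<Rightarrow> kclass" where
  "s_gamma k F = (\<lambda>\<sigma>. F (\<sigma> \<circ> sk k))"

end

theory Submission
  imports Defs
begin

text \<open>
  Exchanging two adjacent \<^emph>\<open>values\<close> \<open>j, j+1\<close> of \<open>\<omega>\<close> changes the weight function by an operator \<open>L\<close>
  (an R-matrix) that interchanges \<open>z\<^sub>j, z\<^sub>j\<^sub>+\<^sub>1\<close>, with coefficients in \<open>z\<close> and \<open>\<mu>\<close>: this relation is passed from one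
  level of variables to the next by an identity in four variables, which is two instances of the
  addition formula for \<open>\<vartheta>\<close>. The recursion to be proved is given by an operator \<open>R\<close> that
  acts on \<open>\<gamma>\<close>, with coefficients in \<open>\<gamma>\<close> and \<open>\<mu>\<close>. So \<open>L\<close> and \<open>R\<close> commute, and \<open>R\<close> is an involution for
  the normalized functions. As every permutation is reached from the identity by exchanging adjacent values,
  only \<open>\<omega> = id\<close> remains. There the restrictions to \<open>\<sigma> \<noteq> id\<close> vanish, and the restriction to
  \<open>\<sigma> = id\<close> is antisymmetric in \<open>z\<close> and does not depend on \<open>\<mu>\<close>.
  The addition formula is a Pluecker relation, because by the triple product
  \<open>\<vartheta>(xy)\<vartheta>(x/y)\<close> is a \<open>2 \<times> 2\<close> determinant.
\<close>

section \<open>The addition formula for the theta function\<close>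

text \<open>The exchange of values holds for arbitrary variables at the top level, so it can be
  proved by induction on the levels. The exchange of positions is claimed only after restriction to
  \<gamma> = z o \<sigma>; it is therefore transported along exchanges of values instead of being
  proved level by level. Commutation of L and R does not cover one case. If the two values stand at
  the positions k and k+1, then L leads from \<omega> to \<omega> o s_k itself, and the commuting
  square would need L at \<omega> o s_k, where the larger value comes first. Here the involution
  property takes over. It depends on the normalization: with m = \<mu>_(k+1)/\<mu>_k, the
  unnormalized operator has the square delta(m,h) delta(1/m,h), a scalar free of \<gamma>, again by
  the addition formula. The denominator of \<open>weight\<close> depends on \<gamma> alone once the
  lower variables are set to \<gamma>, so the exchange of values is a statement about
  numerators.\<close>

definition q_fact :: "complex \<Rightarrow> nat \<Rightarrow> complex" where
  "q_fact q n = (\<Prod>i<n. 1 - q ^ Suc i)"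

lemma one_minus_power_nonzero: "norm q < 1 \<Longrightarrow> 1 - q ^ Suc i \<noteq> (0 :: complex)"
proof
  assume "norm q < 1" and "1 - q ^ Suc i = 0"
  then have "norm q ^ Suc i = 1" by (metis eq_iff_diff_eq_0 norm_one norm_power)
  then show False using \<open>norm q < 1\<close> power_less_one_iff[of "norm q" "Suc i"] by simp
qed

lemma q_fact_nonzero: "norm q < 1 \<Longrightarrow> q_fact q n \<noteq> 0"
  unfolding q_fact_def using one_minus_power_nonzero by (simp del: power_Suc right_minus_eq)

lemma q_fact_Suc: "q_fact q (Suc n) = q_fact q n * (1 - q ^ Suc n)"
  by (simp add: q_fact_def)

lemma q_fact_tendsto:
  assumes "norm q < 1"
  obtains L where "L \<noteq> 0" "q_fact q \<longlonglongrightarrow> L"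
proof -
  have "summable (\<lambda>i. norm ((1 - q ^ Suc i) - 1))"
    using assms by (simp add: norm_mult norm_power summable_mult summable_geometric)
  then have c: "convergent_prod (\<lambda>i. 1 - q ^ Suc i)"
    by (intro abs_convergent_prod_imp_convergent_prod summable_imp_abs_convergent_prod)
  have "(\<lambda>n. \<Prod>i\<le>n. 1 - q ^ Suc i) \<longlonglongrightarrow> prodinf (\<lambda>i. 1 - q ^ Suc i)"
    by (rule convergent_prod_LIMSEQ[OF c])
  then have "(\<lambda>n. q_fact q (Suc n)) \<longlonglongrightarrow> prodinf (\<lambda>i. 1 - q ^ Suc i)"
    by (simp add: q_fact_def lessThan_Suc_atMost del: power_Suc prod.lessThan_Suc)
  moreover have "prodinf (\<lambda>i. 1 - q ^ Suc i) \<noteq> 0"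
    by (rule prodinf_nonzero[OF c one_minus_power_nonzero[OF assms]])
  ultimately show ?thesis
    using that LIMSEQ_imp_Suc by blast
qed

text \<open>Since \<open>q_fact q n\<close> is (q;q)_n, this is, up to sign and a power of q, the
  Gaussian binomial coefficient of 2N+1 over N-n. For fixed n it tends to (-1)^n q^(n(n+1)/2) /
  (q;q)_infinity.\<close>

definition triangle_coeff :: "complex \<Rightarrow> nat \<Rightarrow> nat \<Rightarrow> complex" where
  "triangle_coeff q N n =
     (if n \<le> N then (-1) ^ n * q ^ (n * (n + 1) div 2) * q_fact q (2 * N + 1) *
        inverse (q_fact q (N - n)) * inverse (q_fact q (N + n + 1))
      else 0)"

lemma triangular_Suc: "Suc n * (Suc n + 1) div 2 = n * (n + 1) div 2 + Suc n"
  by simp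

lemma inverse_q_fact:
  "norm q < 1 \<Longrightarrow> inverse (q_fact q n) = inverse (q_fact q (Suc n)) * (1 - q ^ Suc n)"
  using one_minus_power_nonzero[of q n] q_fact_nonzero[of q n] by (simp add: q_fact_Suc field_simps)

lemma triangle_coeff_self:
  "norm q < 1 \<Longrightarrow> triangle_coeff q N N = (-1) ^ N * q ^ (N * (N + 1) div 2)"
  using q_fact_nonzero[of q "2 * N + 1"] by (simp add: triangle_coeff_def q_fact_def[of q 0] flip: mult_2)

text \<open>The next pair of factors in the product equals 1 + Q^2 - Q (X^2 + 1/X^2) with Q =
  q^(N+1), and this is the resulting recurrence of coefficients. For n < N every term carries the
  common factor \<open>t * G\<close>, and a polynomial identity in q, q^n and q^M remains.\<close>

lemma triangle_coeff_rec:
  assumes "norm q < 1"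
  shows "triangle_coeff q (Suc N) (Suc n) = (1 + q ^ (2 * Suc N)) * triangle_coeff q N (Suc n)
           - q ^ Suc N * (triangle_coeff q N n + triangle_coeff q N (Suc (Suc n)))"
proof -
  consider "n > N" | "n = N" | M where "N = M + Suc n"
  proof -
    have "n > N \<or> n = N \<or> (\<exists>M. N = M + Suc n)" by presburger
    then show ?thesis using that by blast
  qed
  then show ?thesis
  proof cases
    case 1
    then show ?thesis by (simp add: triangle_coeff_def)
  next
    case 2
    have "triangle_coeff q N (Suc n) = 0" "triangle_coeff q N (Suc (Suc n)) = 0"
      using 2 by (simp_all add: triangle_coeff_def)
    then show ?thesis
      unfolding 2 triangle_coeff_self[OF assms] triangular_Suc power_add by simp
  next
    case (3 M)
    define B where "B = M + 2 * n + 2"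
    define t where "t = (-1) ^ n * q ^ (n * (n + 1) div 2) * q_fact q (2 * N + 1)"
    define G where "G = inverse (q_fact q (Suc M)) * inverse (q_fact q (Suc (Suc B)))"
    have e: "2 * Suc N + 1 = Suc (Suc (2 * N + 1))" "Suc N + Suc n + 1 = Suc (Suc B)"
      "N + n + 1 = B" "N + Suc n + 1 = Suc B" "N + Suc (Suc n) + 1 = Suc (Suc B)"
      "Suc N - Suc n = Suc M" "N - n = Suc M" "N - Suc n = M"
      using 3 by (auto simp: B_def)
    have le: "Suc n \<le> Suc N" "Suc n \<le> N" "n \<le> N" using 3 by auto
    have c1: "triangle_coeff q (Suc N) (Suc n) =
        - (t * q ^ Suc n * (1 - q ^ Suc (2 * N + 1)) * (1 - q ^ Suc (Suc (2 * N + 1))) * G)"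
      unfolding triangle_coeff_def if_P[OF le(1)] e triangular_Suc q_fact_Suc[of q "Suc (2 * N + 1)"]
        q_fact_Suc[of q "2 * N + 1"] t_def G_def power_add power_Suc[of "-1"]
      by (simp only: mult_ac mult_minus_left mult_minus_right mult_1_right mult_1_left)
    have c2: "triangle_coeff q N (Suc n) = - (t * q ^ Suc n * (1 - q ^ Suc M) * (1 - q ^ Suc (Suc B)) * G)"
      unfolding triangle_coeff_def if_P[OF le(2)] e triangular_Suc
         inverse_q_fact[OF assms, of M] inverse_q_fact[OF assms, of "Suc B"] t_def G_def power_add power_Suc[of "-1"]
      by (simp only: mult_ac mult_minus_left mult_minus_right mult_1_right mult_1_left)
    have c3: "triangle_coeff q N n = t * (1 - q ^ Suc B) * (1 - q ^ Suc (Suc B)) * G"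
      unfolding triangle_coeff_def if_P[OF le(3)] e
         inverse_q_fact[OF assms, of B] inverse_q_fact[OF assms, of "Suc B"] t_def G_def
      by (simp only: mult_ac)
    \<comment> \<open>For M = 0 the coefficient is zero by the convention in
      \<open>triangle_coeff\<close>, in agreement with the factor 1 - q^M.\<close>
    have c4: "triangle_coeff q N (Suc (Suc n)) = t * q ^ Suc n * q ^ Suc (Suc n) * (1 - q ^ M) * (1 - q ^ Suc M) * G"
    proof (cases M)
      case 0
      then show ?thesis using 3 by (simp add: triangle_coeff_def)
    next
      case (Suc M')
      have le: "Suc (Suc n) \<le> N" and e': "N - Suc (Suc n) = M'" using 3 Suc by auto
      show ?thesis
        unfolding triangle_coeff_def if_P[OF le] e e' triangular_Suc inverse_q_fact[OF assms, of M']
          inverse_q_fact[OF assms, of "Suc M'"] t_def G_def Suc power_add power_Suc[of "-1"]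
        by (simp only: mult_ac mult_minus_left mult_minus_right mult_1_right mult_1_left minus_minus)
    qed
    define a where "a = q ^ n"
    define b where "b = q ^ M"
    have p: "q ^ N = b * a * q" "q ^ B = b * a * a * q * q" "q ^ (2 * N + 1) = b * b * a * a * q * q * q"
       "q ^ (2 * Suc N) = b * b * a * a * q * q * q * q"
    proof -
      have *: "N = M + n + 1" "B = M + n + n + 1 + 1" "2 * N + 1 = M + M + n + n + 1 + 1 + 1"
        "2 * Suc N = M + M + n + n + 1 + 1 + 1 + 1"
        using 3 by (auto simp: B_def)
      show "q ^ N = b * a * q" "q ^ B = b * a * a * q * q" "q ^ (2 * N + 1) = b * b * a * a * q * q * q"
       "q ^ (2 * Suc N) = b * b * a * a * q * q * q * q"
        unfolding *(2-4) unfolding *(1) a_def b_def power_add by (simp_all only: mult_ac power_one_right)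
    qed
    show ?thesis
      unfolding c1 c2 c3 c4 power_Suc p a_def[symmetric] b_def[symmetric] by algebra
  qed
qed

text \<open>X^(2n+1) - X^(-2n-1) changes sign under n -> -n-1, so a coefficient of index -1 counts
  as minus the one of index 0. This is the sign in which the recurrence differs from
  \<open>triangle_coeff_rec\<close>.\<close>

lemma triangle_coeff_rec_0:
  assumes "norm q < 1"
  shows "triangle_coeff q (Suc N) 0 = (1 + q ^ (2 * Suc N)) * triangle_coeff q N 0
           - q ^ Suc N * (triangle_coeff q N (Suc 0) - triangle_coeff q N 0)"
proof -
  define F where "F = q_fact q (2 * N + 1)"
  define G where "G = inverse (q_fact q (Suc N)) * inverse (q_fact q (Suc (Suc N)))"
  have c1: "triangle_coeff q (Suc N) 0 = F * (1 - q ^ Suc (2 * N + 1)) * (1 - q ^ Suc (Suc (2 * N + 1))) * G"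
    by (simp add: triangle_coeff_def F_def G_def q_fact_Suc[of q "Suc (Suc (2 * N))"] q_fact_Suc[of q "Suc (2 * N)"]
        del: power_Suc)
  have c2: "triangle_coeff q N 0 = F * (1 - q ^ Suc N) * (1 - q ^ Suc (Suc N)) * G"
    using inverse_q_fact[OF assms, of N] inverse_q_fact[OF assms, of "Suc N"]
    by (simp add: triangle_coeff_def F_def G_def del: power_Suc)
  have c3: "triangle_coeff q N (Suc 0) = - (F * q * (1 - q ^ N) * (1 - q ^ Suc N) * G)"
  proof (cases N)
    case (Suc M)
    show ?thesis
      using inverse_q_fact[OF assms, of M] inverse_q_fact[OF assms, of "Suc M"]
      by (simp add: triangle_coeff_def F_def G_def Suc del: power_Suc)
  qed (simp add: triangle_coeff_def)
  define a where "a = q ^ N"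
  have p: "q ^ (2 * N + 1) = a * a * q" "q ^ (2 * Suc N) = a * a * q * q"
    by (simp_all add: a_def power_add mult_2)
  show ?thesis
    unfolding c1 c2 c3 power_Suc p a_def[symmetric] by algebra
qed

text \<open>Antisymmetry under X -> 1/X means that only the combinations \<open>s n\<close> occur.
  Multiplication by w = X^2 + 1/X^2 turns \<open>s n\<close> into s(n+1) + s(n-1), where s(-1) =
  -s(0), so the induction on N reduces to the recurrence of the coefficients.\<close>

lemma finite_triple_product:
  fixes X :: complex
  assumes "norm q < 1" and "X \<noteq> 0"
  shows "(X - 1 / X) * (\<Prod>m<N. (1 - q ^ Suc m * X\<^sup>2) * (1 - q ^ Suc m / X\<^sup>2)) =
    (\<Sum>n\<le>N. triangle_coeff q N n * (X ^ (2 * n + 1) - (1 / X) ^ (2 * n + 1)))"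
proof (induction N)
  case 0
  then show ?case by (simp add: triangle_coeff_def q_fact_def)
    (use one_minus_power_nonzero[OF assms(1), of 0] in simp)
next
  case (Suc N)
  define s where "s n = X ^ (2 * n + 1) - (1 / X) ^ (2 * n + 1)" for n
  define g where "g = triangle_coeff q N"
  define Q where "Q = q ^ Suc N"
  define w where "w = X\<^sup>2 + 1 / X\<^sup>2"
  have s0: "w * s 0 = s (Suc 0) - s 0"
    using assms(2) by (simp add: s_def w_def field_simps power2_eq_square)
  have sS: "w * s (Suc n) = s (Suc (Suc n)) + s n" for n
  proof -
    have "(X\<^sup>2 + Y\<^sup>2) * (X ^ (2 * Suc n + 1) - Y ^ (2 * Suc n + 1)) =
       X ^ (2 * Suc (Suc n) + 1) - Y ^ (2 * Suc (Suc n) + 1) + (X * Y)\<^sup>2 * (X ^ (2 * n + 1) - Y ^ (2 * n + 1))" for Y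
      by (simp add: algebra_simps power2_eq_square)
    from this[of "1 / X"] show ?thesis using assms(2) by (simp add: s_def w_def power_one_over)
  qed
  have QQ: "q ^ (2 * Suc N) = Q * Q" unfolding Q_def mult_2 power_add by simp
  have gN: "g (Suc N) = 0" "g (Suc (Suc N)) = 0" by (simp_all add: g_def triangle_coeff_def)
  have f: "(1 - q ^ Suc N * X\<^sup>2) * (1 - q ^ Suc N / X\<^sup>2) = 1 + Q * Q - Q * w"
    using assms(2) by (simp add: Q_def[symmetric] w_def field_simps del: power_Suc)
  have "(X - 1 / X) * (\<Prod>m<Suc N. (1 - q ^ Suc m * X\<^sup>2) * (1 - q ^ Suc m / X\<^sup>2)) =
     ((X - 1 / X) * (\<Prod>m<N. (1 - q ^ Suc m * X\<^sup>2) * (1 - q ^ Suc m / X\<^sup>2))) * (1 + Q * Q - Q * w)"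
    unfolding f[symmetric] by simp
  also have "\<dots> = (\<Sum>n\<le>N. g n * s n) * (1 + Q * Q - Q * w)"
    unfolding Suc.IH by (simp add: g_def s_def)
  also have "(\<Sum>n\<le>N. g n * s n) = (\<Sum>n\<le>Suc N. g n * s n)" by (simp add: gN)
  also have "\<dots> * (1 + Q * Q - Q * w) =
      (1 + Q * Q) * (\<Sum>n\<le>Suc N. g n * s n) - Q * (g 0 * (w * s 0) + (\<Sum>n\<le>N. g (Suc n) * (w * s (Suc n))))"
    unfolding sum.atMost_Suc_shift by (simp add: algebra_simps sum.distrib sum_subtractf sum_distrib_left sum_distrib_right)
  also have "(\<Sum>n\<le>N. g (Suc n) * (w * s (Suc n))) =
     (\<Sum>n\<le>N. g (Suc n) * s (Suc (Suc n))) + (\<Sum>n\<le>N. g (Suc n) * s n)"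
    unfolding sS by (simp add: algebra_simps sum.distrib)
  also have "(\<Sum>n\<le>N. g (Suc n) * s (Suc (Suc n))) = (\<Sum>n\<le>N. g n * s (Suc n)) - g 0 * s (Suc 0)"
    using sum.atMost_Suc_shift[of "\<lambda>n. g n * s (Suc n)" N] by (simp add: gN)
  also have "(\<Sum>n\<le>N. g (Suc n) * s n) = g (Suc 0) * s 0 + (\<Sum>n\<le>N. g (Suc (Suc n)) * s (Suc n))"
    using sum.atMost_Suc_shift[of "\<lambda>n. g (Suc n) * s n" N] by (simp add: gN)
  also have "(1 + Q * Q) * (\<Sum>n\<le>Suc N. g n * s n) - Q * (g 0 * (w * s 0) + ((\<Sum>n\<le>N. g n * s (Suc n)) -
      g 0 * s (Suc 0) + (g (Suc 0) * s 0 + (\<Sum>n\<le>N. g (Suc (Suc n)) * s (Suc n))))) =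
      ((1 + Q * Q) * g 0 - Q * (g (Suc 0) - g 0)) * s 0 +
      (\<Sum>n\<le>N. ((1 + Q * Q) * g (Suc n) - Q * (g n + g (Suc (Suc n)))) * s (Suc n))"
    unfolding s0 sum.atMost_Suc_shift by (simp add: algebra_simps sum.distrib sum_distrib_left sum_subtractf)
  also have "\<dots> = triangle_coeff q (Suc N) 0 * s 0 + (\<Sum>n\<le>N. triangle_coeff q (Suc N) (Suc n) * s (Suc n))"
    unfolding triangle_coeff_rec[OF assms(1)] triangle_coeff_rec_0[OF assms(1)] g_def[symmetric] QQ Q_def[symmetric]
    by (rule refl)
  also have "\<dots> = (\<Sum>n\<le>Suc N. triangle_coeff q (Suc N) n * s n)"
    unfolding sum.atMost_Suc_shift by simp
  finally show ?case unfolding s_def .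
qed

section \<open>Theta as an infinite series\<close>

lemma summable_triangular_power:
  fixes r R :: real
  assumes "0 \<le> r" "r < 1" "0 \<le> R"
  shows "summable (\<lambda>n. r ^ (n * (n + 1) div 2) * R ^ n)"
proof -
  have "(\<lambda>n. r ^ Suc n * R) \<longlonglongrightarrow> 0 * R"
    by (intro tendsto_mult tendsto_const LIMSEQ_Suc LIMSEQ_power_zero) (use assms in auto)
  then have "eventually (\<lambda>n. r ^ Suc n * R < 1/2) sequentially"
    by (intro order_tendstoD(2)[where y = 0]) auto
  then obtain N where N: "r ^ Suc n * R < 1/2" if "n \<ge> N" for n
    by (auto simp: eventually_sequentially)
  show ?thesis
  proof (rule summable_ratio_test[of "1/2" N])
    fix n assume "n \<ge> N"
    define t where "t = r ^ (n * (n + 1) div 2) * R ^ n"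
    have "t \<ge> 0" using assms by (simp add: t_def)
    have "r ^ (Suc n * (Suc n + 1) div 2) * R ^ Suc n = (r ^ Suc n * R) * t"
      unfolding triangular_Suc power_add t_def by simp
    also have "\<dots> \<le> 1/2 * t"
      using N[OF \<open>n \<ge> N\<close>] \<open>t \<ge> 0\<close> by (intro mult_right_mono) auto
    finally show "norm (r ^ (Suc n * (Suc n + 1) div 2) * R ^ Suc n) \<le> 1/2 * norm (r ^ (n * (n + 1) div 2) * R ^ n)"
      using assms \<open>t \<ge> 0\<close> by (simp add: t_def)
  qed simp
qed

lemma summable_theta_half:
  fixes q X :: complex
  assumes "norm q < 1"
  shows "summable (\<lambda>n. norm ((-1) ^ n * q ^ (n * (n + 1) div 2) * X ^ (2 * n + 1)))"
proof -
  have "norm ((-1) ^ n * q ^ (n * (n + 1) div 2) * X ^ (2 * n + 1)) =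
      norm X * (norm q ^ (n * (n + 1) div 2) * ((norm X)\<^sup>2) ^ n)" for n
    unfolding power_mult[symmetric] by (simp add: norm_mult norm_power)
  then show ?thesis
    using assms by (simp only:) (intro summable_mult summable_triangular_power; simp)
qed

text \<open>This is the limit of \<open>finite_triple_product\<close> for N to infinity. The
  constant L is (q;q)_infinity, the limit of \<open>q_fact\<close>.\<close>

lemma theta_series:
  assumes "norm q < 1"
  obtains L where "L \<noteq> 0" "\<And>X. X \<noteq> 0 \<Longrightarrow>
     L * theta q X = (\<Sum>n. (-1) ^ n * q ^ (n * (n + 1) div 2) * (X ^ (2 * n + 1) - (1 / X) ^ (2 * n + 1)))"
proof -
  obtain L where L: "L \<noteq> 0" "q_fact q \<longlonglongrightarrow> L"
    using q_fact_tendsto[OF assms] .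
  have "Bseq (q_fact q)" using L(2) convergentI convergent_imp_Bseq by blast
  then obtain K where K: "norm (q_fact q n) \<le> K" "K > 0" for n by (metis BseqE)
  have iL: "(\<lambda>n. inverse (q_fact q n)) \<longlonglongrightarrow> inverse L" by (rule tendsto_inverse[OF L(2,1)])
  have "Bseq (\<lambda>n. inverse (q_fact q n))"  using iL convergentI convergent_imp_Bseq by blast
  then obtain K' where K': "norm (inverse (q_fact q n)) \<le> K'" "K' > 0" for n by (metis BseqE)
  \<comment> \<open>One q-factorial in the numerator and two in the denominator leave L / (L *
    L).\<close>
  have lim: "(\<lambda>N. triangle_coeff q N n) \<longlonglongrightarrow> (-1) ^ n * q ^ (n * (n + 1) div 2) * inverse L" for n
  proof -
    have "(\<lambda>N. (-1) ^ n * q ^ (n * (n + 1) div 2) * q_fact q (2 * N + 1) *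
        inverse (q_fact q (N - n)) * inverse (q_fact q (N + n + 1))) \<longlonglongrightarrow>
        (-1) ^ n * q ^ (n * (n + 1) div 2) * L * inverse L * inverse L"
      by (intro tendsto_mult tendsto_const filterlim_compose[OF L(2)] filterlim_compose[OF iL];
          simp add: filterlim_at_top eventually_at_top_linorder; metis add.commute le_add2 le_diff_conv2 le_add_diff
            add_leD2 mult_2 trans_le_add1 trans_le_add2 le_SucI)
    moreover have "eventually (\<lambda>N. (-1) ^ n * q ^ (n * (n + 1) div 2) * q_fact q (2 * N + 1) *
        inverse (q_fact q (N - n)) * inverse (q_fact q (N + n + 1)) = triangle_coeff q N n) sequentially"
      unfolding eventually_sequentially by (rule exI[of _ n]) (simp add: triangle_coeff_def)
    ultimately have "(\<lambda>N. triangle_coeff q N n) \<longlonglongrightarrow> (-1) ^ n * q ^ (n * (n + 1) div 2) * L * inverse L * inverse L"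
      by (rule Lim_transform_eventually)
    then show ?thesis using L(1) by (simp only: mult.assoc right_inverse mult_1_right not_False_eq_True)
  qed
  \<comment> \<open>The bound is uniform in N, so that Tannery's theorem permits exchanging the
    limit with the sum over n.\<close>
  have bound: "norm (triangle_coeff q N n) \<le> K * K' * K' * norm q ^ (n * (n + 1) div 2)" for N n
  proof -
    have "norm q ^ (n * (n + 1) div 2) * (norm (q_fact q (2 * N + 1)) * norm (inverse (q_fact q (N - n))) *
            norm (inverse (q_fact q (N + n + 1)))) \<le> norm q ^ (n * (n + 1) div 2) * (K * K' * K')"
      by (intro mult_mono mult_left_mono K K') (use K K' in \<open>auto simp: less_imp_le\<close>)
    moreover have "0 \<le> K * K' * K' * norm q ^ (n * (n + 1) div 2)"
      using K(2) K'(2) by simp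
    ultimately show ?thesis
      by (simp add: triangle_coeff_def norm_mult norm_power mult_ac del: norm_inverse)
  qed
  have "L * theta q X = (\<Sum>n. (-1) ^ n * q ^ (n * (n + 1) div 2) * (X ^ (2 * n + 1) - (1 / X) ^ (2 * n + 1)))"
    if X: "X \<noteq> 0" for X
  proof -
    define s where "s n = X ^ (2 * n + 1) - (1 / X) ^ (2 * n + 1)" for n
    define f where "f m = (1 - q ^ Suc m * X\<^sup>2) * (1 - q ^ Suc m / X\<^sup>2)" for m
    have fm: "f m - 1 = q ^ m * (q ^ m * q\<^sup>2 - q * (X\<^sup>2 + 1 / X\<^sup>2))" for m
      using X by (simp add: f_def field_simps power2_eq_square)
    have "summable (\<lambda>m. norm (f m - 1))"
    proof (rule summable_comparison_test)
      show "\<exists>N. \<forall>m\<ge>N. norm (norm (f m - 1)) \<le> norm q ^ m * (1 + norm (q * (X\<^sup>2 + 1 / X\<^sup>2)))"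
      proof (intro exI allI impI)
        fix m
        have "norm (q ^ m * q\<^sup>2 - q * (X\<^sup>2 + 1 / X\<^sup>2)) \<le> norm (q ^ m * q\<^sup>2) + norm (q * (X\<^sup>2 + 1 / X\<^sup>2))"
          by (rule norm_triangle_ineq4)
        also have "norm (q ^ m * q\<^sup>2) \<le> 1"
          using power_le_one[of "norm q" "m + 2"] assms by (simp add: norm_mult norm_power power2_eq_square mult_ac)
        finally show "norm (norm (f m - 1)) \<le> norm q ^ m * (1 + norm (q * (X\<^sup>2 + 1 / X\<^sup>2)))"
          unfolding fm by (simp add: norm_mult norm_power mult_left_mono)
      qed
      show "summable (\<lambda>m. norm q ^ m * (1 + norm (q * (X\<^sup>2 + 1 / X\<^sup>2))))"
        using assms by (intro summable_mult2 summable_geometric) simp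
    qed
    then have "convergent_prod f"
      by (intro abs_convergent_prod_imp_convergent_prod summable_imp_abs_convergent_prod)
    then have "(\<lambda>N. \<Prod>m\<le>N. f m) \<longlonglongrightarrow> prodinf f"
      by (rule convergent_prod_LIMSEQ)
    then have "(\<lambda>N. \<Prod>m<N. f m) \<longlonglongrightarrow> prodinf f"
      unfolding lessThan_Suc_atMost[symmetric] by (rule LIMSEQ_imp_Suc)
    then have "(\<lambda>N. (X - 1 / X) * (\<Prod>m<N. f m)) \<longlonglongrightarrow> (X - 1 / X) * prodinf f"
      by (intro tendsto_mult tendsto_const)
    moreover have "(X - 1 / X) * prodinf f = theta q X"
      using X by (simp add: theta_def f_def[abs_def] power2_eq_square algebra_simps)
    moreover have "(X - 1 / X) * (\<Prod>m<N. f m) = (\<Sum>n. triangle_coeff q N n * s n)" for N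
    proof -
      have "(\<Sum>n\<le>N. triangle_coeff q N n * s n) = (\<Sum>n. triangle_coeff q N n * s n)"
        by (rule suminf_finite[symmetric]) (auto simp: triangle_coeff_def)
      then show ?thesis
        using finite_triple_product[OF assms X, of N] unfolding f_def s_def by simp
    qed
    ultimately have l1: "(\<lambda>N. \<Sum>n. triangle_coeff q N n * s n) \<longlonglongrightarrow> theta q X" by simp
    have sm: "summable (\<lambda>n. K * K' * K' * norm q ^ (n * (n + 1) div 2) * norm (s n))"
    proof (rule summable_comparison_test)
      show "\<exists>N. \<forall>n\<ge>N. norm (K * K' * K' * norm q ^ (n * (n + 1) div 2) * norm (s n)) \<le>
         K * K' * K' * (norm ((-1) ^ n * q ^ (n * (n + 1) div 2) * X ^ (2 * n + 1)) +
          norm ((-1) ^ n * q ^ (n * (n + 1) div 2) * (1 / X) ^ (2 * n + 1)))"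
      proof (intro exI allI impI)
        fix n
        have nn: "norm ((-1) ^ n * q ^ (n * (n + 1) div 2) * Z) = norm q ^ (n * (n + 1) div 2) * norm Z" for Z
          by (simp add: norm_mult norm_power)
        have "norm (s n) \<le> norm (X ^ (2 * n + 1)) + norm ((1 / X) ^ (2 * n + 1))"
          unfolding s_def by (rule norm_triangle_ineq4)
        then have "K * K' * K' * norm q ^ (n * (n + 1) div 2) * norm (s n) \<le>
            K * K' * K' * norm q ^ (n * (n + 1) div 2) * (norm (X ^ (2 * n + 1)) + norm ((1 / X) ^ (2 * n + 1)))"
          using K(2) K'(2) by (intro mult_left_mono) auto
        then show "norm (K * K' * K' * norm q ^ (n * (n + 1) div 2) * norm (s n)) \<le>
         K * K' * K' * (norm ((-1) ^ n * q ^ (n * (n + 1) div 2) * X ^ (2 * n + 1)) +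
          norm ((-1) ^ n * q ^ (n * (n + 1) div 2) * (1 / X) ^ (2 * n + 1)))"
          unfolding nn using K(2) K'(2) by (simp add: distrib_left mult.assoc)
      qed
      show "summable (\<lambda>n. K * K' * K' * (norm ((-1) ^ n * q ^ (n * (n + 1) div 2) * X ^ (2 * n + 1)) +
          norm ((-1) ^ n * q ^ (n * (n + 1) div 2) * (1 / X) ^ (2 * n + 1))))"
        by (intro summable_mult summable_add summable_theta_half assms)
    qed
    have "(\<lambda>N. \<Sum>n. triangle_coeff q N n * s n) \<longlonglongrightarrow> (\<Sum>n. ((-1) ^ n * q ^ (n * (n + 1) div 2) * inverse L) * s n)"
    proof (rule conjunct2[OF conjunct2[OF tannerys_theorem]])
      show "(\<lambda>N. triangle_coeff q N n * s n) \<longlonglongrightarrow> ((-1) ^ n * q ^ (n * (n + 1) div 2) * inverse L) * s n" for n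
        by (intro tendsto_mult lim tendsto_const)
      show "\<forall>\<^sub>F (n, N) in sequentially \<times>\<^sub>F sequentially. norm (triangle_coeff q N n * s n) \<le>
          K * K' * K' * norm q ^ (n * (n + 1) div 2) * norm (s n)"
        using bound by (intro always_eventually) (auto simp: norm_mult intro!: mult_right_mono)
    qed (simp_all add: sm[simplified])
    then have "theta q X = (\<Sum>n. inverse L * ((-1) ^ n * q ^ (n * (n + 1) div 2) * s n))"
      using LIMSEQ_unique[OF l1] by (simp add: mult_ac)
    also have "\<dots> = inverse L * (\<Sum>n. (-1) ^ n * q ^ (n * (n + 1) div 2) * s n)"
    proof (rule suminf_mult)
      have "summable (\<lambda>n. inverse (K * K' * K') * (K * K' * K' * norm q ^ (n * (n + 1) div 2) * norm (s n)))"
        by (intro summable_mult sm)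
      moreover have "inverse (K * K' * K') * (K * K' * K' * norm q ^ (n * (n + 1) div 2) * norm (s n)) =
          norm ((-1) ^ n * q ^ (n * (n + 1) div 2) * s n)" for n
        using K(2) K'(2) by (simp add: norm_mult norm_power field_simps)
      ultimately have "summable (\<lambda>n. norm ((-1) ^ n * q ^ (n * (n + 1) div 2) * s n))"
        by (simp only:)
      then show "summable (\<lambda>n. (-1) ^ n * q ^ (n * (n + 1) div 2) * s n)"
        by (rule summable_norm_cancel)
    qed
    finally show ?thesis using L(1) unfolding s_def by simp
  qed
  then show ?thesis using that L(1) by blast
qed

section \<open>The bilateral theta series and products of two of them\<close>

definition triangular :: "int \<Rightarrow> nat" where
  "triangular k = nat (k * (k + 1) div 2)"

definition theta_term :: "complex \<Rightarrow> complex \<Rightarrow> int \<Rightarrow> complex" where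
  "theta_term q X k = (-1) powi k * q ^ triangular k * X powi (2 * k + 1)"

lemma triangular_of_nat: "triangular (int n) = n * (n + 1) div 2"
proof -
  have "int n * (int n + 1) div 2 = int (n * (n + 1) div 2)"
    by (simp only: zdiv_int of_nat_mult of_nat_add of_nat_1 of_nat_numeral)
  then show ?thesis by (simp only: triangular_def nat_int)
qed

lemma triangular_neg: "triangular (- k - 1) = triangular k"
  by (simp add: triangular_def algebra_simps)

lemma UNIV_int: "(UNIV :: int set) = range int \<union> range (\<lambda>n. - int n - 1)"
proof (intro subset_antisym subsetI UnCI UNIV_I)
  fix k :: int assume "k \<notin> range (\<lambda>n. - int n - 1)"
  then have "k \<noteq> - int (nat (- k - 1)) - 1" by blast
  then have "k = int (nat k)" by (cases "k < 0") auto
  then show "k \<in> range int" by blast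
qed

text \<open>The index -n-1 has the same exponent of q as n, the opposite sign and the power
  X^(-2n-1), so it supplies the second half of \<open>theta_series\<close>. The sum over the
  integers is unordered, which allows a product of two such sums to be regrouped.\<close>

lemma has_sum_theta_term:
  assumes "norm q < 1"
  obtains L where "L \<noteq> 0" "\<And>X. X \<noteq> 0 \<Longrightarrow> (theta_term q X has_sum (L * theta q X)) UNIV"
proof -
  from theta_series[OF assms] obtain L where L: "L \<noteq> 0" "\<And>X. X \<noteq> 0 \<Longrightarrow>
     L * theta q X = (\<Sum>n. (-1) ^ n * q ^ (n * (n + 1) div 2) * (X ^ (2 * n + 1) - (1 / X) ^ (2 * n + 1)))"
    by blast
  have "(theta_term q X has_sum (L * theta q X)) UNIV" if X: "X \<noteq> 0" for X
  proof -
    define u where "u Y n = (-1) ^ n * q ^ (n * (n + 1) div 2) * Y ^ (2 * n + 1)" for Y n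
    have sn: "summable (\<lambda>n. norm (u Y n))" for Y unfolding u_def by (rule summable_theta_half[OF assms])
    have hs: "(u Y has_sum suminf (u Y)) UNIV" for Y
      using norm_summable_imp_has_sum[OF sn summable_sums[OF summable_norm_cancel[OF sn]]] .
    have 1: "theta_term q X \<circ> int = u X"
      using X by (simp add: fun_eq_iff theta_term_def u_def triangular_of_nat power_int_add flip: power_int_of_nat)
    have 2: "theta_term q X \<circ> (\<lambda>n. - int n - 1) = (\<lambda>n. - u (1 / X) n)"
    proof
      fix n
      have "2 * (- int n - 1) + 1 = - int (2 * n + 1)" by simp
      then have "X powi (2 * (- int n - 1) + 1) = (1 / X) ^ (2 * n + 1)"
        by (simp only: power_int_minus power_int_of_nat power_one_over inverse_eq_divide)
      moreover have "(-1) powi (- int n - 1) = - ((-1) ^ n :: complex)"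
      proof -
        have "- int n - 1 = - int (Suc n)" by simp
        then show ?thesis by (simp only: power_int_minus power_int_of_nat flip: power_inverse) simp
      qed
      ultimately show "(theta_term q X \<circ> (\<lambda>n. - int n - 1)) n = - u (1 / X) n"
        unfolding theta_term_def comp_def triangular_neg triangular_of_nat u_def by simp
    qed
    have "(theta_term q X has_sum suminf (u X)) (range int)"
      using hs[of X] 1 by (simp add: has_sum_reindex inj_on_def)
    moreover have "(theta_term q X has_sum - suminf (u (1 / X))) (range (\<lambda>n. - int n - 1))"
      using has_sum_uminusI[OF hs[of "1 / X"]] 2 by (simp add: has_sum_reindex inj_on_def)
    ultimately have "(theta_term q X has_sum (suminf (u X) + - suminf (u (1 / X)))) UNIV"
      unfolding UNIV_int by (rule has_sum_Un_disjoint) auto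
    moreover have "suminf (u X) + - suminf (u (1 / X)) = L * theta q X"
      using suminf_diff[OF summable_norm_cancel[OF sn] summable_norm_cancel[OF sn], of X "1 / X"]
      unfolding L(2)[OF X] u_def by (simp add: right_diff_distrib)
    ultimately show ?thesis by simp
  qed
  then show ?thesis using that L(1) by blast
qed

lemma has_sum_times:
  fixes f :: "'a \<Rightarrow> complex" and g :: "'b \<Rightarrow> complex"
  assumes "(f has_sum a) A" "(g has_sum b) B"
  shows "((\<lambda>(x, y). f x * g y) has_sum (a * b)) (A \<times> B)"
proof (rule has_sum_SigmaI)
  show "((\<lambda>x. f x * b) has_sum a * b) A" by (rule has_sum_cmult_left[OF assms(1)])
  show "((\<lambda>y. (\<lambda>(x, y). f x * g y) (x, y)) has_sum f x * b) B" for x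
    using has_sum_cmult_right[OF assms(2)] by simp
  have f: "(\<lambda>x. norm (f x)) summable_on A" and g: "(\<lambda>x. norm (g x)) summable_on B"
    using assms has_sum_imp_summable summable_on_iff_abs_summable_on_complex by blast+
  have "(\<lambda>(x, y). norm (f x) * norm (g y)) summable_on A \<times> B"
    by (rule summable_on_SigmaI[where g = "\<lambda>x. norm (f x) * (\<Sum>\<^sub>\<infinity>y\<in>B. norm (g y))"])
      (auto intro!: has_sum_cmult_right has_sum_infsum g summable_on_cmult_left f)
  then show "(\<lambda>(x, y). f x * g y) summable_on A \<times> B"
    unfolding summable_on_iff_abs_summable_on_complex by (simp add: norm_mult case_prod_unfold)
qed

text \<open>The exponent of q for the indices k+l and k-l contains no mixed term in k and l; this
  separates the variables in the double series. With k-l-1 as second index the roles of k and l are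
  exchanged.\<close>

lemma triangular_add_even: "triangular (k + l) + triangular (k - l) = nat (k * k + k) + nat (l * l)"
proof -
  have nn: "0 \<le> j * (j + 1)" for j :: int
    by (cases "0 \<le> j") (auto intro: mult_nonpos_nonpos)
  then have *: "int (triangular j) * 2 = j * (j + 1)" for j
    by (simp add: triangular_def)
  have "int (triangular (k + l) + triangular (k - l)) * 2 = (k * (k + 1) + l * l) * 2"
    unfolding of_nat_add distrib_right * by algebra
  then have "int (triangular (k + l) + triangular (k - l)) = int (nat (k * (k + 1)) + nat (l * l))"
    using nn[of k] by simp
  then show ?thesis by (simp only: of_nat_eq_iff distrib_left mult_1_right)
qed

lemma triangular_add_odd: "triangular (k + l) + triangular (k - l - 1) = nat (k * k) + nat (l * l + l)"
  using triangular_add_even[of l k] triangular_neg[of "l - k"] by (simp add: algebra_simps)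

text \<open>Sorting the double series of \<open>\<vartheta>(xy)\<vartheta>(x/y)\<close> by the parity of the difference of the two
  summation indices separates the variables, so that this function is a \<open>2 \<times> 2\<close> determinant.\<close>

lemma theta_mult_determinant:
  assumes "norm q < 1"
  obtains C P Q where "C \<noteq> 0"
    "\<And>x y. x \<noteq> 0 \<Longrightarrow> y \<noteq> 0 \<Longrightarrow> C * (theta q (x * y) * theta q (x / y)) = P x * Q y - Q x * P y"
proof -
  from has_sum_theta_term[OF assms] obtain L where L: "L \<noteq> 0"
    "\<And>X. X \<noteq> 0 \<Longrightarrow> (theta_term q X has_sum (L * theta q X)) UNIV" by blast
  \<comment> \<open>Up to a power of q, the sums of \<open>od\<close> and \<open>ev\<close> are
    Jacobi's functions theta_2 and theta_3 of nome q, with e^(iz) = x^2.\<close>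
  define od where "od x k = q ^ nat (k * k + k) * x powi (4 * k + 2)" for x :: complex and k :: int
  define ev where "ev x k = q ^ nat (k * k) * x powi (4 * k)" for x :: complex and k :: int
  have "L\<^sup>2 * (theta q (x * y) * theta q (x / y)) = infsum (od x) UNIV * infsum (ev y) UNIV - infsum (ev x) UNIV * infsum (od y) UNIV"
    if xy: "x \<noteq> 0" "y \<noteq> 0" for x y
  proof -
    define F where "F = (\<lambda>(n, m). theta_term q (x * y) n * theta_term q (x / y) m)"
    define h1 :: "int \<times> int \<Rightarrow> int \<times> int" where "h1 = (\<lambda>(k, l). (k + l, k - l))"
    define h2 :: "int \<times> int \<Rightarrow> int \<times> int" where "h2 = (\<lambda>(k, l). (k + l, k - l - 1))"
    have F: "(F has_sum (L * theta q (x * y)) * (L * theta q (x / y))) UNIV"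
      unfolding F_def UNIV_Times_UNIV[symmetric] by (intro has_sum_times L(2)) (use xy in auto)
    have inj: "inj h1" "inj h2" by (auto simp: h1_def h2_def inj_def)
    have disj: "range h1 \<inter> range h2 = {}"
      by (auto simp: h1_def h2_def) presburger
    have un: "UNIV = range h1 \<union> range h2"
    proof (intro subset_antisym subsetI UNIV_I)
      fix p :: "int \<times> int"
      obtain n m where p: "p = (n, m)" by force
      show "p \<in> range h1 \<union> range h2"
      proof (cases "even (n - m)")
        case True
        then have "p = h1 ((n + m) div 2, (n - m) div 2)" unfolding p h1_def by auto presburger+
        then show ?thesis by blast
      next
        case False
        then have "p = h2 ((n + m + 1) div 2, (n - m - 1) div 2)" unfolding p h2_def by auto presburger+
        then show ?thesis by blast
      qed
    qed
    have sF: "F summable_on range h1" "F summable_on range h2"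
      using has_sum_imp_summable[OF F] by (auto intro: summable_on_subset_banach)
    have eq1: "F (h1 (k, l)) = od x k * ev y l" for k l
    proof -
      have "(-1) powi (k + l) * (-1) powi (k - l) = ((-1) powi (2 * k) :: complex)"
        by (simp flip: power_int_add)
      also have "\<dots> = 1" by (simp add: power_int_mult)
      finally have s: "(-1) powi (k + l) * (-1) powi (k - l) = (1 :: complex)" .
      have "(x * y) powi (2 * (k + l) + 1) * (x / y) powi (2 * (k - l) + 1) =
         (x powi (2 * (k + l) + 1) * x powi (2 * (k - l) + 1)) * (y powi (2 * (k + l) + 1) * y powi (- (2 * (k - l) + 1)))"
        by (simp only: power_int_mult_distrib power_int_divide_distrib power_int_minus divide_inverse power_int_inverse mult_ac)
      also have "\<dots> = x powi (4 * k + 2) * y powi (4 * l)"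
        using xy by (simp flip: power_int_add)
      finally have p: "(x * y) powi (2 * (k + l) + 1) * (x / y) powi (2 * (k - l) + 1) = x powi (4 * k + 2) * y powi (4 * l)" .
      have "F (h1 (k, l)) = ((-1) powi (k + l) * (-1) powi (k - l)) * q ^ (triangular (k + l) + triangular (k - l)) *
         ((x * y) powi (2 * (k + l) + 1) * (x / y) powi (2 * (k - l) + 1))"
        by (simp add: F_def h1_def theta_term_def power_add)
      then show ?thesis unfolding s p triangular_add_even by (simp add: od_def ev_def power_add)
    qed
    have eq2: "F (h2 (k, l)) = - (ev x k * od y l)" for k l
    proof -
      have "(-1) powi (k + l) * (-1) powi (k - l - 1) = ((-1) powi (2 * k + - 1) :: complex)"
        by (simp flip: power_int_add)
      also have "\<dots> = -1" by (subst power_int_add) (simp_all add: power_int_mult)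
      finally have s: "(-1) powi (k + l) * (-1) powi (k - l - 1) = (-1 :: complex)" .
      have "(x * y) powi (2 * (k + l) + 1) * (x / y) powi (2 * (k - l - 1) + 1) =
         (x powi (2 * (k + l) + 1) * x powi (2 * (k - l - 1) + 1)) * (y powi (2 * (k + l) + 1) * y powi (- (2 * (k - l - 1) + 1)))"
        by (simp only: power_int_mult_distrib power_int_divide_distrib power_int_minus divide_inverse power_int_inverse mult_ac)
      also have "\<dots> = x powi (4 * k) * y powi (4 * l + 2)"
        using xy by (simp add: add.commute flip: power_int_add)
      finally have p: "(x * y) powi (2 * (k + l) + 1) * (x / y) powi (2 * (k - l - 1) + 1) = x powi (4 * k) * y powi (4 * l + 2)" .
      have "F (h2 (k, l)) = ((-1) powi (k + l) * (-1) powi (k - l - 1)) * q ^ (triangular (k + l) + triangular (k - l - 1)) *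
         ((x * y) powi (2 * (k + l) + 1) * (x / y) powi (2 * (k - l - 1) + 1))"
        by (simp add: F_def h2_def theta_term_def power_add)
      then show ?thesis unfolding s p triangular_add_odd by (simp add: od_def ev_def power_add)
    qed
    have prod: "infsum (\<lambda>(k, l). f k * g l) UNIV = infsum f UNIV * infsum g UNIV"
      if "(\<lambda>(k, l). f k * g l) summable_on UNIV" for f g :: "int \<Rightarrow> complex"
      using infsum_Sigma'_banach[of "\<lambda>k l. f k * g l" UNIV "\<lambda>_. UNIV"] that
      by (simp add: infsum_cmult_right' infsum_cmult_left')
    have c1: "F \<circ> h1 = (\<lambda>(k, l). od x k * ev y l)" using eq1 by auto
    have c2: "F \<circ> h2 = (\<lambda>(k, l). - ev x k * od y l)" using eq2 by auto
    have "infsum F (range h1) = infsum (od x) UNIV * infsum (ev y) UNIV"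
      using sF(1) inj(1) prod[of "od x" "ev y"] unfolding infsum_reindex[OF inj(1)] c1
      by (simp add: summable_on_reindex c1)
    moreover have "infsum F (range h2) = - infsum (ev x) UNIV * infsum (od y) UNIV"
      using sF(2) inj(2) prod[of "\<lambda>k. - ev x k" "od y"] unfolding infsum_reindex[OF inj(2)] c2
      by (simp add: summable_on_reindex c2 infsum_uminus)
    moreover have "infsum F UNIV = infsum F (range h1) + infsum F (range h2)"
      using infsum_Un_disjoint[OF sF disj] unfolding un[symmetric] .
    ultimately show ?thesis using infsumI[OF F] by (simp add: power2_eq_square mult_ac)
  qed
  then show ?thesis using that[of "L\<^sup>2" "\<lambda>x. infsum (od x) UNIV" "\<lambda>x. infsum (ev x) UNIV"] L(1) by simp
qed

section \<open>The three-term relation and its specializations\<close>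

lemma theta_inverse: "theta q (1 / X) = - theta q X"
proof (cases "X = 0")
  case False
  then have "1 / X * (1 - 1 / (1 / X)\<^sup>2) = - (X * (1 - 1 / X\<^sup>2))"
    by (simp add: field_simps power2_eq_square)
  then show ?thesis
    unfolding theta_def by (simp add: power_one_over mult.commute)
qed (simp add: theta_def)

lemma theta_swap: "theta q (X / Y) = - theta q (Y / X)"
  using theta_inverse[of q "Y / X"] by simp

lemma theta_1: "theta q 1 = 0"
  by (simp add: theta_def)

lemma theta_three_term:
  assumes "norm q < 1" "a \<noteq> 0" "b \<noteq> 0" "c \<noteq> 0" "d \<noteq> 0"
  shows "theta q (a * b) * theta q (a / b) * (theta q (c * d) * theta q (c / d))
       - theta q (a * c) * theta q (a / c) * (theta q (b * d) * theta q (b / d))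
       + theta q (a * d) * theta q (a / d) * (theta q (b * c) * theta q (b / c)) = 0"
proof -
  obtain C P Q where C: "C \<noteq> 0" and
    D: "\<And>x y. x \<noteq> 0 \<Longrightarrow> y \<noteq> 0 \<Longrightarrow> C * (theta q (x * y) * theta q (x / y)) = P x * Q y - Q x * P y"
    using theta_mult_determinant[OF assms(1)] by blast
  define D where "D x y = theta q (x * y) * theta q (x / y)" for x y
  have "C * C * (D a b * D c d - D a c * D b d + D a d * D b c) =
    (C * D a b) * (C * D c d) - (C * D a c) * (C * D b d) + (C * D a d) * (C * D b c)"
    by algebra
  also have "\<dots> = 0"
    unfolding D_def D[OF assms(2,3)] D[OF assms(4,5)] D[OF assms(2,4)] D[OF assms(3,5)] D[OF assms(2,5)] D[OF assms(3,4)]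
    by algebra
  finally show ?thesis using C unfolding D_def by simp
qed

lemma theta_addition:
  assumes q: "norm q < 1" and nz: "x \<noteq> 0" "y \<noteq> 0" "h \<noteq> 0" "m \<noteq> 0"
  shows "theta q (x * h) * theta q (y * m) * theta q (h * m) * theta q (y / x) =
    theta q (y * m / x) * theta q (x * h * m) * theta q y * theta q h
    - theta q (x * h / y) * theta q (y * h * m) * theta q x * theta q m"
proof -
  \<comment> \<open>Two of the points of \<open>theta_three_term\<close> must have product y and
    quotient h. One of them, \<open>g\<close>, then satisfies g^2 = y * h, hence the square root;
    the other is b = g / h, and the remaining points are g * m and x / b.\<close>
  define g where "g = csqrt (y * h)"
  have gg: "g * g = y * h" by (simp add: g_def flip: power2_eq_square)
  then have "g \<noteq> 0" using nz by auto
  define b where "b = g / h"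
  have b: "b = y / g" using gg nz \<open>g \<noteq> 0\<close> by (simp add: b_def field_simps)
  have eqs: "g * m * b = y * m" "g * m / b = h * m" "g * (x / b) = x * h" "g / (x / b) = y / x"
     "g * m * g = y * h * m" "g * m / g = m" "b * (x / b) = x" "b / (x / b) = y / (x * h)"
     "g * m * (x / b) = x * h * m" "g * m / (x / b) = y * m / x" "b * g = y" "b / g = 1 / h"
    using gg nz \<open>g \<noteq> 0\<close> unfolding b_def by (auto simp: field_simps power2_eq_square)
  have "b \<noteq> 0" using b nz \<open>g \<noteq> 0\<close> by simp
  have i: "theta q (y / (x * h)) = - theta q (x * h / y)" by (rule theta_swap)
  show ?thesis
    using theta_three_term[OF q, of "g * m" b g "x / b"] nz \<open>g \<noteq> 0\<close> \<open>b \<noteq> 0\<close>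
    unfolding eqs i theta_inverse[of q h] by simp algebra
qed

text \<open>In additive notation this is the addition formula \<open>\<theta>(Y)\<theta>(H)\<theta>(Y+M-X)\<theta>(X+H+M) - \<theta>(X)\<theta>(M)\<theta>(X+H-Y)\<theta>(Y+H+M) =
  \<theta>(X+H)\<theta>(Y+M)\<theta>(H+M)\<theta>(Y-X)\<close> with \<open>Y = y-x\<close>, \<open>X = u-s\<close>, \<open>H = y-u+P\<close>, \<open>M = u-y-R\<close>.\<close>

lemma theta_addition_four:
  assumes q: "norm q < 1" and nz: "x \<noteq> 0" "y \<noteq> 0" "s \<noteq> 0" "u \<noteq> 0" "P \<noteq> 0" "R \<noteq> 0"
  shows "theta q (y / x) * theta q (u / s * (P / R)) * theta q (x / s * R) * theta q (y / u * P)
     - theta q (u / s) * theta q (y / x * (P / R)) * theta q (x / s * P) * theta q (y / u * R) =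
    theta q (P / R) * theta q (y / s * P) * theta q (x / u * R) * theta q (y / x * (s / u))"
proof -
  define X Y H M where "X = u / s" and "Y = y / x" and "H = y / u * P" and "M = u / (y * R)"
  have nz': "X \<noteq> 0" "Y \<noteq> 0" "H \<noteq> 0" "M \<noteq> 0"
    using nz by (simp_all add: X_def Y_def H_def M_def)
  have eqs: "X * H = y / s * P" "Y * M = u / (x * R)" "H * M = P / R" "Y / X = y / x * (s / u)"
     "u / (x * R) / X = s / (x * R)" "y / s * P * M = u / s * (P / R)" "y / s * P / Y = x / s * P"
     "Y * H * M = y / x * (P / R)"
    using nz by (simp_all add: X_def Y_def H_def M_def field_simps)
  have i: "theta q (u / (x * R)) = - theta q (x / u * R)" "theta q (s / (x * R)) = - theta q (x / s * R)"
     "theta q M = - theta q (y / u * R)"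
    using theta_swap[of q u "x * R"] theta_swap[of q s "x * R"] theta_swap[of q u "y * R"] by (simp_all add: M_def)
  show ?thesis
    using theta_addition[OF q nz'(1,2,3,4), unfolded eqs i, unfolded X_def Y_def H_def] by algebra
qed

lemma delta_inverse_inverse: "delta q (1 / a) (1 / b) = - delta q a b"
proof -
  have "theta q (1 / a * (1 / b)) = - theta q (a * b)"
    using theta_inverse[of q "a * b"] by simp
  then show ?thesis by (simp add: delta_def theta_inverse)
qed

text \<open>This is \<open>theta_three_term\<close> at x, m, h and 1. The right side is free of x,
  so the square of the unnormalized position operator is a scalar in \<mu> and h.\<close>

lemma delta_three_term:
  assumes q: "norm q < 1" and nz: "x \<noteq> 0" "m \<noteq> 0" "h \<noteq> 0"
    and th: "theta q x \<noteq> 0" "theta q m \<noteq> 0" "theta q h \<noteq> 0"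
  shows "delta q x (1 / m) * delta q x m + delta q x h * delta q (1 / x) h = delta q m h * delta q (1 / m) h"
proof -
  have "theta q (x * m) * theta q (x / m) * (theta q h * theta q h) -
     theta q (x * h) * theta q (x / h) * (theta q m * theta q m) +
     theta q x * theta q x * (theta q (m * h) * theta q (m / h)) = 0"
    using theta_three_term[OF q nz, of 1] by simp
  moreover have "theta q (h / x) = - theta q (x / h)" "theta q (h / m) = - theta q (m / h)" by (rule theta_swap)+
  ultimately have "theta q (x * m) * theta q (x / m) * (theta q h * theta q h) +
     theta q (x * h) * theta q (h / x) * (theta q m * theta q m) =
     theta q x * theta q x * (theta q (m * h) * theta q (h / m))"
    by algebra
  moreover have "theta q (x * (1 / m)) = theta q (x / m)" "theta q (1 / x * h) = theta q (h / x)"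
     "theta q (1 / m * h) = theta q (h / m)" by simp_all
  ultimately show ?thesis
    using th unfolding delta_def theta_inverse by (simp add: divide_simps) algebra
qed

text \<open>The case \<open>n = 2\<close> of the recursion that exchanges adjacent values of \<open>\<omega>\<close>.\<close>

lemma two_point_relation:
  assumes q: "norm q < 1" and nz: "a \<noteq> 0" "b \<noteq> 0" "t \<noteq> 0" "h \<noteq> 0" "m \<noteq> 0"
    and th: "theta q (b / a) \<noteq> 0" "theta q m \<noteq> 0" "theta q h \<noteq> 0" "theta q (h * m) \<noteq> 0"
  shows "theta_delta q (a / t) h * theta_delta q (b / t) m =
    delta q (b / a) m * (theta_delta q (a / t) (h * m) * theta q (b / t)) +
    delta q (a / b) h * (theta_delta q (b / t) (h * m) * theta q (a / t))"
proof -
  define x y where "x = a / t" and "y = b / t"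
  have nz': "x \<noteq> 0" "y \<noteq> 0" using nz by (simp_all add: x_def y_def)
  have e: "b / a = y / x" "a / b = x / y" using nz by (simp_all add: x_def y_def)
  have s: "theta q (x / y) = - theta q (y / x)" by (rule theta_swap)
  have "theta q (x * h) * theta q (y * m) * theta q (h * m) * theta q (y / x) =
    theta q (y / x * m) * theta q (x * (h * m)) * theta q y * theta q h
    - theta q (x / y * h) * theta q (y * (h * m)) * theta q x * theta q m"
    using theta_addition[OF q nz' nz(4,5)] by (simp add: mult.assoc)
  then show ?thesis
    using th nz' unfolding delta_def theta_delta_def e x_def[symmetric] y_def[symmetric] s
    by (simp add: divide_simps) algebra
qed

text \<open>\<open>M\<close> collects those factors of \<open>kernel\<close> that involve only two
  chosen positions: x, y are their variables on the upper level and s, u those on the lower one. The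
  relation follows from \<open>theta_addition_four\<close> for (P, R) and for (1, h). Both instances
  contain theta(y/x * (s/u)); eliminating it leaves the four terms of the claim.\<close>

lemma four_point_relation:
  fixes x y s u P R h q :: complex
  assumes q: "norm q < 1" and nz: "x \<noteq> 0" "y \<noteq> 0" "s \<noteq> 0" "u \<noteq> 0" "P \<noteq> 0" "R \<noteq> 0" "h \<noteq> 0"
    and th: "theta q (y / x) \<noteq> 0" "theta q (u / s) \<noteq> 0" "theta q (P / R) \<noteq> 0" "theta q h \<noteq> 0"
      "theta q P \<noteq> 0" "theta q R \<noteq> 0"
  defines "M \<equiv> \<lambda>P R x y s u. theta_delta q (x / s) P * theta q (y / s) *
       (theta_delta q (x / u) h * theta_delta q (y / u) R) * delta q (u / s) h"
  shows "M R P x y s u * delta q (u / s) (P / R) + M R P x y u s * delta q (u / s) h =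
    delta q (y / x) (P / R) * M P R x y s u + delta q (x / y) h * M P R y x s u"
proof -
  define A B where "A = theta q (u / s)" and "B = theta q (y / x)"
  have sw: "theta q (s / u) = - A" "theta q (x / y) = - B"
    unfolding A_def B_def by (rule theta_swap)+
  have 1: "B * theta q (u / s * (P / R)) * theta q (x / s * R) * theta q (y / u * P)
     - A * theta q (y / x * (P / R)) * theta q (x / s * P) * theta q (y / u * R) =
    theta q (P / R) * theta q (y / s * P) * theta q (x / u * R) * theta q (y / x * (s / u))"
    using theta_addition_four[OF q nz(1-6)] by (simp add: A_def B_def)
  have s2: "theta q (u / s * (1 / h)) = - theta q (s / u * h)" "theta q (y / x * (1 / h)) = - theta q (x / y * h)"
    "theta q (1 / h) = - theta q h"
    using theta_swap[of q u "s * h"] theta_swap[of q y "x * h"] by (simp_all add: theta_inverse)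
  have 2: "B * theta q (s / u * h) * theta q (x / s * h) * theta q (y / u)
     - A * theta q (x / y * h) * theta q (x / s) * theta q (y / u * h) =
    theta q h * theta q (y / s) * theta q (x / u * h) * theta q (y / x * (s / u))"
    using theta_addition_four[OF q nz(1-4), of 1 h] nz(7) unfolding s2 by (simp add: A_def B_def) algebra
  \<comment> \<open>All four terms of the claim contain this factor. It may vanish, so the identity
    is multiplied by it rather than divided.\<close>
  define c where "c = theta q (u / s * h)"
  have "(theta q (x / s * R) * theta q (y / s) * theta q (x / u * h) * theta q (y / u * P)) *
      theta q (u / s * (P / R)) * B * theta q h
     - (theta q (x / u * R) * theta q (y / u) * theta q (x / s * h) * theta q (y / s * P)) *
      theta q (s / u * h) * B * theta q (P / R) =
     theta q (y / x * (P / R)) * (theta q (x / s * P) * theta q (y / s) * theta q (x / u * h) * theta q (y / u * R)) * A * theta q h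
    - theta q (x / y * h) * (theta q (y / s * P) * theta q (x / s) * theta q (y / u * h) * theta q (x / u * R)) * A * theta q (P / R)"
    using 1 2 by algebra
  then have "c * ((theta q (x / s * R) * theta q (y / s) * theta q (x / u * h) * theta q (y / u * P)) *
      theta q (u / s * (P / R)) * B * theta q h
     - (theta q (x / u * R) * theta q (y / u) * theta q (x / s * h) * theta q (y / s * P)) *
      theta q (s / u * h) * B * theta q (P / R)) =
     c * (theta q (y / x * (P / R)) * (theta q (x / s * P) * theta q (y / s) * theta q (x / u * h) * theta q (y / u * R)) * A * theta q h
    - theta q (x / y * h) * (theta q (y / s * P) * theta q (x / s) * theta q (y / u * h) * theta q (x / u * R)) * A * theta q (P / R))"
    by simp
  moreover have "A \<noteq> 0" "B \<noteq> 0" using th by (simp_all add: A_def B_def)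
  ultimately show ?thesis
    using th(3-)
    unfolding M_def delta_def theta_delta_def A_def[symmetric] B_def[symmetric] sw c_def[symmetric]
    by (simp add: divide_simps) algebra
qed

section \<open>Weight functions indexed by positions\<close>

text \<open>This is \<open>psi\<close> with positions in place of ranks: equality of two values
  becomes l = i, \<open>j_index\<close> becomes i, and the exponent of h is 1 - c. No sorting of
  values is left.\<close>

definition factor ::
  "complex \<Rightarrow> (nat \<Rightarrow> complex) \<Rightarrow> complex \<Rightarrow> (nat \<Rightarrow> nat) \<Rightarrow> nat \<Rightarrow> nat \<Rightarrow> nat \<Rightarrow> complex \<Rightarrow> complex"
where
  "factor q \<mu> h \<omega> k i l x =
     (if \<omega> l < \<omega> i then theta_delta q x h
      else if l = i then theta_delta q x (h ^ (if \<omega> i \<le> \<omega> (k + 1) then 1 else 0) * \<mu> (k + 1) / \<mu> i)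
      else theta q x)"

text \<open>One level of \<open>U_fun\<close>, with \<open>Y\<close> on level k+1 and
  \<open>y\<close> on level k. The condition a < b on ranks has become \<omega> i < \<omega>
  l.\<close>

definition kernel ::
  "complex \<Rightarrow> (nat \<Rightarrow> complex) \<Rightarrow> complex \<Rightarrow> (nat \<Rightarrow> nat) \<Rightarrow> nat \<Rightarrow> (nat \<Rightarrow> complex) \<Rightarrow> (nat \<Rightarrow> complex) \<Rightarrow> complex"
where
  "kernel q \<mu> h \<omega> k Y y =
     (\<Prod>(i, l)\<in>{1..k} \<times> {1..k + 1}. factor q \<mu> h \<omega> k i l (Y l / y i)) *
     (\<Prod>(i, l) | i \<in> {1..k} \<and> l \<in> {1..k} \<and> \<omega> i < \<omega> l. delta q (y l / y i) h)"

text \<open>The symmetrized weight function up to level \<open>m\<close>: the variable of level \<open>k\<close> that belongs to the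
  value \<open>\<omega>(i)\<close>, with \<open>i \<le> k\<close>, is listed at the position \<open>i\<close>. Then \<open>\<omega>\<close> enters only through the
  relative order of its values.\<close>

primrec wsum ::
  "complex \<Rightarrow> (nat \<Rightarrow> complex) \<Rightarrow> complex \<Rightarrow> (nat \<Rightarrow> nat) \<Rightarrow> (nat \<Rightarrow> nat \<Rightarrow> complex) \<Rightarrow> nat \<Rightarrow> (nat \<Rightarrow> complex) \<Rightarrow> complex"
where
  "wsum q \<mu> h \<omega> t 0 Y = 1"
| "wsum q \<mu> h \<omega> t (Suc k) Y =
     (\<Sum>\<sigma> | \<sigma> permutes {1..k}. kernel q \<mu> h \<omega> k Y (t k \<circ> \<sigma>) * wsum q \<mu> h \<omega> t k (t k \<circ> \<sigma>))"

definition sorted_kernel ::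
  "complex \<Rightarrow> (nat \<Rightarrow> complex) \<Rightarrow> complex \<Rightarrow> (nat \<Rightarrow> nat) \<Rightarrow> nat \<Rightarrow> (nat \<Rightarrow> complex) \<Rightarrow> (nat \<Rightarrow> complex) \<Rightarrow> complex"
where
  "sorted_kernel q \<mu> h \<omega> k T y =
     (\<Prod>a\<in>{1..k}. (\<Prod>c\<in>{1..k + 1}. psi q \<mu> h \<omega> k a c (T c / y a)) * (\<Prod>b\<in>{a + 1..k}. delta q (y b / y a) h))"

text \<open>The rank of \<omega>(i) among the first k values, which translates positions into sorted
  order. Extending it by the identity makes it a permutation that can be absorbed into a
  symmetrization.\<close>

definition rank_perm :: "(nat \<Rightarrow> nat) \<Rightarrow> nat \<Rightarrow> nat \<Rightarrow> nat" where
  "rank_perm \<omega> k i = (if i \<in> {1..k} then inv_into {1..k} (omega_sorted \<omega> k) (\<omega> i) else i)"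

context
  fixes \<omega> :: "nat \<Rightarrow> nat" and k :: nat
  assumes inj: "inj_on \<omega> {1..k}"
begin

lemma omega_sorted_bij: "bij_betw (omega_sorted \<omega> k) {1..k} (\<omega> ` {1..k})"
proof -
  have "bij_betw (\<lambda>a. a - 1) {1..k} {..<k}"
    by (rule bij_betwI[where g = Suc]) auto
  moreover have "bij_betw ((!) (sorted_list_of_set (\<omega> ` {1..k}))) {..<k} (\<omega> ` {1..k})"
    by (rule bij_betw_nth) (simp_all add: card_image[OF inj, simplified])
  ultimately show ?thesis
    unfolding omega_sorted_def[abs_def] by (rule bij_betw_trans[unfolded comp_def])
qed

lemma omega_sorted_less_iff:
  assumes "a \<in> {1..k}" "b \<in> {1..k}"
  shows "omega_sorted \<omega> k a < omega_sorted \<omega> k b \<longleftrightarrow> a < b"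
proof -
  have *: "omega_sorted \<omega> k a < omega_sorted \<omega> k b" if "a \<in> {1..k}" "b \<in> {1..k}" "a < b" for a b
    unfolding omega_sorted_def using that
    by (intro sorted_wrt_nth_less[OF strict_sorted_list_of_set]) (auto simp: card_image[OF inj, simplified])
  from *[of a b] *[of b a] assms show ?thesis
    by (metis less_asym nat_neq_iff)
qed

lemma omega_sorted_rank_perm: "i \<in> {1..k} \<Longrightarrow> omega_sorted \<omega> k (rank_perm \<omega> k i) = \<omega> i"
  unfolding rank_perm_def using omega_sorted_bij by (simp add: f_inv_into_f bij_betw_def)

lemma rank_perm_permutes: "rank_perm \<omega> k permutes {1..k}"
proof (rule bij_imp_permutes)
  have "bij_betw (inv_into {1..k} (omega_sorted \<omega> k) \<circ> \<omega>) {1..k} {1..k}"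
    by (rule bij_betw_trans[OF inj_on_imp_bij_betw[OF inj] bij_betw_inv_into[OF omega_sorted_bij]])
  then show "bij_betw (rank_perm \<omega> k) {1..k} {1..k}"
    by (rule bij_betw_cong[THEN iffD1, rotated]) (simp add: rank_perm_def)
qed (auto simp: rank_perm_def)

lemma rank_perm_less_iff: "i \<in> {1..k} \<Longrightarrow> l \<in> {1..k} \<Longrightarrow> rank_perm \<omega> k i < rank_perm \<omega> k l \<longleftrightarrow> \<omega> i < \<omega> l"
  using omega_sorted_less_iff[of "rank_perm \<omega> k i" "rank_perm \<omega> k l"]
    permutes_in_image[OF rank_perm_permutes] omega_sorted_rank_perm by metis

lemma j_index_rank_perm: "i \<in> {1..k} \<Longrightarrow> j_index \<omega> k (rank_perm \<omega> k i) = i"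
  unfolding j_index_def omega_sorted_rank_perm
  by (rule the_equality) (auto dest: inj_onD[OF inj])

end

lemma omega_sorted_permutes:
  assumes "\<omega> permutes {1..n}" "a \<in> {1..n}"
  shows "omega_sorted \<omega> n a = a"
proof -
  have "sorted_list_of_set (\<omega> ` {1..n}) = [1..<Suc n]"
    unfolding permutes_image[OF assms(1)] using sorted_list_of_set_range[of 1 "Suc n"] by (simp only: atLeastLessThanSuc_atLeastAtMost)
  then show ?thesis using assms(2) by (simp add: omega_sorted_def del: upt_Suc)
qed

lemma rank_perm_eq:
  assumes "\<omega> permutes {1..n}"
  shows "rank_perm \<omega> n = \<omega>"
proof
  fix i
  have inj: "inj_on \<omega> {1..n}" by (rule permutes_inj_on[OF assms])
  show "rank_perm \<omega> n i = \<omega> i"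
  proof (cases "i \<in> {1..n}")
    case True
    then show ?thesis
      using omega_sorted_rank_perm[OF inj True] omega_sorted_permutes[OF assms]
        permutes_in_image[OF rank_perm_permutes[OF inj]] by metis
  next
    case False
    then show ?thesis by (simp only: rank_perm_def if_False permutes_not_in[OF assms False])
  qed
qed

lemma sorted_kernel_eq:
  assumes inj: "inj_on \<omega> {1..k + 1}"
  shows "sorted_kernel q \<mu> h \<omega> k T y = kernel q \<mu> h \<omega> k (T \<circ> rank_perm \<omega> (k + 1)) (y \<circ> rank_perm \<omega> k)"
proof -
  define \<rho> \<rho>' where "\<rho> = rank_perm \<omega> k" and "\<rho>' = rank_perm \<omega> (k + 1)"
  have injk: "inj_on \<omega> {1..k}" using inj by (rule inj_on_subset) auto
  have \<rho>: "\<rho> permutes {1..k}" and \<rho>': "\<rho>' permutes {1..k + 1}"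
    unfolding \<rho>_def \<rho>'_def by (intro rank_perm_permutes injk inj)+
  have psi: "psi q \<mu> h \<omega> k (\<rho> i) (\<rho>' l) x = factor q \<mu> h \<omega> k i l x"
    if "i \<in> {1..k}" "l \<in> {1..k + 1}" for i l x
  proof -
    have "\<omega> l = \<omega> i \<longleftrightarrow> l = i" using that inj by (auto dest: inj_onD)
    then show ?thesis
      using that unfolding psi_def c_index_def factor_def \<rho>_def \<rho>'_def
        omega_sorted_rank_perm[OF injk that(1)] omega_sorted_rank_perm[OF inj that(2)] j_index_rank_perm[OF injk that(1)]
      by simp
  qed
  have "sorted_kernel q \<mu> h \<omega> k T y =
    (\<Prod>a\<in>{1..k}. (\<Prod>c\<in>{1..k + 1}. psi q \<mu> h \<omega> k a c (T c / y a))) * (\<Prod>a\<in>{1..k}. \<Prod>b\<in>{a + 1..k}. delta q (y b / y a) h)"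
    unfolding sorted_kernel_def by (rule prod.distrib)
  also have "(\<Prod>a\<in>{1..k}. (\<Prod>c\<in>{1..k + 1}. psi q \<mu> h \<omega> k a c (T c / y a))) =
     (\<Prod>i\<in>{1..k}. (\<Prod>l\<in>{1..k + 1}. psi q \<mu> h \<omega> k (\<rho> i) (\<rho>' l) (T (\<rho>' l) / y (\<rho> i))))"
    by (subst prod.permute[OF \<rho>], unfold comp_def, subst prod.permute[OF \<rho>'], simp add: comp_def)
  also have "\<dots> = (\<Prod>(i, l)\<in>{1..k} \<times> {1..k + 1}. factor q \<mu> h \<omega> k i l ((T \<circ> \<rho>') l / (y \<circ> \<rho>) i))"
    unfolding prod.cartesian_product[symmetric] by (intro prod.cong refl) (simp add: psi)
  also have "(\<Prod>a\<in>{1..k}. \<Prod>b\<in>{a + 1..k}. delta q (y b / y a) h) =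
      (\<Prod>(a, b)\<in>(SIGMA a:{1..k}. {a + 1..k}). delta q (y b / y a) h)"
    by (rule prod.Sigma) auto
  also have "\<dots> = (\<Prod>(i, l) | i \<in> {1..k} \<and> l \<in> {1..k} \<and> \<omega> i < \<omega> l. delta q ((y \<circ> \<rho>) l / (y \<circ> \<rho>) i) h)"
  proof (rule prod.reindex_bij_betw[symmetric, where h = "map_prod \<rho> \<rho>", THEN trans])
    show "bij_betw (map_prod \<rho> \<rho>) {(i, l). i \<in> {1..k} \<and> l \<in> {1..k} \<and> \<omega> i < \<omega> l} (SIGMA a:{1..k}. {a + 1..k})"
    proof (rule bij_betw_imageI)
      show "inj_on (map_prod \<rho> \<rho>) {(i, l). i \<in> {1..k} \<and> l \<in> {1..k} \<and> \<omega> i < \<omega> l}"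
        using permutes_inj[OF \<rho>] by (auto simp: inj_on_def dest: injD)
      show "map_prod \<rho> \<rho> ` {(i, l). i \<in> {1..k} \<and> l \<in> {1..k} \<and> \<omega> i < \<omega> l} = (SIGMA a:{1..k}. {a + 1..k})"
      proof (intro subset_antisym subsetI)
        fix x assume "x \<in> map_prod \<rho> \<rho> ` {(i, l). i \<in> {1..k} \<and> l \<in> {1..k} \<and> \<omega> i < \<omega> l}"
        then obtain i l where x: "x = (\<rho> i, \<rho> l)" "i \<in> {1..k}" "l \<in> {1..k}" "\<omega> i < \<omega> l" by auto
        then have "\<rho> i < \<rho> l" unfolding \<rho>_def by (simp add: rank_perm_less_iff[OF injk])
        moreover have "\<rho> i \<in> {1..k}" "\<rho> l \<in> {1..k}" using x permutes_in_image[OF \<rho>] by blast+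
        ultimately show "x \<in> (SIGMA a:{1..k}. {a + 1..k})" unfolding x by auto
      next
        fix x assume "x \<in> (SIGMA a:{1..k}. {a + 1..k})"
        then obtain a b where x: "x = (a, b)" "a \<in> {1..k}" "b \<in> {1..k}" "a < b" by auto
        then obtain i l where il: "a = \<rho> i" "b = \<rho> l" "i \<in> {1..k}" "l \<in> {1..k}"
          using permutes_image[OF \<rho>] by (metis imageE)
        then have "\<omega> i < \<omega> l" using x(4) unfolding \<rho>_def by (simp add: rank_perm_less_iff[OF injk])
        then show "x \<in> map_prod \<rho> \<rho> ` {(i, l). i \<in> {1..k} \<and> l \<in> {1..k} \<and> \<omega> i < \<omega> l}"
          using il x(1) by force
      qed
    qed
  qed (auto intro!: prod.cong)
  finally show ?thesis unfolding kernel_def \<rho>_def \<rho>'_def .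
qed

section \<open>Iterated symmetrization as a nested sum\<close>

lemma wsum_cong: "(\<And>k. k < m \<Longrightarrow> t k = t' k) \<Longrightarrow> wsum q \<mu> h \<omega> t m Y = wsum q \<mu> h \<omega> t' m Y"
  by (induction m arbitrary: Y) auto

text \<open>\<open>foldr\<close> applies the symmetrization of the highest level first. What it
  produces are coefficients in the higher variables only, and these pass through the symmetrizations
  of the lower levels.\<close>

lemma foldr_Sym_sum:
  assumes "m \<notin> set ks" "\<And>k \<sigma> f t. k \<in> set ks \<Longrightarrow> \<sigma> \<in> A \<Longrightarrow> c \<sigma> (t(k := f)) = c \<sigma> t"
  shows "foldr Sym ks (\<lambda>t. \<Sum>\<sigma>\<in>A. G (t(m := t m \<circ> \<sigma>)) * c \<sigma> t) t = (\<Sum>\<sigma>\<in>A. foldr Sym ks G (t(m := t m \<circ> \<sigma>)) * c \<sigma> t)"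
  using assms
proof (induction ks arbitrary: t)
  case (Cons k ks)
  have km: "k \<noteq> m" using Cons.prems(1) by auto
  have IH: "foldr Sym ks (\<lambda>t. \<Sum>\<sigma>\<in>A. G (t(m := t m \<circ> \<sigma>)) * c \<sigma> t) =
      (\<lambda>t. \<Sum>\<sigma>\<in>A. foldr Sym ks G (t(m := t m \<circ> \<sigma>)) * c \<sigma> t)"
    by (rule ext, rule Cons.IH) (use Cons.prems in auto)
  have "foldr Sym (k # ks) (\<lambda>t. \<Sum>\<sigma>\<in>A. G (t(m := t m \<circ> \<sigma>)) * c \<sigma> t) t =
     (\<Sum>\<pi> | \<pi> permutes {1..k}. \<Sum>\<sigma>\<in>A. foldr Sym ks G (t(k := t k \<circ> \<pi>, m := t m \<circ> \<sigma>)) * c \<sigma> t)"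
    unfolding foldr.simps comp_def[of "Sym k"] IH Sym_def[of k]
  proof (intro sum.cong refl)
    fix \<pi> \<sigma> assume "\<sigma> \<in> A"
    then have "c \<sigma> (t(k := t k \<circ> \<pi>)) = c \<sigma> t" by (intro Cons.prems(2)) auto
    then show "foldr Sym ks G ((t(k := t k \<circ> \<pi>))(m := (t(k := t k \<circ> \<pi>)) m \<circ> \<sigma>)) * c \<sigma> (t(k := t k \<circ> \<pi>)) =
         foldr Sym ks G (t(k := t k \<circ> \<pi>, m := t m \<circ> \<sigma>)) * c \<sigma> t"
      using km by simp
  qed
  also have "\<dots> = (\<Sum>\<sigma>\<in>A. (\<Sum>\<pi> | \<pi> permutes {1..k}. foldr Sym ks G (t(k := t k \<circ> \<pi>, m := t m \<circ> \<sigma>))) * c \<sigma> t)"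
    by (subst sum.swap) (simp add: sum_distrib_right)
  also have "\<dots> = (\<Sum>\<sigma>\<in>A. foldr Sym (k # ks) G (t(m := t m \<circ> \<sigma>)) * c \<sigma> t)"
    using km by (simp add: Sym_def[of k] fun_upd_twist)
  finally show ?case .
qed simp

lemma U_fun_eq: "U_fun q n \<omega> \<mu> h t = (\<Prod>k\<in>{1..<n}. sorted_kernel q \<mu> h \<omega> k (t (k + 1)) (t k))"
  by (simp add: U_fun_def sorted_kernel_def)

text \<open>Each \<open>Sym m\<close> runs over all of S_m, so composing its permutations with
  \<open>rank_perm\<close> only rearranges the summands. Thus the variables may be listed by
  position instead of by rank.\<close>

lemma foldr_Sym_U_fun:
  assumes "inj_on \<omega> {1..m}" "m \<ge> 1"
  shows "foldr Sym [1..<m] (U_fun q m \<omega> \<mu> h) t = wsum q \<mu> h \<omega> t m (t m \<circ> rank_perm \<omega> m)"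
  using assms(2,1)
proof (induction m arbitrary: t rule: nat_induct_at_least)
  case base
  have "{\<sigma>. \<sigma> permutes {Suc 0..0}} = {id}" by auto
  then show ?case by (simp add: U_fun_def kernel_def)
next
  case (Suc m)
  have inj: "inj_on \<omega> {1..m}" using Suc.prems by (rule inj_on_subset) auto
  have U: "U_fun q (Suc m) \<omega> \<mu> h t = U_fun q m \<omega> \<mu> h t * sorted_kernel q \<mu> h \<omega> m (t (Suc m)) (t m)" for t
    using Suc.hyps by (simp add: U_fun_eq prod.atLeastLessThan_Suc)
  have "Sym m (U_fun q (Suc m) \<omega> \<mu> h) = (\<lambda>t. \<Sum>\<sigma> | \<sigma> permutes {1..m}.
      U_fun q m \<omega> \<mu> h (t(m := t m \<circ> \<sigma>)) * sorted_kernel q \<mu> h \<omega> m (t (Suc m)) (t m \<circ> \<sigma>))"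
    by (simp add: fun_eq_iff Sym_def U)
  then have "foldr Sym [1..<Suc m] (U_fun q (Suc m) \<omega> \<mu> h) t = foldr Sym [1..<m] (\<lambda>t. \<Sum>\<sigma> | \<sigma> permutes {1..m}.
      U_fun q m \<omega> \<mu> h (t(m := t m \<circ> \<sigma>)) * sorted_kernel q \<mu> h \<omega> m (t (Suc m)) (t m \<circ> \<sigma>)) t"
    using Suc.hyps by simp
  also have "\<dots> = (\<Sum>\<sigma> | \<sigma> permutes {1..m}. foldr Sym [1..<m] (U_fun q m \<omega> \<mu> h) (t(m := t m \<circ> \<sigma>)) *
      sorted_kernel q \<mu> h \<omega> m (t (Suc m)) (t m \<circ> \<sigma>))"
    by (rule foldr_Sym_sum) auto
  also have "\<dots> = (\<Sum>\<sigma> | \<sigma> permutes {1..m}. wsum q \<mu> h \<omega> t m (t m \<circ> (\<sigma> \<circ> rank_perm \<omega> m)) *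
      kernel q \<mu> h \<omega> m (t (Suc m) \<circ> rank_perm \<omega> (Suc m)) (t m \<circ> (\<sigma> \<circ> rank_perm \<omega> m)))"
  proof (rule sum.cong[OF refl])
    fix \<sigma>
    show "foldr Sym [1..<m] (U_fun q m \<omega> \<mu> h) (t(m := t m \<circ> \<sigma>)) *
         sorted_kernel q \<mu> h \<omega> m (t (Suc m)) (t m \<circ> \<sigma>) =
         wsum q \<mu> h \<omega> t m (t m \<circ> (\<sigma> \<circ> rank_perm \<omega> m)) *
         kernel q \<mu> h \<omega> m (t (Suc m) \<circ> rank_perm \<omega> (Suc m)) (t m \<circ> (\<sigma> \<circ> rank_perm \<omega> m))"
      unfolding Suc.IH[OF inj] Suc_eq_plus1 sorted_kernel_eq[OF Suc.prems[unfolded Suc_eq_plus1]]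
      using wsum_cong[of m "t(m := t m \<circ> \<sigma>)" t] by (simp add: comp_assoc)
  qed
  also have "\<dots> = wsum q \<mu> h \<omega> t (Suc m) (t (Suc m) \<circ> rank_perm \<omega> (Suc m))"
    using sum_permutations_compose_right[OF rank_perm_permutes[OF inj],
        of "\<lambda>\<sigma>. wsum q \<mu> h \<omega> t m (t m \<circ> \<sigma>) * kernel q \<mu> h \<omega> m (t (Suc m) \<circ> rank_perm \<omega> (Suc m)) (t m \<circ> \<sigma>)"]
    by (simp add: mult.commute)
  finally show ?case .
qed

text \<open>The values on the top level are 1, ..., n, so the rank of \<omega>(i) is \<omega>(i)
  itself and z is listed as z o \<omega>.\<close>

lemma weight_hat_eq:
  assumes "\<omega> permutes {1..n}" "n \<ge> 1"
  shows "weight_hat q n \<omega> \<gamma> z \<mu> h = (theta q h / theta'1 q) ^ ((n - 1) * n * (2 * n - 1) div 6) *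
     (wsum q \<mu> h \<omega> (\<lambda>_. \<gamma>) n (z \<circ> \<omega>) / (\<Prod>k\<in>{1..<n}. \<Prod>i\<in>{1..k}. \<Prod>j\<in>{1..k}. theta q (h * \<gamma> i / \<gamma> j)))"
proof -
  have "wsum q \<mu> h \<omega> (\<lambda>k. if k = n then z else \<gamma>) n (z \<circ> \<omega>) = wsum q \<mu> h \<omega> (\<lambda>_. \<gamma>) n (z \<circ> \<omega>)"
    by (rule wsum_cong) simp
  moreover have "(\<Prod>k\<in>{1..<n}. \<Prod>i\<in>{1..k}. \<Prod>j\<in>{1..k}.
        theta q (h * (if k = n then z else \<gamma>) i / (if k = n then z else \<gamma>) j)) =
      (\<Prod>k\<in>{1..<n}. \<Prod>i\<in>{1..k}. \<Prod>j\<in>{1..k}. theta q (h * \<gamma> i / \<gamma> j))"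
    by (rule prod.cong) auto
  ultimately show ?thesis
    unfolding weight_hat_def weight_def
    unfolding foldr_Sym_U_fun[OF permutes_inj_on[OF assms(1)] assms(2)] rank_perm_eq[OF assms(1)] by simp
qed

section \<open>Exchanging adjacent values\<close>

lemma genericD:
  assumes "generic q n z \<mu> h"
  shows "h \<noteq> 0" "theta q h \<noteq> 0" "i \<in> {1..n} \<Longrightarrow> z i \<noteq> 0" "i \<in> {1..n} \<Longrightarrow> \<mu> i \<noteq> 0"
    "i \<in> {1..n} \<Longrightarrow> j \<in> {1..n} \<Longrightarrow> i \<noteq> j \<Longrightarrow> theta q (z i / z j) \<noteq> 0"
    "i \<in> {1..n} \<Longrightarrow> j \<in> {1..n} \<Longrightarrow> i \<noteq> j \<Longrightarrow> theta q (\<mu> i / \<mu> j) \<noteq> 0"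
    "i \<in> {1..n} \<Longrightarrow> j \<in> {1..n} \<Longrightarrow> i \<noteq> j \<Longrightarrow> theta q (h * \<mu> i / \<mu> j) \<noteq> 0"
  using assms unfolding generic_def by auto

text \<open>The smaller of two consecutive values stands on the left, so exchanging them increases
  the length. The tuple \<gamma> provides the variables of all lower levels; its genericity keeps
  the denominators in them away from zero.\<close>

locale adjacent_values =
  fixes q h :: complex and \<mu> \<gamma> :: "nat \<Rightarrow> complex" and n :: nat and \<omega> :: "nat \<Rightarrow> nat" and p r :: nat
  assumes q: "norm q < 1" and perm: "\<omega> permutes {1..n}" and generic: "generic q n \<gamma> \<mu> h"
    and p: "p \<in> {1..n}" and r: "r \<in> {1..n}" and less: "p < r" and adj: "\<omega> r = Suc (\<omega> p)"
begin

definition "\<tau> = Transposition.transpose p r"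

lemma \<tau>_simps: "\<tau> p = r" "\<tau> r = p" "i \<noteq> p \<Longrightarrow> i \<noteq> r \<Longrightarrow> \<tau> i = i"
  by (simp_all add: \<tau>_def)

lemma \<tau>_\<tau>: "\<tau> (\<tau> i) = i"
  by (simp add: \<tau>_def)

lemma \<tau>_mem: "\<tau> i \<in> {p, r} \<longleftrightarrow> i \<in> {p, r}"
  by (auto simp: \<tau>_def Transposition.transpose_def split: if_splits)

lemma \<tau>_permutes: "r \<le> k \<Longrightarrow> \<tau> permutes {1..k}"
  unfolding \<tau>_def using p less by (intro permutes_swap_id) auto

text \<open>No value lies between consecutive integers. Hence comparisons with a third position do
  not notice the exchange.\<close>

lemma value_adj: "i \<notin> {p, r} \<Longrightarrow> \<omega> i < \<omega> p \<and> \<omega> i < \<omega> r \<or> \<omega> i > \<omega> p \<and> \<omega> i > \<omega> r"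
  using permutes_inj[OF perm] adj by (metis insertCI injD less_antisym not_less_eq linorder_neqE_nat)

lemma \<tau>_less:
  assumes "\<not> (i \<in> {p, r} \<and> l \<in> {p, r})"
  shows "\<omega> (\<tau> i) < \<omega> l \<longleftrightarrow> \<omega> i < \<omega> l" "\<omega> i < \<omega> (\<tau> l) \<longleftrightarrow> \<omega> i < \<omega> l" "\<omega> (\<tau> i) < \<omega> (\<tau> l) \<longleftrightarrow> \<omega> i < \<omega> l"
  using assms value_adj[of i] value_adj[of l] \<tau>_simps by (cases "i = p"; cases "i = r"; cases "l = p"; cases "l = r"; force)+

lemma factor_\<tau>:
  assumes "\<not> (i \<in> {p, r} \<and> l \<in> {p, r})"
  shows "factor q \<mu> h \<omega> k (\<tau> i) l = factor q \<mu> h \<omega> k i l"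
    and "factor q \<mu> h \<omega> k i (\<tau> l) = factor q \<mu> h \<omega> k i l"
    and "factor q \<mu> h (\<omega> \<circ> \<tau>) k i l = factor q \<mu> h \<omega> k i l"
proof -
  have sym: "\<not> (l \<in> {p, r} \<and> i \<in> {p, r})" using assms by auto
  have d: "l = \<tau> i \<longleftrightarrow> l = i" "\<tau> l = i \<longleftrightarrow> l = i"
    using assms \<tau>_mem[of i] \<tau>_mem[of l] \<tau>_simps by (metis insertCI)+
  have i: "\<tau> i = i" if "l = i" using assms that \<tau>_simps(3) by auto
  \<comment> \<open>For l = i the factor also compares \<omega> i with \<omega> (k+1). Even if k+1
    is p or r, the position i is then a third one.\<close>
  have c: "\<omega> (\<tau> i) \<le> \<omega> (\<tau> (k + 1)) \<longleftrightarrow> \<omega> i \<le> \<omega> (k + 1)" if "l = i"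
    using \<tau>_less(3)[of "k + 1" i] assms that by (simp add: linorder_not_less[symmetric])
  show "factor q \<mu> h \<omega> k (\<tau> i) l = factor q \<mu> h \<omega> k i l"
    unfolding factor_def \<tau>_less(2)[OF sym] d using i by (cases "l = i") auto
  show "factor q \<mu> h \<omega> k i (\<tau> l) = factor q \<mu> h \<omega> k i l"
    unfolding factor_def \<tau>_less(1)[OF sym] d by auto
  show "factor q \<mu> h (\<omega> \<circ> \<tau>) k i l = factor q \<mu> h \<omega> k i l"
    unfolding factor_def comp_def \<tau>_less(3)[OF sym] using c by (cases "l = i") auto
qed

text \<open>Only pairs inside {p, r} x {p, r} react to the exchange. \<open>factor_rest\<close> and
  \<open>delta_rest\<close> collect all other pairs and form the prefactor common to all terms of
  the relation.\<close>

definition factor_rest :: "(nat \<Rightarrow> nat) \<Rightarrow> nat \<Rightarrow> (nat \<Rightarrow> complex) \<Rightarrow> (nat \<Rightarrow> complex) \<Rightarrow> complex" where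
  "factor_rest w k Y y = (\<Prod>(i, l)\<in>{1..k} \<times> {1..k + 1} - {p, r} \<times> {p, r}. factor q \<mu> h w k i l (Y l / y i))"

definition delta_rest :: "(nat \<Rightarrow> nat) \<Rightarrow> nat \<Rightarrow> (nat \<Rightarrow> complex) \<Rightarrow> complex" where
  "delta_rest w k y = (\<Prod>(i, l)\<in>{(i, l). i \<in> {1..k} \<and> l \<in> {1..k} \<and> w i < w l} - {p, r} \<times> {p, r}. delta q (y l / y i) h)"

lemma factor_rest_\<tau>:
  "factor_rest (\<omega> \<circ> \<tau>) k Y y = factor_rest \<omega> k Y y"
  "r \<le> k + 1 \<Longrightarrow> factor_rest \<omega> k (Y \<circ> \<tau>) y = factor_rest \<omega> k Y y"
  "r \<le> k \<Longrightarrow> factor_rest \<omega> k Y (y \<circ> \<tau>) = factor_rest \<omega> k Y y"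
proof -
  show "factor_rest (\<omega> \<circ> \<tau>) k Y y = factor_rest \<omega> k Y y"
    unfolding factor_rest_def
  proof (rule prod.cong[OF refl])
    fix x assume "x \<in> {1..k} \<times> {1..k + 1} - {p, r} \<times> {p, r}"
    then obtain i l where x: "x = (i, l)" "\<not> (i \<in> {p, r} \<and> l \<in> {p, r})" by blast
    show "(case x of (i, l) \<Rightarrow> factor q \<mu> h (\<omega> \<circ> \<tau>) k i l (Y l / y i)) =
        (case x of (i, l) \<Rightarrow> factor q \<mu> h \<omega> k i l (Y l / y i))"
      using factor_\<tau>(3)[OF x(2)] x(1) by simp
  qed
  show "factor_rest \<omega> k (Y \<circ> \<tau>) y = factor_rest \<omega> k Y y" if "r \<le> k + 1"
    unfolding factor_rest_def
  proof (rule prod.reindex_bij_witness[of _ "map_prod id \<tau>" "map_prod id \<tau>"])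
    fix x assume "x \<in> {1..k} \<times> {1..k + 1} - {p, r} \<times> {p, r}"
    then obtain i l where x: "x = (i, l)" "i \<in> {1..k}" "l \<in> {1..k + 1}" "\<not> (i \<in> {p, r} \<and> l \<in> {p, r})" by blast
    then show "map_prod id \<tau> x \<in> {1..k} \<times> {1..k + 1} - {p, r} \<times> {p, r}"
        "map_prod id \<tau> x \<in> {1..k} \<times> {1..k + 1} - {p, r} \<times> {p, r}"
      using permutes_in_image[OF \<tau>_permutes[OF that], of l] \<tau>_mem[of l] by auto
    show "map_prod id \<tau> (map_prod id \<tau> x) = x" "map_prod id \<tau> (map_prod id \<tau> x) = x" using x by (simp_all add: \<tau>_\<tau>)
    show "(case map_prod id \<tau> x of (i, l) \<Rightarrow> factor q \<mu> h \<omega> k i l (Y l / y i)) =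
        (case x of (i, l) \<Rightarrow> factor q \<mu> h \<omega> k i l ((Y \<circ> \<tau>) l / y i))"
      using x by (simp add: factor_\<tau>)
  qed
  show "factor_rest \<omega> k Y (y \<circ> \<tau>) = factor_rest \<omega> k Y y" if "r \<le> k"
    unfolding factor_rest_def
  proof (rule prod.reindex_bij_witness[of _ "map_prod \<tau> id" "map_prod \<tau> id"])
    fix x assume "x \<in> {1..k} \<times> {1..k + 1} - {p, r} \<times> {p, r}"
    then obtain i l where x: "x = (i, l)" "i \<in> {1..k}" "l \<in> {1..k + 1}" "\<not> (i \<in> {p, r} \<and> l \<in> {p, r})" by blast
    then show "map_prod \<tau> id x \<in> {1..k} \<times> {1..k + 1} - {p, r} \<times> {p, r}"
        "map_prod \<tau> id x \<in> {1..k} \<times> {1..k + 1} - {p, r} \<times> {p, r}"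
      using permutes_in_image[OF \<tau>_permutes[OF that], of i] \<tau>_mem[of i] by auto
    show "map_prod \<tau> id (map_prod \<tau> id x) = x" "map_prod \<tau> id (map_prod \<tau> id x) = x" using x by (simp_all add: \<tau>_\<tau>)
    show "(case map_prod \<tau> id x of (i, l) \<Rightarrow> factor q \<mu> h \<omega> k i l (Y l / y i)) =
        (case x of (i, l) \<Rightarrow> factor q \<mu> h \<omega> k i l (Y l / (y \<circ> \<tau>) i))"
      using x by (simp add: factor_\<tau>)
  qed
qed

lemma delta_rest_\<tau>:
  "delta_rest (\<omega> \<circ> \<tau>) k y = delta_rest \<omega> k y"
  "r \<le> k \<Longrightarrow> delta_rest \<omega> k (y \<circ> \<tau>) = delta_rest \<omega> k y"
proof -
  show "delta_rest (\<omega> \<circ> \<tau>) k y = delta_rest \<omega> k y"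
  proof -
    have "(\<omega> \<circ> \<tau>) i < (\<omega> \<circ> \<tau>) l \<longleftrightarrow> \<omega> i < \<omega> l" if "(i, l) \<notin> {p, r} \<times> {p, r}" for i l
      using \<tau>_less(3)[of i l] that by auto
    then have "{(i, l). i \<in> {1..k} \<and> l \<in> {1..k} \<and> (\<omega> \<circ> \<tau>) i < (\<omega> \<circ> \<tau>) l} - {p, r} \<times> {p, r} =
        {(i, l). i \<in> {1..k} \<and> l \<in> {1..k} \<and> \<omega> i < \<omega> l} - {p, r} \<times> {p, r}"
      by blast
    then show ?thesis unfolding delta_rest_def by simp
  qed
  show "delta_rest \<omega> k (y \<circ> \<tau>) = delta_rest \<omega> k y" if "r \<le> k"
    unfolding delta_rest_def
  proof (rule prod.reindex_bij_witness[of _ "map_prod \<tau> \<tau>" "map_prod \<tau> \<tau>"])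
    fix x assume "x \<in> {(i, l). i \<in> {1..k} \<and> l \<in> {1..k} \<and> \<omega> i < \<omega> l} - {p, r} \<times> {p, r}"
    then obtain i l where x: "x = (i, l)" "i \<in> {1..k}" "l \<in> {1..k}" "\<omega> i < \<omega> l" "\<not> (i \<in> {p, r} \<and> l \<in> {p, r})" by blast
    then show "map_prod \<tau> \<tau> x \<in> {(i, l). i \<in> {1..k} \<and> l \<in> {1..k} \<and> \<omega> i < \<omega> l} - {p, r} \<times> {p, r}"
        "map_prod \<tau> \<tau> x \<in> {(i, l). i \<in> {1..k} \<and> l \<in> {1..k} \<and> \<omega> i < \<omega> l} - {p, r} \<times> {p, r}"
      using permutes_in_image[OF \<tau>_permutes[OF that], of i] permutes_in_image[OF \<tau>_permutes[OF that], of l]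
        \<tau>_mem[of i] \<tau>_mem[of l] \<tau>_less(3)[OF x(5)] by auto
    show "map_prod \<tau> \<tau> (map_prod \<tau> \<tau> x) = x" "map_prod \<tau> \<tau> (map_prod \<tau> \<tau> x) = x" using x by (simp_all add: \<tau>_\<tau>)
    show "(case map_prod \<tau> \<tau> x of (i, l) \<Rightarrow> delta q (y l / y i) h) =
        (case x of (i, l) \<Rightarrow> delta q ((y \<circ> \<tau>) l / (y \<circ> \<tau>) i) h)"
      using x by simp
  qed
qed

lemma kernel_split:
  "kernel q \<mu> h w k Y y = factor_rest w k Y y * delta_rest w k y *
     (\<Prod>(i, l)\<in>{1..k} \<times> {1..k + 1} \<inter> {p, r} \<times> {p, r}. factor q \<mu> h w k i l (Y l / y i)) *
     (\<Prod>(i, l)\<in>{(i, l). i \<in> {1..k} \<and> l \<in> {1..k} \<and> w i < w l} \<inter> {p, r} \<times> {p, r}. delta q (y l / y i) h)"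
proof -
  have fin: "finite {(i, l). i \<in> {1..k} \<and> l \<in> {1..k} \<and> w i < w l}"
    by (rule finite_subset[of _ "{1..k} \<times> {1..k}"]) auto
  have s: "prod f A = prod f (A - B) * prod f (A \<inter> B)" if "finite A" for A B and f :: "nat \<times> nat \<Rightarrow> complex"
    using that by (metis prod.Int_Diff mult.commute)
  show ?thesis
    unfolding kernel_def factor_rest_def delta_rest_def
    by (subst s[where B = "{p, r} \<times> {p, r}"], simp, subst (2) s[where B = "{p, r} \<times> {p, r}"], rule fin) (simp add: mult_ac)
qed

text \<open>At level r-1 the position r belongs to the upper variables only. The two remaining
  factors are those of \<open>two_point_relation\<close>.\<close>

lemma kernel_first:
  assumes "k + 1 = r"
  shows "kernel q \<mu> h w k Y y = factor_rest w k Y y * delta_rest w k y *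
     (factor q \<mu> h w k p p (Y p / y p) * factor q \<mu> h w k p r (Y r / y p))"
proof -
  have "{1..k} \<times> {1..k + 1} \<inter> {p, r} \<times> {p, r} = {(p, p), (p, r)}"
     and "{(i, l). i \<in> {1..k} \<and> l \<in> {1..k} \<and> w i < w l} \<inter> {p, r} \<times> {p, r} = {}"
    using assms p less by auto
  then show ?thesis using less by (simp add: kernel_split)
qed

text \<open>From level r on, both positions occur among the upper and the lower variables. If w
  separates their values, the four factors and the one delta form the expression \<open>M\<close> of
  \<open>four_point_relation\<close>.\<close>

lemma kernel_later:
  assumes "r \<le> k"
  shows "kernel q \<mu> h w k Y y = factor_rest w k Y y * delta_rest w k y *
     (factor q \<mu> h w k p p (Y p / y p) * factor q \<mu> h w k p r (Y r / y p) *
     (factor q \<mu> h w k r p (Y p / y r) * factor q \<mu> h w k r r (Y r / y r))) *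
     (if w p < w r then delta q (y r / y p) h else if w r < w p then delta q (y p / y r) h else 1)"
proof -
  have "{1..k} \<times> {1..k + 1} \<inter> {p, r} \<times> {p, r} = {(p, p), (p, r), (r, p), (r, r)}"
     and "{(i, l). i \<in> {1..k} \<and> l \<in> {1..k} \<and> w i < w l} \<inter> {p, r} \<times> {p, r} =
       (if w p < w r then {(p, r)} else if w r < w p then {(r, p)} else {})"
    using assms p less by auto
  then show ?thesis using less by (simp add: kernel_split mult_ac)
qed

text \<open>The position r is not yet visible, and \<omega> and \<omega> o \<tau> order the
  positions 1, ..., k+1 in the same way.\<close>

lemma kernel_early:
  assumes "k + 1 < r"
  shows "kernel q \<mu> h (\<omega> \<circ> \<tau>) k Y y = kernel q \<mu> h \<omega> k Y y"
proof -
  have "factor q \<mu> h (\<omega> \<circ> \<tau>) k i l x = factor q \<mu> h \<omega> k i l x" if "i \<in> {1..k}" "l \<in> {1..k + 1}" for i l x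
  proof (cases "i \<in> {p, r} \<and> l \<in> {p, r}")
    case True
    then have [simp]: "i = p" "l = p" using that assms by auto
    have "k + 1 \<notin> {p, r}" using that assms by auto
    then have "\<omega> r \<le> \<omega> (\<tau> (k + 1)) \<longleftrightarrow> \<omega> p \<le> \<omega> (k + 1)"
      using value_adj[of "k + 1"] \<tau>_simps(3)[of "k + 1"] by auto
    then show ?thesis by (simp add: factor_def \<tau>_simps)
  qed (simp add: factor_\<tau>)
  moreover have "{(i, l). i \<in> {1..k} \<and> l \<in> {1..k} \<and> (\<omega> \<circ> \<tau>) i < (\<omega> \<circ> \<tau>) l} =
      {(i, l). i \<in> {1..k} \<and> l \<in> {1..k} \<and> \<omega> i < \<omega> l}"
  proof -
    have "(\<omega> \<circ> \<tau>) i < (\<omega> \<circ> \<tau>) l \<longleftrightarrow> \<omega> i < \<omega> l" if "i \<in> {1..k}" "l \<in> {1..k}" for i l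
    proof (cases "i \<in> {p, r} \<and> l \<in> {p, r}")
      case True
      then have "i = p" "l = p" using that assms by auto
      then show ?thesis by simp
    qed (simp add: \<tau>_less)
    then show ?thesis by blast
  qed
  ultimately show ?thesis unfolding kernel_def by (auto intro!: arg_cong2[where f = "(*)"] prod.cong)
qed

lemma wsum_early: "k < r \<Longrightarrow> wsum q \<mu> h (\<omega> \<circ> \<tau>) t k Y = wsum q \<mu> h \<omega> t k Y"
  by (induction k arbitrary: Y) (auto simp: kernel_early)

lemmas generic_simps = genericD[OF generic]

text \<open>Level k+1 is a sum over \<sigma> of a kernel times level k. The induction hypothesis is
  applied to the lower factor, the sum over all \<sigma> allows \<tau> to be moved into the kernel,
  and the kernels satisfy an intertwining relation. The coefficients have the same form at every
  level.\<close>

theorem wsum_swap: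
  assumes "r \<le> k" "k \<le> n" "Y p \<noteq> 0" "Y r \<noteq> 0" "theta q (Y r / Y p) \<noteq> 0"
  shows "wsum q \<mu> h (\<omega> \<circ> \<tau>) (\<lambda>_. \<gamma>) k (Y \<circ> \<tau>) =
    delta q (Y r / Y p) (\<mu> r / \<mu> p) * wsum q \<mu> h \<omega> (\<lambda>_. \<gamma>) k Y +
    delta q (Y p / Y r) h * wsum q \<mu> h \<omega> (\<lambda>_. \<gamma>) k (Y \<circ> \<tau>)"
  using assms
proof (induction k arbitrary: Y rule: dec_induct)
  case base
  obtain k where k: "r = Suc k" using less by (cases r) auto
  have "kernel q \<mu> h (\<omega> \<circ> \<tau>) k (Y \<circ> \<tau>) y =
    delta q (Y r / Y p) (\<mu> r / \<mu> p) * kernel q \<mu> h \<omega> k Y y + delta q (Y p / Y r) h * kernel q \<mu> h \<omega> k (Y \<circ> \<tau>) y"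
    if "y p \<noteq> 0" for y
  proof -
    \<comment> \<open>For the pair (p, p), the kernel of \<omega> contains h * \<mu> r / \<mu> p and
      that of \<omega> o \<tau> only \<mu> r / \<mu> p, because there the value at k+1 = r is the
      smaller one.\<close>
    have "theta q (h * (\<mu> r / \<mu> p)) \<noteq> 0" using generic_simps(7)[OF r p] less by simp
    then have "theta_delta q (Y p / y p) h * theta_delta q (Y r / y p) (\<mu> r / \<mu> p) =
       delta q (Y r / Y p) (\<mu> r / \<mu> p) * (theta_delta q (Y p / y p) (h * (\<mu> r / \<mu> p)) * theta q (Y r / y p)) +
       delta q (Y p / Y r) h * (theta_delta q (Y r / y p) (h * (\<mu> r / \<mu> p)) * theta q (Y p / y p))"
      using base that p r less generic_simps by (intro two_point_relation[OF q]) auto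
    moreover have kr: "k + 1 = r" "r \<le> k + 1" using k by auto
    ultimately show ?thesis
      unfolding kernel_first[OF kr(1)] factor_rest_\<tau>(1) factor_rest_\<tau>(2)[OF kr(2)] delta_rest_\<tau>(1) factor_def kr(1)
      using less by (simp add: \<tau>_simps adj algebra_simps)
  qed
  moreover have "(\<gamma> \<circ> \<sigma>) p \<noteq> 0" if "\<sigma> permutes {1..k}" for \<sigma>
    using generic_simps(3) permutes_in_image[OF that, of p] p r less k by auto
  moreover have early: "wsum q \<mu> h (\<omega> \<circ> \<tau>) t k Z = wsum q \<mu> h \<omega> t k Z" for t Z
    by (rule wsum_early) (simp add: k)
  ultimately show ?case
    using k unfolding k wsum.simps
    by (simp add: early sum_distrib_left sum.distrib[symmetric] algebra_simps k[symmetric])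
next
  case (step k)
  have rk: "r \<le> k" "r \<le> k + 1" and kn: "k + 1 \<in> {1..n}" "k + 1 \<noteq> p" "k + 1 \<noteq> r" "k \<noteq> p" "p \<noteq> r" using step less by auto
  have pr: "\<omega> p < \<omega> r" "\<not> \<omega> r < \<omega> p" using adj by auto
  \<comment> \<open>The value at k+1 lies above or below both exchanged values, so p and r have the
    same exponent of h. This is why P / R = \<mu> r / \<mu> p does not depend on the level.\<close>
  define e where "e = (if \<omega> p \<le> \<omega> (k + 1) then 1 else 0 :: nat)"
  have e: "(if \<omega> p \<le> \<omega> (k + 1) then 1 else 0) = e" "(if \<omega> r \<le> \<omega> (k + 1) then 1 else 0) = e"
    "(\<omega> \<circ> \<tau>) (k + 1) = \<omega> (k + 1)"
    using value_adj[of "k + 1"] kn \<tau>_simps(3)[of "k + 1"] by (auto simp: e_def)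
  define P R where "P = h ^ e * \<mu> (k + 1) / \<mu> p" and "R = h ^ e * \<mu> (k + 1) / \<mu> r"
  have PR: "P / R = \<mu> r / \<mu> p" "P \<noteq> 0" "R \<noteq> 0" "theta q P \<noteq> 0" "theta q R \<noteq> 0"
    using generic_simps(1,4,6,7) p r kn by (auto simp: P_def R_def e_def)
  define y where "y \<sigma> = \<gamma> \<circ> \<sigma>" for \<sigma> :: "nat \<Rightarrow> nat"
  have nz: "y \<sigma> p \<noteq> 0" "y \<sigma> r \<noteq> 0" "theta q (y \<sigma> r / y \<sigma> p) \<noteq> 0" if "\<sigma> permutes {1..k}" for \<sigma>
  proof -
    have "\<sigma> p \<in> {1..k}" "\<sigma> r \<in> {1..k}" using permutes_in_image[OF that] p r less rk by auto
    moreover have "\<sigma> p \<noteq> \<sigma> r" using permutes_inj[OF that] less by (auto dest: injD)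
    ultimately show "y \<sigma> p \<noteq> 0" "y \<sigma> r \<noteq> 0" "theta q (y \<sigma> r / y \<sigma> p) \<noteq> 0"
      using generic_simps(3,5) step.prems(1) by (auto simp: y_def)
  qed
  define K K' where "K = kernel q \<mu> h \<omega> k" and "K' = kernel q \<mu> h (\<omega> \<circ> \<tau>) k"
  define W W' where "W = wsum q \<mu> h \<omega> (\<lambda>_. \<gamma>) k" and "W' = wsum q \<mu> h (\<omega> \<circ> \<tau>) (\<lambda>_. \<gamma>) k"
  define m where "m = \<mu> r / \<mu> p"
  \<comment> \<open>Multiplied by W (y \<sigma>) and summed over \<sigma>, this passes the relation
    from level k to level k+1.\<close>
  have key: "K' (Y \<circ> \<tau>) (y \<sigma> \<circ> \<tau>) * delta q (y \<sigma> r / y \<sigma> p) m + K' (Y \<circ> \<tau>) (y \<sigma>) * delta q (y \<sigma> r / y \<sigma> p) h =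
     delta q (Y r / Y p) m * K Y (y \<sigma>) + delta q (Y p / Y r) h * K (Y \<circ> \<tau>) (y \<sigma>)" if "\<sigma> permutes {1..k}" for \<sigma>
  proof -
    define M where "M P R x z s u = theta_delta q (x / s) P * theta q (z / s) *
       (theta_delta q (x / u) h * theta_delta q (z / u) R) * delta q (u / s) h" for P R x z s u
    define C where "C = factor_rest \<omega> k Y (y \<sigma>) * delta_rest \<omega> k (y \<sigma>)"
    have K: "K Z (y \<sigma>) = factor_rest \<omega> k Z (y \<sigma>) * delta_rest \<omega> k (y \<sigma>) * M P R (Z p) (Z r) (y \<sigma> p) (y \<sigma> r)" for Z
      unfolding K_def kernel_later[OF rk(1)] M_def using pr kn(5) e(1,2)
      by (simp add: factor_def P_def R_def)
    have K': "K' Z v = factor_rest \<omega> k Z v * delta_rest \<omega> k v * M R P (Z r) (Z p) (v r) (v p)" for Z v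
      unfolding K'_def kernel_later[OF rk(1)] factor_rest_\<tau>(1) delta_rest_\<tau>(1) M_def using pr kn(2,3,5) e
      by (simp add: factor_def P_def R_def \<tau>_simps)
    have "M R P (Y p) (Y r) (y \<sigma> p) (y \<sigma> r) * delta q (y \<sigma> r / y \<sigma> p) (P / R) +
        M R P (Y p) (Y r) (y \<sigma> r) (y \<sigma> p) * delta q (y \<sigma> r / y \<sigma> p) h =
        delta q (Y r / Y p) (P / R) * M P R (Y p) (Y r) (y \<sigma> p) (y \<sigma> r) +
        delta q (Y p / Y r) h * M P R (Y r) (Y p) (y \<sigma> p) (y \<sigma> r)"
      unfolding M_def by (rule four_point_relation[OF q]) (use step.prems nz[OF that] PR generic_simps p r kn in auto)
    then have "C * (M R P (Y p) (Y r) (y \<sigma> p) (y \<sigma> r) * delta q (y \<sigma> r / y \<sigma> p) m +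
        M R P (Y p) (Y r) (y \<sigma> r) (y \<sigma> p) * delta q (y \<sigma> r / y \<sigma> p) h) =
        C * (delta q (Y r / Y p) m * M P R (Y p) (Y r) (y \<sigma> p) (y \<sigma> r) +
        delta q (Y p / Y r) h * M P R (Y r) (Y p) (y \<sigma> p) (y \<sigma> r))"
      unfolding PR(1) m_def by simp
    then show ?thesis
      unfolding K K' factor_rest_\<tau>(2)[OF rk(2)] factor_rest_\<tau>(3)[OF rk(1)] delta_rest_\<tau>(2)[OF rk(1)] C_def
      by (simp add: \<tau>_simps algebra_simps)
  qed
  have W': "W' (y \<sigma> \<circ> \<tau>) = delta q (y \<sigma> r / y \<sigma> p) m * W (y \<sigma>) + delta q (y \<sigma> p / y \<sigma> r) h * W (y \<sigma> \<circ> \<tau>)"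
    if "\<sigma> permutes {1..k}" for \<sigma>
    unfolding W_def W'_def m_def by (rule step.IH) (use step.prems nz[OF that] in auto)
  have comp: "y (\<sigma> \<circ> \<tau>) = y \<sigma> \<circ> \<tau>" for \<sigma> by (simp add: y_def comp_assoc)
  have "wsum q \<mu> h (\<omega> \<circ> \<tau>) (\<lambda>_. \<gamma>) (Suc k) (Y \<circ> \<tau>) = (\<Sum>\<sigma> | \<sigma> permutes {1..k}. K' (Y \<circ> \<tau>) (y \<sigma>) * W' (y \<sigma>))"
    by (simp add: K'_def W'_def y_def)
  also have "\<dots> = (\<Sum>\<sigma> | \<sigma> permutes {1..k}. K' (Y \<circ> \<tau>) (y \<sigma> \<circ> \<tau>) * W' (y \<sigma> \<circ> \<tau>))"
    unfolding comp[symmetric] by (rule sum_permutations_compose_right[OF \<tau>_permutes[OF rk(1)]])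
  also have "\<dots> = (\<Sum>\<sigma> | \<sigma> permutes {1..k}. K' (Y \<circ> \<tau>) (y \<sigma> \<circ> \<tau>) * (delta q (y \<sigma> r / y \<sigma> p) m * W (y \<sigma>))) +
      (\<Sum>\<sigma> | \<sigma> permutes {1..k}. K' (Y \<circ> \<tau>) (y \<sigma> \<circ> \<tau>) * (delta q (y \<sigma> p / y \<sigma> r) h * W (y \<sigma> \<circ> \<tau>)))"
    unfolding sum.distrib[symmetric] by (rule sum.cong) (simp_all add: W' algebra_simps)
  \<comment> \<open>In the second sum the substitution \<sigma> -> \<sigma> o \<tau> is undone, so
    that both sums contain W (y \<sigma>).\<close>
  also have "(\<Sum>\<sigma> | \<sigma> permutes {1..k}. K' (Y \<circ> \<tau>) (y \<sigma> \<circ> \<tau>) * (delta q (y \<sigma> p / y \<sigma> r) h * W (y \<sigma> \<circ> \<tau>))) =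
      (\<Sum>\<sigma> | \<sigma> permutes {1..k}. K' (Y \<circ> \<tau>) (y \<sigma>) * (delta q (y \<sigma> r / y \<sigma> p) h * W (y \<sigma>)))"
    using sum_permutations_compose_right[OF \<tau>_permutes[OF rk(1)],
      of "\<lambda>\<sigma>. K' (Y \<circ> \<tau>) (y \<sigma>) * (delta q (y \<sigma> r / y \<sigma> p) h * W (y \<sigma>))"]
    by (simp add: comp \<tau>_simps)
  also have "(\<Sum>\<sigma> | \<sigma> permutes {1..k}. K' (Y \<circ> \<tau>) (y \<sigma> \<circ> \<tau>) * (delta q (y \<sigma> r / y \<sigma> p) m * W (y \<sigma>))) + \<dots> =
      (\<Sum>\<sigma> | \<sigma> permutes {1..k}. (delta q (Y r / Y p) m * K Y (y \<sigma>) + delta q (Y p / Y r) h * K (Y \<circ> \<tau>) (y \<sigma>)) * W (y \<sigma>))"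
    unfolding sum.distrib[symmetric]
  proof (rule sum.cong[OF refl])
    fix \<sigma> assume "\<sigma> \<in> {\<sigma>. \<sigma> permutes {1..k}}"
    then show "K' (Y \<circ> \<tau>) (y \<sigma> \<circ> \<tau>) * (delta q (y \<sigma> r / y \<sigma> p) m * W (y \<sigma>)) +
        K' (Y \<circ> \<tau>) (y \<sigma>) * (delta q (y \<sigma> r / y \<sigma> p) h * W (y \<sigma>)) =
        (delta q (Y r / Y p) m * K Y (y \<sigma>) + delta q (Y p / Y r) h * K (Y \<circ> \<tau>) (y \<sigma>)) * W (y \<sigma>)"
      unfolding mult.assoc[symmetric] distrib_right[symmetric] using key[of \<sigma>] by simp
  qed
  also have "\<dots> = delta q (Y r / Y p) m * (\<Sum>\<sigma> | \<sigma> permutes {1..k}. K Y (y \<sigma>) * W (y \<sigma>)) +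
      delta q (Y p / Y r) h * (\<Sum>\<sigma> | \<sigma> permutes {1..k}. K (Y \<circ> \<tau>) (y \<sigma>) * W (y \<sigma>))"
    by (simp add: sum_distrib_left sum.distrib algebra_simps)
  finally show ?case unfolding K_def W_def m_def y_def wsum.simps .
qed

end

section \<open>Inversions and length\<close>

definition inversions :: "nat \<Rightarrow> (nat \<Rightarrow> nat) \<Rightarrow> (nat \<times> nat) set" where
  "inversions n \<omega> = {(i, j). i \<in> {1..n} \<and> j \<in> {1..n} \<and> i < j \<and> \<omega> i > \<omega> j}"

lemma finite_inversions [simp]: "finite (inversions n \<omega>)"
  by (rule finite_subset[of _ "{1..n} \<times> {1..n}"]) (auto simp: inversions_def)

lemma inversions_id: "inversions n id = {}"
  by (auto simp: inversions_def)

lemma sk_simps: "sk k k = Suc k" "sk k (Suc k) = k" "i \<noteq> k \<Longrightarrow> i \<noteq> Suc k \<Longrightarrow> sk k i = i"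
  by (simp_all add: sk_def)

lemma sk_sk: "sk k (sk k i) = i" "sk k \<circ> sk k = id" "f \<circ> sk k \<circ> sk k = f"
  by (simp_all add: sk_def fun_eq_iff)

lemma sk_permutes: "1 \<le> k \<Longrightarrow> k < n \<Longrightarrow> sk k permutes {1..n}"
  unfolding sk_def by (rule permutes_swap_id) auto

lemma sk_less:
  assumes "\<not> (a \<in> {k, Suc k} \<and> b \<in> {k, Suc k})"
  shows "sk k a < sk k b \<longleftrightarrow> a < b"
  using assms unfolding sk_def Transposition.transpose_def by auto

text \<open>An equality of sets is wanted, not just of their sizes: the normalization is a product
  over inversions with factors depending on \<mu>.\<close>

lemma inversions_left:
  assumes "\<omega> permutes {1..n}" "p \<in> {1..n}" "r \<in> {1..n}" "p < r" "\<omega> r = Suc (\<omega> p)"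
  shows "inversions n (sk (\<omega> p) \<circ> \<omega>) = insert (p, r) (inversions n \<omega>)" "(p, r) \<notin> inversions n \<omega>"
proof -
  have v: "\<omega> i = \<omega> p \<longleftrightarrow> i = p" "\<omega> i = Suc (\<omega> p) \<longleftrightarrow> i = r" for i
    using permutes_inj[OF assms(1)] assms(5) by (metis injD)+
  have "sk (\<omega> p) (\<omega> j) < sk (\<omega> p) (\<omega> i) \<longleftrightarrow> (i, j) = (p, r) \<or> \<omega> j < \<omega> i" if "i < j" for i j
  proof (cases "\<omega> j \<in> {\<omega> p, Suc (\<omega> p)} \<and> \<omega> i \<in> {\<omega> p, Suc (\<omega> p)}")
    case True
    then have "(i, j) = (p, r)" using that assms(4) by (auto simp: v)
    then show ?thesis using assms(5) by (simp add: sk_simps)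
  next
    case False
    then have "(i, j) \<noteq> (p, r)" using assms(5) by auto
    then show ?thesis using sk_less[OF False] by blast
  qed
  then show "inversions n (sk (\<omega> p) \<circ> \<omega>) = insert (p, r) (inversions n \<omega>)"
    using assms unfolding inversions_def by fastforce
  show "(p, r) \<notin> inversions n \<omega>" using assms by (auto simp: inversions_def)
qed

lemma inversions_right:
  assumes "1 \<le> k" "k < n" "\<omega> k < \<omega> (Suc k)"
  shows "inversions n (\<omega> \<circ> sk k) = insert (k, Suc k) (map_prod (sk k) (sk k) ` inversions n \<omega>)"
    "(k, Suc k) \<notin> map_prod (sk k) (sk k) ` inversions n \<omega>"
proof -
  have *: "(i, j) \<in> inversions n (\<omega> \<circ> sk k) \<longleftrightarrow> (i, j) = (k, Suc k) \<or> (sk k i, sk k j) \<in> inversions n \<omega>" for i j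
  proof (cases "i \<in> {k, Suc k} \<and> j \<in> {k, Suc k}")
    case True
    then show ?thesis using assms by (auto simp: inversions_def sk_simps)
  next
    case False
    have "sk k i \<in> {1..n} \<longleftrightarrow> i \<in> {1..n}" "sk k j \<in> {1..n} \<longleftrightarrow> j \<in> {1..n}"
      using permutes_in_image[OF sk_permutes[OF assms(1,2)]] by blast+
    then show ?thesis using False sk_less[OF False] by (auto simp: inversions_def)
  qed
  have im: "(i, j) \<in> map_prod (sk k) (sk k) ` inversions n \<omega> \<longleftrightarrow> (sk k i, sk k j) \<in> inversions n \<omega>" for i j
    by (force simp: sk_sk)
  show "inversions n (\<omega> \<circ> sk k) = insert (k, Suc k) (map_prod (sk k) (sk k) ` inversions n \<omega>)"
  proof (rule set_eqI)
    fix x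
    show "x \<in> inversions n (\<omega> \<circ> sk k) \<longleftrightarrow> x \<in> insert (k, Suc k) (map_prod (sk k) (sk k) ` inversions n \<omega>)"
      by (cases x) (simp only: * im insert_iff)
  qed
  show "(k, Suc k) \<notin> map_prod (sk k) (sk k) ` inversions n \<omega>"
    unfolding im by (simp add: sk_simps inversions_def)
qed

lemma inj_map_prod_sk: "inj_on (map_prod (sk k) (sk k)) A"
  by (rule inj_onI) (metis (no_types, lifting) map_prod_compose comp_apply map_prod.id id_apply sk_sk(2))

text \<open>Otherwise the inverse of \<omega> would be increasing, and the identity is the only
  increasing permutation.\<close>

lemma exists_descent:
  assumes "\<omega> permutes {1..n}" "\<omega> \<noteq> id"
  obtains p r where "p \<in> {1..n}" "r \<in> {1..n}" "r < p" "\<omega> r = Suc (\<omega> p)"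
proof (rule ccontr)
  note that' = that
  assume "\<not> thesis"
  then have no: "\<not> (r < p \<and> \<omega> r = Suc (\<omega> p))" if "p \<in> {1..n}" "r \<in> {1..n}" for p r
    using that' that by blast
  define v where "v = inv \<omega>"
  have v: "v permutes {1..n}" unfolding v_def by (rule permutes_inv[OF assms(1)])
  have wv: "\<omega> (v j) = j" for j unfolding v_def by (rule permutes_inverses(1)[OF assms(1)])
  have mono: "v j < v (Suc j)" if "j \<in> {1..<n}" for j
  proof -
    have "v j \<in> {1..n}" "v (Suc j) \<in> {1..n}" using permutes_in_image[OF v] that by auto
    moreover have "v j \<noteq> v (Suc j)" by (metis wv n_not_Suc_n)
    ultimately show ?thesis using no[of "v j" "v (Suc j)"] by (simp add: wv)
  qed
  have "j \<le> v j" if "j \<in> {1..n}" for j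
    using that
  proof (induction j)
    case (Suc j)
    then show ?case
    proof (cases "j = 0")
      case True
      then show ?thesis using permutes_in_image[OF v, of 1] Suc.prems by simp
    next
      case False
      then have "j \<le> v j" "v j < v (Suc j)" using Suc mono by auto
      then show ?thesis by simp
    qed
  qed simp
  then have "v = id" using permutes_natset_ge[OF v] by blast
  then show False using assms(2) wv by (auto simp: fun_eq_iff)
qed

text \<open>The induction is on the number of inversions. Every step creates an inversion, which
  matches the condition p < r of \<open>adjacent_values\<close>.\<close>

lemma permutes_adjacent_induct [consumes 1, case_names id swap]:
  assumes "\<omega> permutes {1..n}" and "P id"
    and swap: "\<And>\<omega> p r. \<omega> permutes {1..n} \<Longrightarrow> P \<omega> \<Longrightarrow> p \<in> {1..n} \<Longrightarrow> r \<in> {1..n} \<Longrightarrow> p < r \<Longrightarrow>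
      \<omega> r = Suc (\<omega> p) \<Longrightarrow> P (sk (\<omega> p) \<circ> \<omega>)"
  shows "P \<omega>"
  using assms(1)
proof (induction "card (inversions n \<omega>)" arbitrary: \<omega> rule: less_induct)
  case less
  show ?case
  proof (cases "\<omega> = id")
    case False
    obtain p r where pr: "p \<in> {1..n}" "r \<in> {1..n}" "r < p" "\<omega> r = Suc (\<omega> p)"
      using exists_descent[OF less.prems False] by blast
    define v where "v = sk (\<omega> p) \<circ> \<omega>"
    have w: "\<omega> p \<in> {1..n}" "Suc (\<omega> p) \<in> {1..n}" using permutes_in_image[OF less.prems] pr by metis+
    have v: "v permutes {1..n}"
      unfolding v_def using w by (intro permutes_compose[OF less.prems] sk_permutes) auto
    have vv: "v r = \<omega> p" "v p = Suc (v r)" using pr(4) by (simp_all add: v_def sk_simps)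
    have \<omega>: "\<omega> = sk (v r) \<circ> v" unfolding vv(1) by (simp add: v_def sk_sk fun_eq_iff)
    have "card (inversions n v) < card (inversions n \<omega>)"
      using inversions_left[OF v pr(2,1,3) vv(2)] \<omega> by simp
    then have "P v" using less.hyps v by blast
    then show ?thesis using swap[OF v _ pr(2,1,3) vv(2)] \<omega> by simp
  qed (use assms(2) in simp)
qed

section \<open>Coxeter length as the number of inversions\<close>

lemma foldr_Cons_apply: "foldr f (x # xs) a = f x (foldr f xs a)"
  by simp

lemma word_permutes:
  "set ks \<subseteq> {1..<n} \<Longrightarrow> foldr (\<lambda>k \<pi>. sk k \<circ> \<pi>) ks id permutes {1..n}"
  by (induction ks) (auto simp: permutes_id simp del: One_nat_def intro!: permutes_compose sk_permutes)

text \<open>One more letter exchanges two consecutive values and so creates at most one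
  inversion.\<close>

lemma card_inversions_word:
  "set ks \<subseteq> {1..<n} \<Longrightarrow> card (inversions n (foldr (\<lambda>k \<pi>. sk k \<circ> \<pi>) ks id)) \<le> length ks"
proof (induction ks)
  case (Cons j ks)
  define \<pi> where "\<pi> = foldr (\<lambda>k \<pi>. sk k \<circ> \<pi>) ks id"
  have \<pi>: "\<pi> permutes {1..n}" unfolding \<pi>_def using Cons.prems by (intro word_permutes) auto
  obtain p r where pr: "\<pi> p = j" "\<pi> r = Suc j" using permutes_surj[OF \<pi>] by (metis surjD)
  have j: "j \<in> {1..n}" "Suc j \<in> {1..n}" using Cons.prems by auto
  then have mem: "p \<in> {1..n}" "r \<in> {1..n}" using permutes_in_image[OF \<pi>] pr by metis+
  have "card (inversions n (sk j \<circ> \<pi>)) \<le> Suc (card (inversions n \<pi>))"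
  proof (cases "p < r")
    case True
    then show ?thesis using inversions_left[OF \<pi> mem True] pr by simp
  next
    case False
    then have "r < p" using pr by (metis linorder_neqE_nat n_not_Suc_n)
    define v where "v = sk j \<circ> \<pi>"
    have v: "v permutes {1..n}"
      unfolding v_def using j by (intro permutes_compose[OF \<pi>] sk_permutes) auto
    have vv: "v r = j" "v p = Suc (v r)" using pr by (simp_all add: v_def sk_simps)
    have "\<pi> = sk (v r) \<circ> v" unfolding vv(1) by (simp add: v_def sk_sk fun_eq_iff)
    then have "inversions n \<pi> = insert (r, p) (inversions n v)"
      using inversions_left(1)[OF v mem(2,1) \<open>r < p\<close> vv(2)] by simp
    then have "card (inversions n v) \<le> card (inversions n \<pi>)"
      by (intro card_mono) auto
    then show ?thesis by (simp add: v_def)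
  qed
  moreover have "card (inversions n \<pi>) \<le> length ks"
    unfolding \<pi>_def by (rule Cons.IH) (use Cons.prems in auto)
  ultimately show ?case
    unfolding foldr_Cons_apply \<pi>_def[symmetric] length_Cons by linarith
qed (simp add: inversions_id)

text \<open>Each exchange of values in the induction contributes one letter and exactly one
  inversion, so the word obtained is reduced.\<close>

lemma exists_word:
  assumes "\<omega> permutes {1..n}"
  shows "\<exists>ks. length ks = card (inversions n \<omega>) \<and> set ks \<subseteq> {1..<n} \<and> \<omega> = foldr (\<lambda>k \<pi>. sk k \<circ> \<pi>) ks id"
  using assms
proof (induction rule: permutes_adjacent_induct)
  case id
  show ?case using inversions_id[of n] by (intro exI[of _ "[]"]) (simp add: id_def)
next
  case (swap \<omega> p r)
  then obtain ks where ks: "length ks = card (inversions n \<omega>)" "set ks \<subseteq> {1..<n}"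
      "\<omega> = foldr (\<lambda>k \<pi>. sk k \<circ> \<pi>) ks id" by blast
  have "\<omega> p \<in> {1..n}" "Suc (\<omega> p) \<in> {1..n}" using permutes_in_image[OF swap.hyps(1)] swap.hyps by metis+
  then have "set (\<omega> p # ks) \<subseteq> {1..<n}" using ks(2) by auto
  moreover have "length (\<omega> p # ks) = card (inversions n (sk (\<omega> p) \<circ> \<omega>))"
    unfolding inversions_left(1)[OF swap.hyps] using ks(1) inversions_left(2)[OF swap.hyps] by simp
  moreover have "sk (\<omega> p) \<circ> \<omega> = foldr (\<lambda>k \<pi>. sk k \<circ> \<pi>) (\<omega> p # ks) id"
    unfolding foldr_Cons_apply ks(3)[symmetric] by (rule refl)
  ultimately show ?case by blast
qed

lemma perm_length_eq:
  assumes "\<omega> permutes {1..n}"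
  shows "perm_length n \<omega> = card (inversions n \<omega>)"
  unfolding perm_length_def
proof (rule Least_equality)
  show "\<exists>ks. length ks = card (inversions n \<omega>) \<and> set ks \<subseteq> {1..<n} \<and> \<omega> = foldr (\<lambda>k \<pi>. sk k \<circ> \<pi>) ks id"
    by (rule exists_word[OF assms])
qed (use card_inversions_word in blast)

lemma perm_length_swap:
  assumes "\<omega> permutes {1..n}" "1 \<le> k" "k < n" "\<omega> k < \<omega> (Suc k)"
  shows "perm_length n (\<omega> \<circ> sk k) = Suc (perm_length n \<omega>)"
proof -
  have wk: "\<omega> \<circ> sk k permutes {1..n}"
    by (rule permutes_compose[OF sk_permutes[OF assms(2,3)] assms(1)])
  show ?thesis
    using inversions_right[of k n \<omega>, OF assms(2-4)] card_image[OF inj_map_prod_sk, of k "inversions n \<omega>"]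
    unfolding perm_length_eq[OF wk] perm_length_eq[OF assms(1)] by simp
qed

lemma generic_permute:
  assumes "generic q n z \<mu> h" "\<sigma> permutes {1..n}"
  shows "generic q n (z \<circ> \<sigma>) \<mu> h" "generic q n z (\<mu> \<circ> \<sigma>) h"
proof -
  have s: "\<sigma> i \<in> {1..n}" if "i \<in> {1..n}" for i using permutes_in_image[OF assms(2)] that by blast
  have "\<sigma> i \<noteq> \<sigma> j" if "i \<noteq> j" for i j using permutes_inj[OF assms(2)] that by (auto dest: injD)
  then show "generic q n (z \<circ> \<sigma>) \<mu> h" "generic q n z (\<mu> \<circ> \<sigma>) h"
    using assms(1) s unfolding generic_def comp_def by metis+
qed

text \<open>In \<open>wsum_swap\<close> at the top level Y = z o \<omega>, and Y o \<tau> amounts to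
  exchanging two entries of z while \<gamma> = z o \<sigma> is held fixed. The denominator involves
  \<gamma> only and is common to all terms.\<close>

lemma weight_hat_swap:
  assumes "norm q < 1" "\<omega> permutes {1..n}" "\<sigma> permutes {1..n}" "generic q n z \<mu> h"
    "p \<in> {1..n}" "r \<in> {1..n}" "p < r" "\<omega> r = Suc (\<omega> p)"
  shows "weight_hat q n (sk (\<omega> p) \<circ> \<omega>) (z \<circ> \<sigma>) z \<mu> h =
    delta q (z (\<omega> r) / z (\<omega> p)) (\<mu> r / \<mu> p) * weight_hat q n \<omega> (z \<circ> \<sigma>) z \<mu> h +
    delta q (z (\<omega> p) / z (\<omega> r)) h * weight_hat q n \<omega> (z \<circ> \<sigma>) (z \<circ> sk (\<omega> p)) \<mu> h"
proof -
  interpret adjacent_values q h \<mu> "z \<circ> \<sigma>" n \<omega> p r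
    by unfold_locales (use assms generic_permute in auto)
  have v: "\<omega> p \<in> {1..n}" "\<omega> r \<in> {1..n}" using permutes_in_image[OF assms(2)] assms(5,6) by blast+
  have sw: "sk (\<omega> p) \<circ> \<omega> = \<omega> \<circ> \<tau>"
  proof
    fix i
    have "\<omega> i = \<omega> p \<longleftrightarrow> i = p" "\<omega> i = \<omega> r \<longleftrightarrow> i = r"
      using permutes_inj[OF assms(2)] by (auto dest: injD)
    then show "(sk (\<omega> p) \<circ> \<omega>) i = (\<omega> \<circ> \<tau>) i"
      by (cases "i = p"; cases "i = r") (auto simp: sk_simps \<tau>_simps assms(8))
  qed
  have perm': "sk (\<omega> p) \<circ> \<omega> permutes {1..n}"
    using v assms(8) by (intro permutes_compose[OF assms(2)] sk_permutes) auto
  have n: "n \<ge> 1" using assms(5) by auto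
  have nz: "z (\<omega> p) \<noteq> 0" "z (\<omega> r) \<noteq> 0" "theta q (z (\<omega> r) / z (\<omega> p)) \<noteq> 0"
    using assms(4,8) v unfolding generic_def by auto
  have "wsum q \<mu> h (\<omega> \<circ> \<tau>) (\<lambda>_. z \<circ> \<sigma>) n ((z \<circ> \<omega>) \<circ> \<tau>) =
    delta q (z (\<omega> r) / z (\<omega> p)) (\<mu> r / \<mu> p) * wsum q \<mu> h \<omega> (\<lambda>_. z \<circ> \<sigma>) n (z \<circ> \<omega>) +
    delta q (z (\<omega> p) / z (\<omega> r)) h * wsum q \<mu> h \<omega> (\<lambda>_. z \<circ> \<sigma>) n ((z \<circ> \<omega>) \<circ> \<tau>)"
    using wsum_swap[of n "z \<circ> \<omega>"] nz assms(6) by simp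
  moreover have "z \<circ> (\<omega> \<circ> \<tau>) = (z \<circ> \<omega>) \<circ> \<tau>" "(z \<circ> sk (\<omega> p)) \<circ> \<omega> = (z \<circ> \<omega>) \<circ> \<tau>"
    using sw by (simp_all add: comp_assoc)
  ultimately show ?thesis
    unfolding sw weight_hat_eq[OF assms(2) n] weight_hat_eq[OF perm'[unfolded sw] n]
    by (simp add: add_divide_distrib algebra_simps)
qed

section \<open>The identity permutation\<close>

text \<open>The inverse v of \<pi> moves some i to v i > i, and the factor at (i, v i) is theta(1) =
  0. From v i \<le> k+1 it follows that i \<le> k, so this pair does occur in the product.\<close>

lemma kernel_id_zero:
  assumes "\<pi> permutes {1..k + 1}" "\<pi> \<noteq> id" "\<And>i. i \<in> {1..k} \<Longrightarrow> \<gamma> i \<noteq> 0"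
  shows "kernel q \<mu> h id k (\<gamma> \<circ> \<pi>) \<gamma> = 0"
proof -
  define v where "v = inv \<pi>"
  have v: "v permutes {1..k + 1}" unfolding v_def by (rule permutes_inv[OF assms(1)])
  have \<pi>v: "\<pi> (v i) = i" for i unfolding v_def by (rule permutes_inverses(1)[OF assms(1)])
  have "v \<noteq> id"
  proof
    assume "v = id"
    then have "\<pi> i = i" for i using \<pi>v[of i] by simp
    then show False using assms(2) by auto
  qed
  then obtain i where i: "i \<in> {1..k + 1}" "i < v i"
    using permutes_natset_le[OF v] by (meson not_less)
  moreover have "v i \<in> {1..k + 1}" using permutes_in_image[OF v] i(1) by blast
  ultimately have i': "i \<in> {1..k}" "v i \<in> {1..k + 1}" by auto
  have "factor q \<mu> h id k i (v i) ((\<gamma> \<circ> \<pi>) (v i) / \<gamma> i) = 0"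
    using i(2) assms(3)[OF i'(1)] by (simp add: factor_def \<pi>v theta_1)
  moreover have "(i, v i) \<in> {1..k} \<times> {1..k + 1}" using i' by simp
  ultimately have "(\<Prod>(i, l)\<in>{1..k} \<times> {1..k + 1}. factor q \<mu> h id k i l ((\<gamma> \<circ> \<pi>) l / \<gamma> i)) = 0"
    by (intro prod_zero bexI[of _ "(i, v i)"]) auto
  then show ?thesis by (simp add: kernel_def)
qed

text \<open>The induction hypothesis leaves only the summand \<sigma> = id; its kernel vanishes
  unless \<pi> = id.\<close>

lemma wsum_id:
  assumes "\<pi> permutes {1..m}" "\<And>i. i \<in> {1..<m} \<Longrightarrow> \<gamma> i \<noteq> 0"
  shows "wsum q \<mu> h id (\<lambda>_. \<gamma>) m (\<gamma> \<circ> \<pi>) = (if \<pi> = id then \<Prod>k<m. kernel q \<mu> h id k \<gamma> \<gamma> else 0)"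
  using assms
proof (induction m arbitrary: \<pi>)
  case (Suc k)
  have "wsum q \<mu> h id (\<lambda>_. \<gamma>) (Suc k) (\<gamma> \<circ> \<pi>) =
     (\<Sum>\<sigma> | \<sigma> permutes {1..k}. kernel q \<mu> h id k (\<gamma> \<circ> \<pi>) (\<gamma> \<circ> \<sigma>) * wsum q \<mu> h id (\<lambda>_. \<gamma>) k (\<gamma> \<circ> \<sigma>))"
    by simp
  also have "\<dots> = (\<Sum>\<sigma> | \<sigma> permutes {1..k}. if \<sigma> = id
       then kernel q \<mu> h id k (\<gamma> \<circ> \<pi>) (\<gamma> \<circ> id) * (\<Prod>k<k. kernel q \<mu> h id k \<gamma> \<gamma>) else 0)"
  proof (intro sum.cong refl)
    fix \<sigma> assume "\<sigma> \<in> {\<sigma>. \<sigma> permutes {1..k}}"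
    then have IH: "wsum q \<mu> h id (\<lambda>_. \<gamma>) k (\<gamma> \<circ> \<sigma>) = (if \<sigma> = id then \<Prod>k<k. kernel q \<mu> h id k \<gamma> \<gamma> else 0)"
      using Suc.prems(2) by (intro Suc.IH) auto
    show "kernel q \<mu> h id k (\<gamma> \<circ> \<pi>) (\<gamma> \<circ> \<sigma>) * wsum q \<mu> h id (\<lambda>_. \<gamma>) k (\<gamma> \<circ> \<sigma>) = (if \<sigma> = id
       then kernel q \<mu> h id k (\<gamma> \<circ> \<pi>) (\<gamma> \<circ> id) * (\<Prod>k<k. kernel q \<mu> h id k \<gamma> \<gamma>) else 0)"
      unfolding IH by (cases "\<sigma> = id") simp_all
  qed
  also have "\<dots> = kernel q \<mu> h id k (\<gamma> \<circ> \<pi>) \<gamma> * (\<Prod>k<k. kernel q \<mu> h id k \<gamma> \<gamma>)"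
    using permutes_id[of "{1..k}"] by (subst sum.delta) (auto simp: finite_permutations)
  also have "\<dots> = (if \<pi> = id then \<Prod>k<Suc k. kernel q \<mu> h id k \<gamma> \<gamma> else 0)"
    using kernel_id_zero[of \<pi> k \<gamma> q \<mu> h] Suc.prems by auto
  finally show ?case .
next
  case 0
  then have "\<pi> = id" by simp
  then show ?case by simp
qed

text \<open>With c = theta'1 / theta(h), each pair i, l \<le> k contributes c * theta(h \<gamma>_l /
  \<gamma>_i), whatever the order of i and l: for i < l the delta cancels the theta. This produces
  the denominator of \<open>weight\<close> at level k, and the pairs with l = k+1 supply the
  remaining product.\<close>

lemma kernel_id:
  assumes "generic q n \<gamma> \<mu> h" "k < n"
  shows "kernel q \<mu> h id k \<gamma> \<gamma> = (theta'1 q / theta q h) ^ (k * k) *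
     (\<Prod>i\<in>{1..k}. \<Prod>l\<in>{1..k}. theta q (h * \<gamma> i / \<gamma> l)) * (\<Prod>i\<in>{1..k}. theta q (\<gamma> (k + 1) / \<gamma> i))"
proof -
  define c where "c = theta'1 q / theta q h"
  have g: "theta q h \<noteq> 0" "\<And>i. i \<in> {1..n} \<Longrightarrow> \<gamma> i \<noteq> 0"
    "\<And>i l. i \<in> {1..n} \<Longrightarrow> l \<in> {1..n} \<Longrightarrow> i \<noteq> l \<Longrightarrow> theta q (\<gamma> i / \<gamma> l) \<noteq> 0"
    "\<And>i l. i \<in> {1..n} \<Longrightarrow> l \<in> {1..n} \<Longrightarrow> i \<noteq> l \<Longrightarrow> theta q (h * \<mu> i / \<mu> l) \<noteq> 0"
    using assms(1) unfolding generic_def by auto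
  define f where "f i l = factor q \<mu> h id k i l (\<gamma> l / \<gamma> i)" for i l
  define d where "d i l = (if i < l then delta q (\<gamma> l / \<gamma> i) h else 1)" for i l :: nat
  have fd: "f i l * d i l = c * theta q (h * \<gamma> l / \<gamma> i)" if "i \<in> {1..k}" "l \<in> {1..k}" for i l
  proof -
    have il: "i \<in> {1..n}" "l \<in> {1..n}" "k + 1 \<in> {1..n}" "k + 1 \<noteq> i" using that assms(2) by auto
    consider "l < i" | "l = i" | "i < l" by linarith
    then show ?thesis
    proof cases
      case 1
      then show ?thesis by (simp add: f_def d_def factor_def theta_delta_def c_def mult_ac)
    next
      \<comment> \<open>At x = 1 the value of \<open>theta_delta\<close> is \<open>theta'1 q\<close>
        for every second argument at which theta is nonzero. This is where \<mu> disappears.\<close>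
      case 2
      then show ?thesis using g(1,2,4) il that(1)
        by (simp add: f_def d_def factor_def theta_delta_def c_def)
    next
      case 3
      then show ?thesis using g(3)[OF il(2,1)]
        by (simp add: f_def d_def factor_def delta_def c_def mult_ac)
    qed
  qed
  have e: "(\<Prod>(i, l) | i \<in> {1..k} \<and> l \<in> {1..k} \<and> id i < id l. delta q (\<gamma> l / \<gamma> i) h) = (\<Prod>(i, l)\<in>{1..k} \<times> {1..k}. d i l)"
    by (rule prod.mono_neutral_cong_left) (auto simp: d_def split: if_splits)
  have "kernel q \<mu> h id k \<gamma> \<gamma> = (\<Prod>i\<in>{1..k}. \<Prod>l\<in>{1..k + 1}. f i l) * (\<Prod>i\<in>{1..k}. \<Prod>l\<in>{1..k}. d i l)"
    unfolding kernel_def e f_def[symmetric] prod.cartesian_product[symmetric] by (rule refl)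
  also have "(\<Prod>i\<in>{1..k}. \<Prod>l\<in>{1..k + 1}. f i l) = (\<Prod>i\<in>{1..k}. \<Prod>l\<in>{1..k}. f i l) * (\<Prod>i\<in>{1..k}. f i (k + 1))"
    by (simp add: prod.distrib)
  also have "(\<Prod>i\<in>{1..k}. f i (k + 1)) = (\<Prod>i\<in>{1..k}. theta q (\<gamma> (k + 1) / \<gamma> i))"
    by (rule prod.cong) (auto simp: f_def factor_def)
  also have "(\<Prod>i\<in>{1..k}. \<Prod>l\<in>{1..k}. f i l) * (\<Prod>i\<in>{1..k}. theta q (\<gamma> (k + 1) / \<gamma> i)) * (\<Prod>i\<in>{1..k}. \<Prod>l\<in>{1..k}. d i l) =
     (\<Prod>i\<in>{1..k}. \<Prod>l\<in>{1..k}. f i l * d i l) * (\<Prod>i\<in>{1..k}. theta q (\<gamma> (k + 1) / \<gamma> i))"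
    by (simp add: prod.distrib)
  also have "(\<Prod>i\<in>{1..k}. \<Prod>l\<in>{1..k}. f i l * d i l) = (\<Prod>i\<in>{1..k}. \<Prod>l\<in>{1..k}. c * theta q (h * \<gamma> l / \<gamma> i))"
    by (intro prod.cong refl fd)
  also have "\<dots> = c ^ (k * k) * (\<Prod>i\<in>{1..k}. \<Prod>l\<in>{1..k}. theta q (h * \<gamma> i / \<gamma> l))"
    by (simp add: prod.distrib power_mult) (rule disjI2, rule prod.swap)
  finally show ?thesis unfolding c_def .
qed

definition theta_vandermonde :: "complex \<Rightarrow> nat \<Rightarrow> (nat \<Rightarrow> complex) \<Rightarrow> complex" where
  "theta_vandermonde q n \<gamma> = (\<Prod>(i, l) | i \<in> {1..n} \<and> l \<in> {1..n} \<and> i < l. theta q (\<gamma> l / \<gamma> i))"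

text \<open>The transposition permutes the pairs i < l other than (k, k+1), and that pair
  contributes the sign because theta is odd.\<close>

lemma theta_vandermonde_swap:
  assumes "1 \<le> k" "k < n"
  shows "theta_vandermonde q n (\<gamma> \<circ> sk k) = - theta_vandermonde q n \<gamma>"
proof -
  define A where "A = {(i, l). i \<in> {1..n} \<and> l \<in> {1..n} \<and> i < l} - {(k, Suc k)}"
  have fin: "finite {(i, l). i \<in> {1..n} \<and> l \<in> {1..n} \<and> i < l}"
    by (rule finite_subset[of _ "{1..n} \<times> {1..n}"]) auto
  have split: "theta_vandermonde q n \<gamma> = theta q (\<gamma> (Suc k) / \<gamma> k) * (\<Prod>(i, l)\<in>A. theta q (\<gamma> l / \<gamma> i))" for \<gamma>
    unfolding theta_vandermonde_def A_def using assms by (subst prod.remove[OF fin, of "(k, Suc k)"]) auto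
  have mem: "(sk k i, sk k l) \<in> A" if "(i, l) \<in> A" for i l
  proof -
    have "\<not> (i \<in> {k, Suc k} \<and> l \<in> {k, Suc k})" using that by (auto simp: A_def)
    then have "sk k i < sk k l" using sk_less that unfolding A_def by auto
    moreover have "sk k i \<in> {1..n}" "sk k l \<in> {1..n}"
      using permutes_in_image[OF sk_permutes[OF assms]] that unfolding A_def by blast+
    moreover have "(sk k i, sk k l) \<noteq> (k, Suc k)"
      using sk_sk(1)[of k i] sk_sk(1)[of k l] that by (auto simp: A_def sk_simps)
    ultimately show ?thesis by (auto simp: A_def)
  qed
  have "(\<Prod>(i, l)\<in>A. theta q ((\<gamma> \<circ> sk k) l / (\<gamma> \<circ> sk k) i)) = (\<Prod>(i, l)\<in>A. theta q (\<gamma> l / \<gamma> i))"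
    by (rule prod.reindex_bij_witness[of _ "map_prod (sk k) (sk k)" "map_prod (sk k) (sk k)"])
      (auto simp: sk_sk mem)
  then show ?thesis
    unfolding split using theta_swap[of q "\<gamma> k" "\<gamma> (Suc k)"] by (simp add: sk_simps)
qed

text \<open>C is chosen before \<gamma> and \<mu>. So the restriction does not change with \<mu>,
  and its dependence on \<gamma> is an antisymmetric product.\<close>

lemma weight_hat_id_self:
  assumes "n \<ge> 1"
  obtains C where "\<And>\<gamma> \<mu>. generic q n \<gamma> \<mu> h \<Longrightarrow> weight_hat q n id \<gamma> \<gamma> \<mu> h = C * theta_vandermonde q n \<gamma>"
proof
  fix \<gamma> \<mu>
  assume g: "generic q n \<gamma> \<mu> h"
  define D where "D k = (\<Prod>i\<in>{1..k}. \<Prod>l\<in>{1..k}. theta q (h * \<gamma> i / \<gamma> l))" for k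
  have D: "D k \<noteq> 0" if "k < n" for k
  proof -
    have "theta q (h * \<gamma> i / \<gamma> l) \<noteq> 0" if "i \<in> {1..n}" "l \<in> {1..n}" for i l
      using g that unfolding generic_def by (cases "i = l") auto
    then show ?thesis using that by (auto simp: D_def)
  qed
  have nz: "\<gamma> i \<noteq> 0" if "i \<in> {1..<n}" for i using g that unfolding generic_def by auto
  have "wsum q \<mu> h id (\<lambda>_. \<gamma>) n \<gamma> = (\<Prod>k<n. kernel q \<mu> h id k \<gamma> \<gamma>)"
    using wsum_id[of id n \<gamma> q \<mu> h, OF permutes_id nz] by simp
  also have "\<dots> = (\<Prod>k\<in>{1..<n}. kernel q \<mu> h id k \<gamma> \<gamma>)"
    by (rule prod.mono_neutral_right) (auto simp: kernel_def not_less_eq_eq intro!: prod.neutral)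
  also have "\<dots> = (\<Prod>k\<in>{1..<n}. (theta'1 q / theta q h) ^ (k * k) * D k * (\<Prod>i\<in>{1..k}. theta q (\<gamma> (k + 1) / \<gamma> i)))"
    unfolding D_def by (rule prod.cong[OF refl], rule kernel_id[OF g]) auto
  also have "\<dots> = (\<Prod>k\<in>{1..<n}. (theta'1 q / theta q h) ^ (k * k)) * (\<Prod>k\<in>{1..<n}. D k) *
      (\<Prod>k\<in>{1..<n}. \<Prod>i\<in>{1..k}. theta q (\<gamma> (k + 1) / \<gamma> i))"
    by (simp add: prod.distrib)
  also have "(\<Prod>k\<in>{1..<n}. \<Prod>i\<in>{1..k}. theta q (\<gamma> (k + 1) / \<gamma> i)) =
      (\<Prod>(k, i)\<in>(SIGMA k:{1..<n}. {1..k}). theta q (\<gamma> (k + 1) / \<gamma> i))"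
    by (rule prod.Sigma) auto
  also have "\<dots> = theta_vandermonde q n \<gamma>"
    unfolding theta_vandermonde_def
    by (rule prod.reindex_bij_witness[of _ "\<lambda>(i, l). (l - 1, i)" "\<lambda>(k, i). (i, k + 1)"]) auto
  finally have ws: "wsum q \<mu> h id (\<lambda>_. \<gamma>) n \<gamma> =
     (\<Prod>k\<in>{1..<n}. (theta'1 q / theta q h) ^ (k * k)) * (\<Prod>k\<in>{1..<n}. D k) * theta_vandermonde q n \<gamma>" .
  show "weight_hat q n id \<gamma> \<gamma> \<mu> h = (theta q h / theta'1 q) ^ ((n - 1) * n * (2 * n - 1) div 6) *
      (\<Prod>k\<in>{1..<n}. (theta'1 q / theta q h) ^ (k * k)) * theta_vandermonde q n \<gamma>"
    unfolding weight_hat_eq[OF permutes_id assms] comp_id ws D_def[symmetric] using D by simp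
qed

text \<open>Relative to \<gamma> = z o \<sigma>, the top variables are \<gamma> o inv \<sigma>, so
  \<open>wsum_id\<close> applies to the nontrivial permutation inv \<sigma>.\<close>

lemma weight_hat_id_other:
  assumes "\<sigma> permutes {1..n}" "n \<ge> 1" "\<sigma> \<noteq> id" "generic q n z \<mu> h"
  shows "weight_hat q n id (z \<circ> \<sigma>) z \<mu> h = 0"
proof -
  have inv: "inv \<sigma> permutes {1..n}" by (rule permutes_inv[OF assms(1)])
  have z: "z = (z \<circ> \<sigma>) \<circ> inv \<sigma>" using permutes_inv_o(1)[OF assms(1)] by (simp add: comp_assoc)
  have "inv \<sigma> \<noteq> id" using assms(3) inv_inv_eq[OF permutes_bij[OF assms(1)]] by (metis inv_id)
  moreover have "(z \<circ> \<sigma>) i \<noteq> 0" if "i \<in> {1..<n}" for i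
    using generic_permute(1)[OF assms(4,1)] that unfolding generic_def by auto
  ultimately have "wsum q \<mu> h id (\<lambda>_. z \<circ> \<sigma>) n ((z \<circ> \<sigma>) \<circ> inv \<sigma>) = 0"
    using wsum_id[OF inv, of "z \<circ> \<sigma>" q \<mu> h] by simp
  then show ?thesis
    unfolding weight_hat_eq[OF permutes_id assms(2)] z[symmetric] by simp
qed

section \<open>The recursion\<close>

lemma weight_hat_norm_eq:
  "weight_hat_norm q n \<omega> \<gamma> z \<mu> h = weight_hat q n \<omega> \<gamma> z \<mu> h / (\<Prod>(i, j)\<in>inversions n \<omega>. delta q (\<mu> i / \<mu> j) h)"
  unfolding weight_hat_norm_def inversions_def by simp

lemma weight_hat_norm_swap_values:
  assumes "norm q < 1" "\<omega> permutes {1..n}" "\<sigma> permutes {1..n}" "generic q n z \<mu> h"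
    "p \<in> {1..n}" "r \<in> {1..n}" "p < r" "\<omega> r = Suc (\<omega> p)"
  shows "weight_hat_norm q n (sk (\<omega> p) \<circ> \<omega>) (z \<circ> \<sigma>) z \<mu> h =
    (delta q (z (\<omega> r) / z (\<omega> p)) (\<mu> r / \<mu> p) * weight_hat_norm q n \<omega> (z \<circ> \<sigma>) z \<mu> h +
     delta q (z (\<omega> p) / z (\<omega> r)) h * weight_hat_norm q n \<omega> (z \<circ> \<sigma>) (z \<circ> sk (\<omega> p)) \<mu> h) / delta q (\<mu> p / \<mu> r) h"
  unfolding weight_hat_norm_eq weight_hat_swap[OF assms] inversions_left(1)[OF assms(2,5-8)]
  using inversions_left(2)[OF assms(2,5-8)] by (simp add: add_divide_distrib mult_ac)

text \<open>The normalized recursion, restricted to fixed points. It quantifies over all parameters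
  because the inductive steps use it at \<sigma> o s_k, at permuted \<mu> and at permuted z.\<close>

definition position_recursion :: "complex \<Rightarrow> nat \<Rightarrow> nat \<Rightarrow> (nat \<Rightarrow> nat) \<Rightarrow> bool" where
  "position_recursion q n k \<omega> \<longleftrightarrow> (\<forall>\<sigma> z \<mu> h. \<sigma> permutes {1..n} \<longrightarrow> generic q n z \<mu> h \<longrightarrow>
     weight_hat_norm q n (\<omega> \<circ> sk k) (z \<circ> \<sigma>) z \<mu> h =
       (weight_hat_norm q n \<omega> (z \<circ> \<sigma>) z (\<mu> \<circ> sk k) h * delta q (z (\<sigma> (Suc k)) / z (\<sigma> k)) (\<mu> (Suc k) / \<mu> k) -
        weight_hat_norm q n \<omega> (z \<circ> (\<sigma> \<circ> sk k)) z (\<mu> \<circ> sk k) h * delta q (z (\<sigma> (Suc k)) / z (\<sigma> k)) h) /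
       delta q (\<mu> k / \<mu> (Suc k)) h)"

text \<open>For the identity, exchanging the values k, k+1 is the same as exchanging the positions
  k, k+1. The relation for values therefore gives the left side, and its two terms agree one by one
  with those of the recursion.\<close>

lemma position_recursion_id:
  assumes q: "norm q < 1" and k: "1 \<le> k" "k < n"
  shows "position_recursion q n k id"
  unfolding position_recursion_def
proof (intro allI impI)
  fix \<sigma> z \<mu> h
  assume \<sigma>: "\<sigma> permutes {1..n}" and g: "generic q n z \<mu> h"
  have n: "n \<ge> 1" using k by simp
  have sk: "sk k permutes {1..n}" by (rule sk_permutes[OF k])
  note g_mu = generic_permute(2)[OF g sk] and g_z = generic_permute(1)[OF g sk]
  obtain C where C: "\<And>\<gamma> \<mu>. generic q n \<gamma> \<mu> h \<Longrightarrow> weight_hat q n id \<gamma> \<gamma> \<mu> h = C * theta_vandermonde q n \<gamma>"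
    using weight_hat_id_self[OF n] by blast
  have norm_id: "weight_hat_norm q n id \<gamma> z \<mu> h = weight_hat q n id \<gamma> z \<mu> h" for \<gamma> z \<mu>
    by (simp add: weight_hat_norm_eq inversions_id)
  have sk\<sigma>: "sk k \<circ> \<sigma> permutes {1..n}" "\<sigma> \<circ> sk k permutes {1..n}"
    using permutes_compose \<sigma> sk by blast+
  \<comment> \<open>At \<sigma> = id the two coefficients coincide and the weight does not depend on
    \<mu>; at every other \<sigma> both sides are zero.\<close>
  have 1: "weight_hat q n id (z \<circ> \<sigma>) z \<mu> h * delta q (z (Suc k) / z k) (\<mu> (Suc k) / \<mu> k) =
     weight_hat q n id (z \<circ> \<sigma>) z (\<mu> \<circ> sk k) h * delta q (z (\<sigma> (Suc k)) / z (\<sigma> k)) (\<mu> (Suc k) / \<mu> k)"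
  proof (cases "\<sigma> = id")
    case True
    then show ?thesis using C[OF g] C[OF g_mu] by simp
  next
    case False
    then show ?thesis
      using weight_hat_id_other[OF \<sigma> n False g] weight_hat_id_other[OF \<sigma> n False g_mu] by simp
  qed
  \<comment> \<open>Only \<sigma> = s_k contributes. There the two weights are restrictions to the
    identity, for z o s_k and for z, and antisymmetry supplies the sign.\<close>
  have 2: "weight_hat q n id (z \<circ> \<sigma>) (z \<circ> sk k) \<mu> h * delta q (z k / z (Suc k)) h =
     - (weight_hat q n id (z \<circ> (\<sigma> \<circ> sk k)) z (\<mu> \<circ> sk k) h * delta q (z (\<sigma> (Suc k)) / z (\<sigma> k)) h)"
  proof (cases "\<sigma> = sk k")
    case True
    have z: "z \<circ> (sk k \<circ> sk k) = z" unfolding sk_sk(2) by simp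
    show ?thesis
      unfolding True z C[OF g_z] C[OF g_mu] theta_vandermonde_swap[OF k] by (simp add: sk_simps)
  next
    case False
    have ne: "sk k \<circ> \<sigma> \<noteq> id" "\<sigma> \<circ> sk k \<noteq> id"
      using False sk_sk(1) by (metis comp_apply ext id_apply)+
    have "z \<circ> \<sigma> = (z \<circ> sk k) \<circ> (sk k \<circ> \<sigma>)" by (simp add: fun_eq_iff sk_sk)
    then have "weight_hat q n id (z \<circ> \<sigma>) (z \<circ> sk k) \<mu> h = 0"
      using weight_hat_id_other[OF sk\<sigma>(1) n ne(1) g_z] by simp
    then show ?thesis using weight_hat_id_other[OF sk\<sigma>(2) n ne(2) g_mu] by simp
  qed
  have kn: "k \<in> {1..n}" "Suc k \<in> {1..n}" using k by auto
  have "weight_hat_norm q n (sk k) (z \<circ> \<sigma>) z \<mu> h =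
    (delta q (z (Suc k) / z k) (\<mu> (Suc k) / \<mu> k) * weight_hat q n id (z \<circ> \<sigma>) z \<mu> h +
     delta q (z k / z (Suc k)) h * weight_hat q n id (z \<circ> \<sigma>) (z \<circ> sk k) \<mu> h) / delta q (\<mu> k / \<mu> (Suc k)) h"
    using weight_hat_norm_swap_values[OF q permutes_id \<sigma> g kn] unfolding norm_id by simp
  also have "delta q (z (Suc k) / z k) (\<mu> (Suc k) / \<mu> k) * weight_hat q n id (z \<circ> \<sigma>) z \<mu> h +
     delta q (z k / z (Suc k)) h * weight_hat q n id (z \<circ> \<sigma>) (z \<circ> sk k) \<mu> h =
     weight_hat q n id (z \<circ> \<sigma>) z (\<mu> \<circ> sk k) h * delta q (z (\<sigma> (Suc k)) / z (\<sigma> k)) (\<mu> (Suc k) / \<mu> k) -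
     weight_hat q n id (z \<circ> (\<sigma> \<circ> sk k)) z (\<mu> \<circ> sk k) h * delta q (z (\<sigma> (Suc k)) / z (\<sigma> k)) h"
    using 1 2 by (simp add: mult.commute)
  finally show "weight_hat_norm q n (id \<circ> sk k) (z \<circ> \<sigma>) z \<mu> h =
      (weight_hat_norm q n id (z \<circ> \<sigma>) z (\<mu> \<circ> sk k) h * delta q (z (\<sigma> (Suc k)) / z (\<sigma> k)) (\<mu> (Suc k) / \<mu> k) -
       weight_hat_norm q n id (z \<circ> (\<sigma> \<circ> sk k)) z (\<mu> \<circ> sk k) h * delta q (z (\<sigma> (Suc k)) / z (\<sigma> k)) h) /
      delta q (\<mu> k / \<mu> (Suc k)) h"
    unfolding norm_id id_comp .
qed

text \<open>By the three-term relation, the recursion is an involution.\<close>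

lemma position_recursion_swap:
  assumes q: "norm q < 1" and "theta'1 q \<noteq> 0" and k: "1 \<le> k" "k < n" and rec: "position_recursion q n k \<omega>"
  shows "position_recursion q n k (\<omega> \<circ> sk k)"
  unfolding position_recursion_def
proof (intro allI impI)
  fix \<sigma> z \<mu> h
  assume \<sigma>: "\<sigma> permutes {1..n}" and g: "generic q n z \<mu> h"
  have sk: "sk k permutes {1..n}" by (rule sk_permutes[OF k])
  have \<sigma>': "\<sigma> \<circ> sk k permutes {1..n}" by (rule permutes_compose[OF sk \<sigma>])
  note g_mu = generic_permute(2)[OF g sk]
  have kn: "k \<in> {1..n}" "Suc k \<in> {1..n}" "k \<noteq> Suc k" using k by auto
  define x where "x = z (\<sigma> (Suc k)) / z (\<sigma> k)"
  define m where "m = \<mu> (Suc k) / \<mu> k"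
  have inv: "z (\<sigma> k) / z (\<sigma> (Suc k)) = 1 / x" "\<mu> k / \<mu> (Suc k) = 1 / m" by (simp_all add: x_def m_def)
  have "\<sigma> k \<in> {1..n}" "\<sigma> (Suc k) \<in> {1..n}" using permutes_in_image[OF \<sigma>] kn(1,2) by (simp_all only:)
  moreover have "\<sigma> (Suc k) \<noteq> \<sigma> k" using permutes_inj[OF \<sigma>] by (simp add: inj_eq)
  ultimately have "x \<noteq> 0" "theta q x \<noteq> 0"
    unfolding x_def using genericD(3,5)[OF g] by auto
  moreover have "m \<noteq> 0" "theta q m \<noteq> 0" "theta q (m * h) \<noteq> 0"
    unfolding m_def using genericD(4,6)[OF g] genericD(7)[OF g kn(2,1)] kn by (auto simp: mult.commute)
  moreover have "theta q (1 / m) \<noteq> 0" "theta q (1 / m * h) \<noteq> 0"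
    unfolding inv(2)[symmetric] using genericD(6)[OF g kn(1,2)] genericD(7)[OF g kn(1,2)] kn by (auto simp: mult.commute)
  ultimately have nz: "x \<noteq> 0" "m \<noteq> 0" "h \<noteq> 0" "theta q x \<noteq> 0" "theta q m \<noteq> 0" "theta q h \<noteq> 0"
      "theta q (1 / m) \<noteq> 0" "theta q (m * h) \<noteq> 0" "theta q (1 / m * h) \<noteq> 0"
    using genericD(1,2)[OF g] by auto
  have d: "delta q m h \<noteq> 0" "delta q (1 / m) h \<noteq> 0"
    using nz assms(2) by (simp_all add: delta_def)
  define w where "w = weight_hat_norm q n \<omega> (z \<circ> \<sigma>) z \<mu> h"
  define w' where "w' = weight_hat_norm q n \<omega> (z \<circ> (\<sigma> \<circ> sk k)) z \<mu> h"
  have 1: "weight_hat_norm q n (\<omega> \<circ> sk k) (z \<circ> \<sigma>) z (\<mu> \<circ> sk k) h =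
      (w * delta q x (1 / m) - w' * delta q x h) / delta q m h"
    using rec[unfolded position_recursion_def, rule_format, OF \<sigma> g_mu]
    by (simp add: sk_simps sk_sk(3) inv w_def w'_def x_def[symmetric] m_def[symmetric])
  have 2: "weight_hat_norm q n (\<omega> \<circ> sk k) (z \<circ> (\<sigma> \<circ> sk k)) z (\<mu> \<circ> sk k) h =
      (w' * delta q (1 / x) (1 / m) - w * delta q (1 / x) h) / delta q m h"
    using rec[unfolded position_recursion_def, rule_format, OF \<sigma>' g_mu]
    by (simp add: sk_simps sk_sk(3) inv w_def w'_def x_def[symmetric] m_def[symmetric])
  \<comment> \<open>After applying the recursion twice, the terms with w' cancel because delta(1/x,
    1/m) = -delta(x, m). The coefficient of w is evaluated by the three-term relation.\<close>
  have "w * (delta q x (1 / m) * delta q x m + delta q x h * delta q (1 / x) h) = w * (delta q m h * delta q (1 / m) h)"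
    using delta_three_term[OF q nz(1-6)] by simp
  then have "w * (delta q m h * delta q (1 / m) h) =
     (w * delta q x (1 / m) - w' * delta q x h) * delta q x m -
     (w' * delta q (1 / x) (1 / m) - w * delta q (1 / x) h) * delta q x h"
    unfolding delta_inverse_inverse by (simp add: algebra_simps)
  then have "w = ((w * delta q x (1 / m) - w' * delta q x h) / delta q m h * delta q x m -
     (w' * delta q (1 / x) (1 / m) - w * delta q (1 / x) h) / delta q m h * delta q x h) / delta q (1 / m) h"
    using d by (simp add: divide_simps mult_ac)
  then show "weight_hat_norm q n (\<omega> \<circ> sk k \<circ> sk k) (z \<circ> \<sigma>) z \<mu> h =
      (weight_hat_norm q n (\<omega> \<circ> sk k) (z \<circ> \<sigma>) z (\<mu> \<circ> sk k) h * delta q (z (\<sigma> (Suc k)) / z (\<sigma> k)) (\<mu> (Suc k) / \<mu> k) -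
       weight_hat_norm q n (\<omega> \<circ> sk k) (z \<circ> (\<sigma> \<circ> sk k)) z (\<mu> \<circ> sk k) h * delta q (z (\<sigma> (Suc k)) / z (\<sigma> k)) h) /
      delta q (\<mu> k / \<mu> (Suc k)) h"
    unfolding sk_sk(3) 1 2 x_def[symmetric] m_def[symmetric] inv w_def[symmetric] .
qed

text \<open>Exchanging adjacent values acts on \<open>z\<close> and has coefficients in \<open>z\<close>, exchanging adjacent positions
  acts on \<open>\<gamma>\<close> and has coefficients in \<open>\<gamma>\<close>; hence the two recursions commute.\<close>

lemma position_recursion_swap_values:
  assumes q: "norm q < 1" and k: "1 \<le> k" "k < n" and \<omega>: "\<omega> permutes {1..n}"
    and pr: "p \<in> {1..n}" "r \<in> {1..n}" "p < r" "\<omega> r = Suc (\<omega> p)" and "\<not> (p = k \<and> r = Suc k)"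
    and rec: "position_recursion q n k \<omega>"
  shows "position_recursion q n k (sk (\<omega> p) \<circ> \<omega>)"
  unfolding position_recursion_def
proof (intro allI impI)
  fix \<sigma> z \<mu> h
  assume \<sigma>: "\<sigma> permutes {1..n}" and g: "generic q n z \<mu> h"
  have sk: "sk k permutes {1..n}" by (rule sk_permutes[OF k])
  have \<sigma>': "\<sigma> \<circ> sk k permutes {1..n}" by (rule permutes_compose[OF sk \<sigma>])
  note g_mu = generic_permute(2)[OF g sk]
  define j where "j = \<omega> p"
  have "\<omega> p \<in> {1..n}" "\<omega> r \<in> {1..n}" using permutes_in_image[OF \<omega>] pr by blast+
  then have sj: "sk j permutes {1..n}" unfolding j_def using pr(4) by (intro sk_permutes) auto
  note g_z = generic_permute(1)[OF g sj]
  have \<omega>': "\<omega> \<circ> sk k permutes {1..n}" by (rule permutes_compose[OF sk \<omega>])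
  \<comment> \<open>In \<omega> o s_k the values j and j+1 stand at these positions.\<close>
  define p' r' where "p' = sk k p" and "r' = sk k r"
  have pr': "p' \<in> {1..n}" "r' \<in> {1..n}" using permutes_in_image[OF sk] pr unfolding p'_def r'_def by blast+
  \<comment> \<open>This fails exactly in the excluded case p = k, r = k+1; otherwise the exchange
    of values also applies to \<omega> o s_k.\<close>
  have "p' < r'"
    unfolding p'_def r'_def using pr(3) assms(9) by (subst sk_less) auto
  have v: "(\<omega> \<circ> sk k) p' = j" "(\<omega> \<circ> sk k) r' = Suc j" "\<omega> r = Suc j" "(\<mu> \<circ> sk k) p = \<mu> p'" "(\<mu> \<circ> sk k) r = \<mu> r'"
    using pr(4) by (simp_all add: p'_def r'_def sk_sk j_def)
  define a b where "a = delta q (z (Suc j) / z j) (\<mu> r' / \<mu> p')" and "b = delta q (z j / z (Suc j)) h"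
  define x where "x = z (\<sigma> (Suc k)) / z (\<sigma> k)"
  define m where "m = \<mu> (Suc k) / \<mu> k"
  have L: "weight_hat_norm q n (sk j \<circ> (\<omega> \<circ> sk k)) (z \<circ> \<sigma>) z \<mu> h =
    (a * weight_hat_norm q n (\<omega> \<circ> sk k) (z \<circ> \<sigma>) z \<mu> h +
     b * weight_hat_norm q n (\<omega> \<circ> sk k) (z \<circ> \<sigma>) (z \<circ> sk j) \<mu> h) / delta q (\<mu> p' / \<mu> r') h"
    using weight_hat_norm_swap_values[OF q \<omega>' \<sigma> g pr' \<open>p' < r'\<close>] unfolding v a_def b_def by simp
  have R: "weight_hat_norm q n (sk j \<circ> \<omega>) (z \<circ> \<pi>) z (\<mu> \<circ> sk k) h =
    (a * weight_hat_norm q n \<omega> (z \<circ> \<pi>) z (\<mu> \<circ> sk k) h +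
     b * weight_hat_norm q n \<omega> (z \<circ> \<pi>) (z \<circ> sk j) (\<mu> \<circ> sk k) h) / delta q (\<mu> p' / \<mu> r') h"
    if "\<pi> permutes {1..n}" for \<pi>
    using weight_hat_norm_swap_values[OF q \<omega> that g_mu pr] unfolding j_def[symmetric] v a_def b_def .
  \<comment> \<open>Exchanging entries of z while \<gamma> = z o \<sigma> stays fixed means passing
    to the fixed point s_j o \<sigma>. The coefficients of R depend on \<gamma> and hence do not
    change.\<close>
  have zz: "(z \<circ> sk j) \<circ> (sk j \<circ> \<pi>) = z \<circ> \<pi>" "(z \<circ> sk j) ((sk j \<circ> \<pi>) i) = z (\<pi> i)" for \<pi> :: "nat \<Rightarrow> nat" and i
    by (simp_all add: fun_eq_iff sk_sk)
  have 1: "weight_hat_norm q n (\<omega> \<circ> sk k) (z \<circ> \<sigma>) z \<mu> h =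
    (weight_hat_norm q n \<omega> (z \<circ> \<sigma>) z (\<mu> \<circ> sk k) h * delta q x m -
     weight_hat_norm q n \<omega> (z \<circ> (\<sigma> \<circ> sk k)) z (\<mu> \<circ> sk k) h * delta q x h) / delta q (\<mu> k / \<mu> (Suc k)) h"
    unfolding x_def m_def by (rule rec[unfolded position_recursion_def, rule_format, OF \<sigma> g])
  have 2: "weight_hat_norm q n (\<omega> \<circ> sk k) (z \<circ> \<sigma>) (z \<circ> sk j) \<mu> h =
    (weight_hat_norm q n \<omega> (z \<circ> \<sigma>) (z \<circ> sk j) (\<mu> \<circ> sk k) h * delta q x m -
     weight_hat_norm q n \<omega> (z \<circ> (\<sigma> \<circ> sk k)) (z \<circ> sk j) (\<mu> \<circ> sk k) h * delta q x h) / delta q (\<mu> k / \<mu> (Suc k)) h"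
    using rec[unfolded position_recursion_def, rule_format, OF permutes_compose[OF \<sigma> sj] g_z]
    unfolding comp_assoc[of "sk j" \<sigma> "sk k"] zz x_def[symmetric] m_def[symmetric] .
  show "weight_hat_norm q n (sk (\<omega> p) \<circ> \<omega> \<circ> sk k) (z \<circ> \<sigma>) z \<mu> h =
      (weight_hat_norm q n (sk (\<omega> p) \<circ> \<omega>) (z \<circ> \<sigma>) z (\<mu> \<circ> sk k) h * delta q (z (\<sigma> (Suc k)) / z (\<sigma> k)) (\<mu> (Suc k) / \<mu> k) -
       weight_hat_norm q n (sk (\<omega> p) \<circ> \<omega>) (z \<circ> (\<sigma> \<circ> sk k)) z (\<mu> \<circ> sk k) h * delta q (z (\<sigma> (Suc k)) / z (\<sigma> k)) h) /
      delta q (\<mu> k / \<mu> (Suc k)) h"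
    unfolding j_def[symmetric] comp_assoc[of "sk j" \<omega> "sk k"] L R[OF \<sigma>] R[OF \<sigma>'] 1 2 x_def[symmetric] m_def[symmetric]
    by (simp add: add_divide_distrib diff_divide_distrib algebra_simps)
qed

text \<open>Since \<open>x / 0 = 0\<close>, the recursion is trivial if \<open>\<vartheta>'(1) = 0\<close>, which spares a proof that this
  never happens.\<close>

lemma weight_hat_degenerate:
  assumes "theta'1 q = 0" "n \<ge> 2"
  shows "weight_hat q n \<omega> \<gamma> z \<mu> h = 0"
proof -
  have "2 * 3 \<le> n * (2 * n - 1)" using assms(2) by (intro mult_le_mono) auto
  also have "\<dots> \<le> (n - 1) * (n * (2 * n - 1))" using assms(2) by simp
  finally have "1 \<le> (n - 1) * n * (2 * n - 1) div 6"
    using div_le_mono[of 6 _ 6] by (simp add: mult.assoc)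
  then show ?thesis using assms(1) by (simp add: weight_hat_def weight_def zero_power)
qed

lemma position_recursion:
  assumes q: "norm q < 1" and k: "1 \<le> k" "k < n" and \<omega>: "\<omega> permutes {1..n}"
  shows "position_recursion q n k \<omega>"
proof (cases "theta'1 q = 0")
  case True
  then show ?thesis
    using weight_hat_degenerate[OF True, of n] k by (simp add: position_recursion_def weight_hat_norm_eq)
next
  case theta: False
  show ?thesis
    using \<omega>
  proof (induction rule: permutes_adjacent_induct)
    case id
    show ?case by (rule position_recursion_id[OF q k])
  next
    case (swap \<omega> p r)
    show ?case
    proof (cases "p = k \<and> r = Suc k")
      case eq: True
      \<comment> \<open>Here the exchanged values stand at the positions k and k+1, so the new
        permutation is \<omega> o s_k and the involution property settles the case.\<close>
      have e: "sk (\<omega> p) \<circ> \<omega> = \<omega> \<circ> sk k"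
      proof
        fix i
        have "\<omega> i = \<omega> k \<longleftrightarrow> i = k" "\<omega> i = \<omega> (Suc k) \<longleftrightarrow> i = Suc k"
          using permutes_inj[OF swap.hyps(1)] by (auto dest: injD)
        then show "(sk (\<omega> p) \<circ> \<omega>) i = (\<omega> \<circ> sk k) i"
          using eq swap.hyps(5) by (cases "i = k"; cases "i = Suc k") (auto simp: sk_simps)
      qed
      show ?thesis unfolding e by (rule position_recursion_swap[OF q theta k swap.IH])
    next
      case False
      show ?thesis by (rule position_recursion_swap_values[OF q k swap.hyps False swap.IH])
    qed
  qed
qed

section \<open>Removing the normalization\<close>

lemma inversion_product_swap:
  assumes "1 \<le> k" "k < n" "\<omega> k < \<omega> (Suc k)"
  shows "(\<Prod>(i, j)\<in>inversions n (\<omega> \<circ> sk k). delta q (\<mu> i / \<mu> j) h) =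
    delta q (\<mu> k / \<mu> (Suc k)) h * (\<Prod>(i, j)\<in>inversions n \<omega>. delta q ((\<mu> \<circ> sk k) i / (\<mu> \<circ> sk k) j) h)"
  unfolding inversions_right(1)[of k n \<omega>, OF assms]
  using inversions_right(2)[of k n \<omega>, OF assms]
  by (subst prod.insert) (auto simp: prod.reindex[OF inj_map_prod_sk] case_prod_unfold intro!: prod.cong)

lemma delta_mu_nonzero:
  assumes "generic q n z \<mu> h" "theta'1 q \<noteq> 0" "i \<in> {1..n}" "j \<in> {1..n}" "i \<noteq> j"
  shows "delta q (\<mu> i / \<mu> j) h \<noteq> 0"
  using genericD(2)[OF assms(1)] genericD(6,7)[OF assms(1,3,4,5)] assms(2) by (simp add: delta_def mult.commute)

lemma inversion_product_nonzero:
  assumes "generic q n z \<mu> h" "theta'1 q \<noteq> 0"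
  shows "(\<Prod>(i, j)\<in>inversions n \<omega>. delta q (\<mu> i / \<mu> j) h) \<noteq> 0"
proof -
  have "delta q (\<mu> i / \<mu> j) h \<noteq> 0" if "(i, j) \<in> inversions n \<omega>" for i j
    using that by (intro delta_mu_nonzero[OF assms]) (auto simp: inversions_def)
  then show ?thesis by (auto simp: prod_zero_iff)
qed

theorem theorem11p1:
  fixes q :: complex and n k :: nat and \<omega> :: "nat \<Rightarrow> nat"
  assumes "norm q < 1" and "\<omega> permutes {1..n}" and "1 \<le> k" and "k \<le> n - 1"
  shows
    "(perm_length n (\<omega> \<circ> sk k) > perm_length n \<omega> \<longrightarrow>
        cls q n (weight_hat q n (\<omega> \<circ> sk k)) =
          s_mu k (cls q n (weight_hat q n \<omega>)) *
            cls q n (\<lambda>\<gamma> z \<mu> h. delta q (\<gamma> (k + 1) / \<gamma> k) (\<mu> (k + 1) / \<mu> k))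
          - s_mu k (s_gamma k (cls q n (weight_hat q n \<omega>))) *
            cls q n (\<lambda>\<gamma> z \<mu> h. delta q (\<gamma> (k + 1) / \<gamma> k) h))
     \<and>
     (perm_length n (\<omega> \<circ> sk k) < perm_length n \<omega> \<longrightarrow>
        cls q n (weight_hat q n (\<omega> \<circ> sk k)) =
          s_mu k (cls q n (weight_hat q n \<omega>)) *
            cls q n (\<lambda>\<gamma> z \<mu> h. delta q (\<gamma> (k + 1) / \<gamma> k) (\<mu> (k + 1) / \<mu> k) /
              (delta q (\<mu> k / \<mu> (k + 1)) h * delta q (\<mu> (k + 1) / \<mu> k) h))
          - s_mu k (s_gamma k (cls q n (weight_hat q n \<omega>))) *
            cls q n (\<lambda>\<gamma> z \<mu> h. delta q (\<gamma> (k + 1) / \<gamma> k) h /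
              (delta q (\<mu> k / \<mu> (k + 1)) h * delta q (\<mu> (k + 1) / \<mu> k) h)))
     \<and>
     cls q n (weight_hat_norm q n (\<omega> \<circ> sk k)) =
       s_mu k (cls q n (weight_hat_norm q n \<omega>)) *
         cls q n (\<lambda>\<gamma> z \<mu> h. delta q (\<gamma> (k + 1) / \<gamma> k) (\<mu> (k + 1) / \<mu> k) /
           delta q (\<mu> k / \<mu> (k + 1)) h)
       - s_mu k (s_gamma k (cls q n (weight_hat_norm q n \<omega>))) *
         cls q n (\<lambda>\<gamma> z \<mu> h. delta q (\<gamma> (k + 1) / \<gamma> k) h / delta q (\<mu> k / \<mu> (k + 1)) h)"
proof -
  have q: "norm q < 1" and \<omega>: "\<omega> permutes {1..n}" and k: "1 \<le> k" "k < n" using assms by auto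
  have sk: "sk k permutes {1..n}" by (rule sk_permutes[OF k])
  have \<omega>': "\<omega> \<circ> sk k permutes {1..n}" by (rule permutes_compose[OF sk \<omega>])
  \<comment> \<open>It suffices to compare restrictions at generic parameters: elsewhere all classes
    have the default value 0.\<close>
  have cls_rec: "cls q n F = s_mu k (cls q n G) * cls q n A - s_mu k (s_gamma k (cls q n G)) * cls q n B"
    if "\<And>\<sigma> z \<mu> h. \<sigma> permutes {1..n} \<Longrightarrow> generic q n z \<mu> h \<Longrightarrow>
      F (z \<circ> \<sigma>) z \<mu> h = G (z \<circ> \<sigma>) z (\<mu> \<circ> sk k) h * A (z \<circ> \<sigma>) z \<mu> h -
        G (z \<circ> (\<sigma> \<circ> sk k)) z (\<mu> \<circ> sk k) h * B (z \<circ> \<sigma>) z \<mu> h" for F G A B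
  proof (intro ext)
    fix \<sigma> z \<mu> h
    show "cls q n F \<sigma> z \<mu> h = (s_mu k (cls q n G) * cls q n A - s_mu k (s_gamma k (cls q n G)) * cls q n B) \<sigma> z \<mu> h"
    proof (cases "\<sigma> permutes {1..n} \<and> generic q n z \<mu> h")
      case True
      then have "\<sigma> \<circ> sk k permutes {1..n}" "generic q n z (\<mu> \<circ> sk k) h"
        using permutes_compose[OF sk] generic_permute(2)[OF _ sk] by blast+
      then show ?thesis using True that by (simp add: cls_def s_mu_def s_gamma_def)
    qed (auto simp: cls_def)
  qed
  have rec: "weight_hat_norm q n (\<omega> \<circ> sk k) (z \<circ> \<sigma>) z \<mu> h =
       (weight_hat_norm q n \<omega> (z \<circ> \<sigma>) z (\<mu> \<circ> sk k) h * delta q (z (\<sigma> (Suc k)) / z (\<sigma> k)) (\<mu> (Suc k) / \<mu> k) -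
        weight_hat_norm q n \<omega> (z \<circ> (\<sigma> \<circ> sk k)) z (\<mu> \<circ> sk k) h * delta q (z (\<sigma> (Suc k)) / z (\<sigma> k)) h) /
       delta q (\<mu> k / \<mu> (Suc k)) h"
    if "\<sigma> permutes {1..n}" "generic q n z \<mu> h" for \<sigma> z \<mu> h
    using position_recursion[OF q k \<omega>] that unfolding position_recursion_def by blast
  define N where "N w \<mu> h = (\<Prod>(i, j)\<in>inversions n w. delta q (\<mu> i / \<mu> j) h)" for w \<mu> h
  \<comment> \<open>If \<open>theta'1 q\<close> vanishes, so do both sides; otherwise genericity
    makes the product nonzero and it cancels.\<close>
  have N: "weight_hat q n w \<gamma> z \<mu> h = weight_hat_norm q n w \<gamma> z \<mu> h * N w \<mu> h" if "generic q n z \<mu> h" for w \<gamma> z \<mu> h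
  proof (cases "theta'1 q = 0")
    case True
    then show ?thesis using weight_hat_degenerate[OF True, of n] k by (simp add: weight_hat_norm_eq)
  next
    case False
    then show ?thesis using inversion_product_nonzero[OF that False] by (simp add: weight_hat_norm_eq N_def)
  qed
  have d: "delta q (\<mu> k / \<mu> (Suc k)) h \<noteq> 0" "delta q (\<mu> (Suc k) / \<mu> k) h \<noteq> 0"
    if "generic q n z \<mu> h" "theta'1 q \<noteq> 0" for z \<mu> h
    using k by (intro delta_mu_nonzero[OF that]; simp)+
  have up: "weight_hat q n (\<omega> \<circ> sk k) (z \<circ> \<sigma>) z \<mu> h =
      weight_hat q n \<omega> (z \<circ> \<sigma>) z (\<mu> \<circ> sk k) h * delta q ((z \<circ> \<sigma>) (k + 1) / (z \<circ> \<sigma>) k) (\<mu> (k + 1) / \<mu> k) -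
      weight_hat q n \<omega> (z \<circ> (\<sigma> \<circ> sk k)) z (\<mu> \<circ> sk k) h * delta q ((z \<circ> \<sigma>) (k + 1) / (z \<circ> \<sigma>) k) h"
    if "\<omega> k < \<omega> (Suc k)" "\<sigma> permutes {1..n}" "generic q n z \<mu> h" for \<sigma> z \<mu> h
  proof (cases "theta'1 q = 0")
    case True
    then show ?thesis using weight_hat_degenerate[OF True, of n] k by simp
  next
    case False
    \<comment> \<open>The factor of the new inversion cancels the divisor in the normalized
      recursion.\<close>
    have "N (\<omega> \<circ> sk k) \<mu> h = delta q (\<mu> k / \<mu> (Suc k)) h * N \<omega> (\<mu> \<circ> sk k) h"
      unfolding N_def by (rule inversion_product_swap[OF k that(1)])
    then show ?thesis
      using d[OF that(3) False]
      unfolding N[OF that(3)] N[OF generic_permute(2)[OF that(3) sk]] rec[OF that(2,3)]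
      by (simp add: field_simps)
  qed
  have down: "weight_hat q n (\<omega> \<circ> sk k) (z \<circ> \<sigma>) z \<mu> h =
      weight_hat q n \<omega> (z \<circ> \<sigma>) z (\<mu> \<circ> sk k) h * (delta q ((z \<circ> \<sigma>) (k + 1) / (z \<circ> \<sigma>) k) (\<mu> (k + 1) / \<mu> k) /
        (delta q (\<mu> k / \<mu> (k + 1)) h * delta q (\<mu> (k + 1) / \<mu> k) h)) -
      weight_hat q n \<omega> (z \<circ> (\<sigma> \<circ> sk k)) z (\<mu> \<circ> sk k) h * (delta q ((z \<circ> \<sigma>) (k + 1) / (z \<circ> \<sigma>) k) h /
        (delta q (\<mu> k / \<mu> (k + 1)) h * delta q (\<mu> (k + 1) / \<mu> k) h))"
    if "\<omega> (Suc k) < \<omega> k" "\<sigma> permutes {1..n}" "generic q n z \<mu> h" for \<sigma> z \<mu> h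
  proof (cases "theta'1 q = 0")
    case True
    then show ?thesis using weight_hat_degenerate[OF True, of n] k by simp
  next
    case False
    \<comment> \<open>Now \<omega> has the additional inversion. Its factor, with \<mu>_k and
      \<mu>_(k+1) exchanged, joins the divisor of the normalized recursion and gives the product of
      two deltas.\<close>
    have "N \<omega> (\<mu> \<circ> sk k) h = delta q (\<mu> (Suc k) / \<mu> k) h * N (\<omega> \<circ> sk k) \<mu> h"
      using inversion_product_swap[of k n "\<omega> \<circ> sk k" q "\<mu> \<circ> sk k" h] k that(1)
      unfolding N_def sk_sk(3) by (simp add: sk_simps)
    then show ?thesis
      using d[OF that(3) False]
      unfolding N[OF that(3)] N[OF generic_permute(2)[OF that(3) sk]] rec[OF that(2,3)]
      by (simp add: field_simps)
  qed
  have ne: "\<omega> k \<noteq> \<omega> (Suc k)" using permutes_inj[OF \<omega>] by (metis injD n_not_Suc_n)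
  have less: "\<omega> k < \<omega> (Suc k)" if "perm_length n (\<omega> \<circ> sk k) > perm_length n \<omega>"
  proof (rule ccontr)
    assume "\<not> \<omega> k < \<omega> (Suc k)"
    then show False
      using perm_length_swap[OF \<omega>' k] that ne by (simp add: sk_simps sk_sk)
  qed
  have greater: "\<omega> (Suc k) < \<omega> k" if "perm_length n (\<omega> \<circ> sk k) < perm_length n \<omega>"
  proof (rule ccontr)
    assume "\<not> \<omega> (Suc k) < \<omega> k"
    then show False using perm_length_swap[OF \<omega> k] that ne by simp
  qed
  show ?thesis
  proof (intro conjI impI)
    show "cls q n (weight_hat q n (\<omega> \<circ> sk k)) = s_mu k (cls q n (weight_hat q n \<omega>)) *
            cls q n (\<lambda>\<gamma> z \<mu> h. delta q (\<gamma> (k + 1) / \<gamma> k) (\<mu> (k + 1) / \<mu> k))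
          - s_mu k (s_gamma k (cls q n (weight_hat q n \<omega>))) *
            cls q n (\<lambda>\<gamma> z \<mu> h. delta q (\<gamma> (k + 1) / \<gamma> k) h)"
      if "perm_length n (\<omega> \<circ> sk k) > perm_length n \<omega>"
      by (rule cls_rec) (rule up[OF less[OF that]])
    show "cls q n (weight_hat q n (\<omega> \<circ> sk k)) = s_mu k (cls q n (weight_hat q n \<omega>)) *
            cls q n (\<lambda>\<gamma> z \<mu> h. delta q (\<gamma> (k + 1) / \<gamma> k) (\<mu> (k + 1) / \<mu> k) /
              (delta q (\<mu> k / \<mu> (k + 1)) h * delta q (\<mu> (k + 1) / \<mu> k) h))
          - s_mu k (s_gamma k (cls q n (weight_hat q n \<omega>))) *
            cls q n (\<lambda>\<gamma> z \<mu> h. delta q (\<gamma> (k + 1) / \<gamma> k) h /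
              (delta q (\<mu> k / \<mu> (k + 1)) h * delta q (\<mu> (k + 1) / \<mu> k) h))"
      if "perm_length n (\<omega> \<circ> sk k) < perm_length n \<omega>"
      by (rule cls_rec) (rule down[OF greater[OF that]])
    show "cls q n (weight_hat_norm q n (\<omega> \<circ> sk k)) = s_mu k (cls q n (weight_hat_norm q n \<omega>)) *
         cls q n (\<lambda>\<gamma> z \<mu> h. delta q (\<gamma> (k + 1) / \<gamma> k) (\<mu> (k + 1) / \<mu> k) / delta q (\<mu> k / \<mu> (k + 1)) h)
       - s_mu k (s_gamma k (cls q n (weight_hat_norm q n \<omega>))) *
         cls q n (\<lambda>\<gamma> z \<mu> h. delta q (\<gamma> (k + 1) / \<gamma> k) h / delta q (\<mu> k / \<mu> (k + 1)) h)"
      by (rule cls_rec) (simp add: rec diff_divide_distrib)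
  qed
qed

end
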